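(* Let $\mathscr{B}\subseteq\mathbb{N}$, and let $(n_k)_{k=1}^\infty$ be a strictly increasing sequence of positive integers such that $$\lim_{m\to\infty}\limsup_{k\to\infty}\frac1{n_k}\bigl|\{0\le j<n_k:(\eta_{\mathscr{B}(m)})_j\ne(\eta_{\mathscr{B}})_j\}\bigr|=0$$ (such a sequence exists by the Davenport--Erdős theorem). For $m\ge1$ let $\nu_m$ be the unique ergodic shift-invariant measure on the periodic orbit $X_{\mathscr{B}(m)}$. Then there exists an ergodic shift-invariant Borel probability measure $\nu$ on $X_{\mathscr{B}}$ (the Mirsky measure) such that $$\lim_{m\to\infty}\bar d_{\mathcal{M}}(\nu_m,\nu)=0,$$ and $\eta_{\mathscr{B}}$ is quasi-generic for $\nu$ along $(n_k)_{k=1}^\infty$. Furthermore, $\nu$ has rational discrete spectrum, and in particular its entropy $h(\nu)$ is $0$.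
   Context: For $\mathscr{B}\subseteq\mathbb{N}$ let $\mathscr{F}_{\mathscr{B}}=\mathbb{Z}\setminus\bigcup_{b\in\mathscr{B}}b\mathbb{Z}$, and let $\eta_{\mathscr{B}}\in\{0,1\}^{\mathbb{Z}}$ be its characteristic sequence: $(\eta_{\mathscr{B}})_j=1$ if $j\in\mathscr{F}_{\mathscr{B}}$ and $0$ otherwise. Let $\sigma$ be the shift on $\{0,1\}^{\mathbb{Z}}$, $\sigma(x)_i=x_{i+1}$, and let $X_{\mathscr{B}}$ be the closure of the $\sigma$-orbit of $\eta_{\mathscr{B}}$. $\mathscr{B}(k)$ is the set of the $k$ smallest elements of $\mathscr{B}$ (with $\mathscr{B}(k)=\mathscr{B}$ if $\mathscr{B}$ has at most $k$ elements); $\eta_{\mathscr{B}(k)}$ is a periodic point, so $X_{\mathscr{B}(k)}$ is a periodic orbit. Measures on $X_{\mathscr{B}}$ and $X_{\mathscr{B}(k)}$ are regarded as measures on $\{0,1\}^{\mathbb{Z}}$. For $\sigma$-invariant Borel probability measures $\mu,\nu$ on $\{0,1\}^{\mathbb{Z}}$, $\bar d_{\mathcal{M}}(\mu,\nu)=\inf_\lambda\lambda(\{(x,y):x_0\ne y_0\})$, the infimum being over all $\sigma\times\sigma$-invariant Borel probability measures $\lambda$ on $\{0,1\}^{\mathbb{Z}}\times\{0,1\}^{\mathbb{Z}}$ with marginals $\mu$ and $\nu$ (Ornstein's d-bar metric). A point $x$ is quasi-generic for $\nu$ along $(n_k)$ if $\frac1{n_k}\sum_{j=0}^{n_k-1}f(\sigma^j(x))\to\int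 f\,d\nu$ for every continuous $f$. $\nu$ has rational discrete spectrum if the eigenfunctions of the Koopman operator $f\mapsto f\circ\sigma$ span a dense subspace of $L^2(\nu)$ and all its eigenvalues are roots of unity. $h(\nu)$ is Kolmogorov--Sinai entropy. *)

theory Defs
  imports "HOL-Probability.Probability"
begin

section \<open>The shift space\<close>

text \<open>
  Points of the full shift are functions of type \<open>int \<Rightarrow> bool\<close>, with \<open>True\<close> in the role of the
  symbol 1.  The topology on \<open>bool\<close> is discrete, the one on \<open>int \<Rightarrow> bool\<close> is the product topology,
  and \<open>borel\<close> refers to the latter.  Second countability of \<open>bool\<close> carries over to the full shift, so
  that the Borel sets of its square are those of the product measurable space.
\<close>

instance bool :: second_countable_topology
proof
  have "open = generate_topology (UNIV :: bool set set)"
    by (intro ext iffI Topological_Spaces.open_discrete generate_topology.Basis UNIV_I)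
  then show "\<exists>B :: bool set set. countable B \<and> open = generate_topology B"
    by (intro exI[of _ UNIV]) simp
qed

definition shift_map :: "(int \<Rightarrow> 'a) \<Rightarrow> int \<Rightarrow> 'a" where
  "shift_map x = (\<lambda>i. x (i + 1))"

text \<open>
  The shift is invertible and its \<open>m\<close>-th iterate, for an integer \<open>m\<close>, is translation by \<open>m\<close>;
  the orbit is the two-sided one.
\<close>

definition shift_orbit :: "(int \<Rightarrow> 'a) \<Rightarrow> (int \<Rightarrow> 'a) set" where
  "shift_orbit x = range (\<lambda>m::int. (\<lambda>i. x (i + m)))"

definition free_set :: "nat set \<Rightarrow> int set" where
  "free_set B = UNIV - (\<Union>b\<in>B. {int b * k |k. True})"

definition eta :: "nat set \<Rightarrow> int \<Rightarrow> bool" where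
  "eta B j \<longleftrightarrow> j \<in> free_set B"

definition subshift :: "nat set \<Rightarrow> (int \<Rightarrow> bool) set" where
  "subshift B = closure (shift_orbit (eta B))"

text \<open>The set of the \<open>k\<close> smallest elements of \<open>B\<close>, and \<open>B\<close> itself if it has at most \<open>k\<close> elements.\<close>

definition smallest :: "nat set \<Rightarrow> nat \<Rightarrow> nat set" where
  "smallest B k = {b \<in> B. card {a \<in> B. a < b} < k}"


section \<open>Invariant measures\<close>

definition invariant_prob :: "('a::topological_space \<Rightarrow> 'a) \<Rightarrow> 'a measure \<Rightarrow> bool" where
  "invariant_prob T M \<longleftrightarrow>
     prob_space M \<and> sets M = sets borel \<and> T \<in> measurable M M \<and> distr M M T = M"

definition ergodic_prob :: "('a::topological_space \<Rightarrow> 'a) \<Rightarrow> 'a measure \<Rightarrow> bool" where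
  "ergodic_prob T M \<longleftrightarrow> invariant_prob T M \<and>
     (\<forall>A\<in>sets M. T -` A = A \<longrightarrow> measure M A = 0 \<or> measure M A = 1)"

text \<open>Measures on a subshift are measures on the full shift that are concentrated on it.\<close>

definition periodic_measure :: "nat set \<Rightarrow> nat \<Rightarrow> (int \<Rightarrow> bool) measure" where
  "periodic_measure B m =
     (THE M. ergodic_prob shift_map M \<and> measure M (subshift (smallest B m)) = 1)"

definition joinings ::
    "(int \<Rightarrow> bool) measure \<Rightarrow> (int \<Rightarrow> bool) measure \<Rightarrow> ((int \<Rightarrow> bool) \<times> (int \<Rightarrow> bool)) measure set" where
  "joinings M N = {L. invariant_prob (map_prod shift_map shift_map) L \<and>
     distr L borel fst = M \<and> distr L borel snd = N}"

definition dbar :: "(int \<Rightarrow> bool) measure \<Rightarrow> (int \<Rightarrow> bool) measure \<Rightarrow> real" where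
  "dbar M N = (INF L\<in>joinings M N. measure L {(x, y). x 0 \<noteq> y 0})"

definition quasi_generic_along ::
    "(nat \<Rightarrow> nat) \<Rightarrow> (int \<Rightarrow> bool) \<Rightarrow> (int \<Rightarrow> bool) measure \<Rightarrow> bool" where
  "quasi_generic_along n x M \<longleftrightarrow>
     (\<forall>f::(int \<Rightarrow> bool) \<Rightarrow> real. continuous_on UNIV f \<longrightarrow>
        (\<lambda>k. (\<Sum>j<n k. f ((shift_map ^^ j) x)) / real (n k)) \<longlonglongrightarrow> integral\<^sup>L M f)"


section \<open>Rational discrete spectrum\<close>

text \<open>Elements of the complex \<open>L\<^sup>2\<close> space are represented by functions, not by a.e.-classes.\<close>

definition square_integrable :: "'a measure \<Rightarrow> ('a \<Rightarrow> complex) \<Rightarrow> bool" where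
  "square_integrable M f \<longleftrightarrow> f \<in> borel_measurable M \<and> integrable M (\<lambda>x. (cmod (f x))\<^sup>2)"

definition koopman_eigenfunction ::
    "('a \<Rightarrow> 'a) \<Rightarrow> 'a measure \<Rightarrow> complex \<Rightarrow> ('a \<Rightarrow> complex) \<Rightarrow> bool" where
  "koopman_eigenfunction T M c f \<longleftrightarrow>
     square_integrable M f \<and> \<not> (AE x in M. f x = 0) \<and> (AE x in M. (f \<circ> T) x = c * f x)"

definition discrete_spectrum :: "('a \<Rightarrow> 'a) \<Rightarrow> 'a measure \<Rightarrow> bool" where
  "discrete_spectrum T M \<longleftrightarrow>
     (\<forall>g e. square_integrable M g \<longrightarrow> 0 < e \<longrightarrow>
        (\<exists>F a. finite F \<and> (\<forall>f\<in>F. \<exists>c. koopman_eigenfunction T M c f) \<and>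
           sqrt (LINT x|M. (cmod (g x - (\<Sum>f\<in>F. a f * f x)))\<^sup>2) < e))"

definition rational_discrete_spectrum :: "('a \<Rightarrow> 'a) \<Rightarrow> 'a measure \<Rightarrow> bool" where
  "rational_discrete_spectrum T M \<longleftrightarrow> discrete_spectrum T M \<and>
     (\<forall>c f. koopman_eigenfunction T M c f \<longrightarrow> (\<exists>q>0. c ^ q = 1))"


section \<open>Kolmogorov--Sinai entropy\<close>

definition finite_partition :: "'a measure \<Rightarrow> 'a set set \<Rightarrow> bool" where
  "finite_partition M P \<longleftrightarrow> finite P \<and> P \<subseteq> sets M \<and> disjoint P \<and> \<Union>P = space M"

text \<open>Empty cells contribute nothing, since \<open>0 * ln 0 = 0\<close>.\<close>

definition partition_entropy :: "'a measure \<Rightarrow> 'a set set \<Rightarrow> real" where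
  "partition_entropy M P = - (\<Sum>A\<in>P. measure M A * ln (measure M A))"

text \<open>
  The common refinement of the preimages of \<open>P\<close> under the first \<open>n\<close> iterates \<open>T ^^ i\<close>, \<open>i < n\<close>.
\<close>

primrec iterated_partition :: "('a \<Rightarrow> 'a) \<Rightarrow> 'a measure \<Rightarrow> 'a set set \<Rightarrow> nat \<Rightarrow> 'a set set" where
  "iterated_partition T M P 0 = {space M}"
| "iterated_partition T M P (Suc n) =
     {A \<inter> ((T ^^ n) -` C \<inter> space M) |A C. A \<in> iterated_partition T M P n \<and> C \<in> P}"

definition entropy_wrt :: "('a \<Rightarrow> 'a) \<Rightarrow> 'a measure \<Rightarrow> 'a set set \<Rightarrow> real" where
  "entropy_wrt T M P = lim (\<lambda>n. partition_entropy M (iterated_partition T M P n) / real n)"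

definition KS_entropy :: "('a \<Rightarrow> 'a) \<Rightarrow> 'a measure \<Rightarrow> ereal" where
  "KS_entropy T M = (SUP P\<in>{P. finite_partition M P}. ereal (entropy_wrt T M P))"

end

theory Submission
  imports Defs
begin

text \<open>
  Let \<open>w\<close> be a random profinite integer, that is, a compatible family of residues modulo all
  \<open>N!\<close>, each uniformly distributed, and let \<open>\<tau>\<close> be the addition of 1.  Since \<open>w\<close> has a residue
  modulo every \<open>b\<close>, the translate \<open>\<eta>\<^sub>B(\<sqdot> + w)\<close> makes sense: its coordinate \<open>j\<close> is 1 iff no
  \<open>b \<in> B\<close> divides \<open>j + w\<close>.  The Mirsky measure \<open>\<nu>\<close> is the law of this random sequence
  (\<open>translated_eta\<close>).  Adding 1 to \<open>w\<close> shifts the sequence, so the full shift with \<open>\<nu>\<close> is a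
  factor of the odometer \<open>\<tau>\<close>, and most claims are claims about factors of the odometer.

  All measures in question live on the same probability space: for a finite set \<open>B(m)\<close> the translate
  by \<open>w\<close> is an ordinary translate of \<open>\<eta>\<^bsub>B(m)\<^esub>\<close>, so its law is an invariant measure on the periodic
  orbit, hence equal to \<open>\<nu>\<^sub>m\<close>.  The pair of translates is therefore a joining of \<open>\<nu>\<^sub>m\<close>
  and \<open>\<nu>\<close>, and its two sequences differ at 0 with probability tending to 0, because the 0-th coordinates
  for \<open>B(m)\<close> decrease to the one for \<open>B\<close>.  This gives convergence in d-bar
  (\<open>dbar_periodic_mirsky_tendsto_0\<close>).  Integrals of continuous functions converge for the same
  reason; averages along the periodic \<open>\<eta>\<^bsub>B(m)\<^esub>\<close> converge to the integral with respect to \<open>\<nu>\<^sub>m\<close>, and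
  by the assumption they are close, for large \<open>m\<close> and then large \<open>k\<close>, to those along \<open>\<eta>\<^sub>B\<close>, so
  \<open>\<eta>\<^sub>B\<close> is quasi-generic for \<open>\<nu>\<close> (\<open>quasi_generic_mirsky\<close>).  A measure for which
  \<open>\<eta>\<^sub>B\<close> is quasi-generic is concentrated on the orbit closure.

  The odometer enters through one fact: functions of a single residue are dense in \<open>L\<^sup>2\<close>
  (\<open>residue_functions_dense\<close>).  It has three consequences.  A square-integrable
  function with vanishing integral over every residue class is 0; as the integrals of an
  eigenfunction over the \<open>N!\<close> consecutive classes form a cyclic geometric progression with the eigenvalue
  as ratio, eigenvalues are roots of unity and invariant events are trivial.  Next, conditional probabilities
  of the residue classes given the point of the factor are permuted cyclically by the shift, so that their
  discrete Fourier transforms are eigenfunctions of the factor; by Jensen's inequality their span is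
  dense as well (\<open>discrete_spectrum_factor\<close>).  Finally, every finite partition of the factor agrees, up to a
  set of small measure, with a function of one residue; the itinerary of a point is then close in
  Hamming distance to one of \<open>N!\<close> periodic words, and there are too few such itineraries for positive entropy
  (\<open>KS_entropy_factor\<close>).
\<close>

section \<open>The odometer\<close>

text \<open>
  \<open>a N w\<close> is the residue of the profinite integer \<open>w\<close> modulo \<open>N!\<close>.  Factorials are used since they
  form a chain under divisibility in which every modulus eventually occurs.  The last assumption says that
  the residues generate the \<open>\<sigma>\<close>-algebra up to null sets, in the approximate form in which it is
  applied.
\<close>

locale odometer = prob_space P for P :: "'w measure" +
  fixes \<tau> :: "'w \<Rightarrow> 'w" and a :: "nat \<Rightarrow> 'w \<Rightarrow> nat"
  assumes tau_measurable [measurable]: "\<tau> \<in> measurable P P"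
    and tau_invariant: "distr P P \<tau> = P"
    and residue_measurable [measurable]: "\<And>N. a N \<in> measurable P (count_space UNIV)"
    and residue_less: "\<And>N w. w \<in> space P \<Longrightarrow> a N w < fact N"
    and residue_mod: "\<And>N M w. w \<in> space P \<Longrightarrow> N \<le> M \<Longrightarrow> a M w mod fact N = a N w"
    and residue_tau: "\<And>N w. w \<in> space P \<Longrightarrow> a N (\<tau> w) = (a N w + 1) mod fact N"
    and residue_uniform: "\<And>N s. s < fact N \<Longrightarrow> prob {w \<in> space P. a N w = s} = 1 / fact N"
    and residues_generate: "\<And>A e. A \<in> events \<Longrightarrow> 0 < e \<Longrightarrow>
          \<exists>N S. prob (sym_diff A {w \<in> space P. a N w \<in> S}) < e"

lemma bij_betw_succ_mod:
  assumes "0 < (Q::nat)"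
  shows "bij_betw (\<lambda>s. (s + 1) mod Q) {..<Q} {..<Q}"
proof -
  have "inj_on (\<lambda>s. (s + 1) mod Q) {..<Q}"
    by (auto simp: inj_on_def mod_Suc split: if_splits)
  moreover have "(\<lambda>s. (s + 1) mod Q) ` {..<Q} \<subseteq> {..<Q}"
    using assms by auto
  ultimately show ?thesis
    by (simp add: bij_betw_def endo_inj_surj)
qed

section \<open>Digits in the factorial number system\<close>

text \<open>
  \<open>digit n i\<close> is the coefficient of \<open>i!\<close> in the factorial expansion of \<open>n\<close>, a number between 0
  and \<open>i\<close>.  A profinite integer is an infinite sequence of such digits, and independent uniform digits
  give the Haar measure.
\<close>

definition digit :: "nat \<Rightarrow> nat \<Rightarrow> nat" where
  "digit n i = n div fact i mod Suc i"

definition digit_sum :: "nat \<Rightarrow> (nat \<Rightarrow> nat) \<Rightarrow> nat" where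
  "digit_sum N d = (\<Sum>i<N. d i * fact i)"

lemma digit_sum_Suc: "digit_sum (Suc N) d = digit_sum N d + d N * fact N"
  by (simp add: digit_sum_def)

lemma digit_sum_cong: "(\<And>i. i < N \<Longrightarrow> d i = d' i) \<Longrightarrow> digit_sum N d = digit_sum N d'"
  by (simp add: digit_sum_def)

lemma digit_sum_less:
  assumes "\<And>i. i < N \<Longrightarrow> d i \<le> i"
  shows "digit_sum N d < fact N"
  using assms
proof (induction N)
  case 0
  then show ?case by (simp add: digit_sum_def)
next
  case (Suc N)
  have "digit_sum N d < fact N" using Suc by simp
  moreover have "d N * fact N \<le> N * fact N"
    using Suc.prems[of N] by (intro mult_right_mono) auto
  ultimately show ?case by (simp only: digit_sum_Suc fact_Suc of_nat_id mult_Suc)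
qed

lemma digit_sum_digit: "digit_sum N (digit n) = n mod fact N"
proof (induction N)
  case 0
  then show ?case by (simp add: digit_sum_def)
next
  case (Suc N)
  have "n mod fact (Suc N) = n mod (fact N * Suc N)"
    by (simp add: mult.commute)
  then show ?case
    using Suc by (simp only: mod_mult2_eq digit_sum_Suc digit_def) (simp add: mult.commute)
qed

text \<open>
  For \<open>i < N\<close> the number \<open>N!\<close> is a multiple of \<open>(i + 1)!\<close>, so reduction modulo \<open>N!\<close> does not touch
  the digit of index \<open>i\<close>.
\<close>

lemma digit_mod_fact:
  assumes "i < N"
  shows "digit (n mod fact N) i = digit n i"
proof -
  have "(fact (Suc i)::nat) dvd fact N"
    using assms by (intro fact_dvd) simp
  then obtain k where "(fact N :: nat) = fact (Suc i) * k" by (rule dvdE)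
  then have k: "(fact N :: nat) = fact i * (Suc i * k)"
    by (simp add: algebra_simps)
  have "n mod fact N div fact i = n div fact i mod (Suc i * k)"
    unfolding k mod_mult2_eq by simp
  then show ?thesis
    by (simp only: digit_def) (simp add: mod_mod_cancel del: mult_Suc)
qed

lemma digit_digit_sum:
  assumes "\<And>i. i < N \<Longrightarrow> d i \<le> i" "i < N"
  shows "digit (digit_sum N d) i = d i"
  using assms
proof (induction N)
  case (Suc N)
  have less: "digit_sum N d < fact N"
    using Suc.prems by (intro digit_sum_less) auto
  show ?case
  proof (cases "i = N")
    case True
    then show ?thesis using less Suc.prems(1)[of N]
      by (simp add: digit_sum_Suc digit_def)
  next
    case False
    then have "i < N" using Suc.prems by simp
    have "digit (digit_sum (Suc N) d) i = digit (digit_sum (Suc N) d mod fact N) i"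
      using digit_mod_fact[OF \<open>i < N\<close>] by simp
    also have "digit_sum (Suc N) d mod fact N = digit_sum N d"
      using less by (simp add: digit_sum_Suc)
    also have "digit (digit_sum N d) i = d i"
      using Suc \<open>i < N\<close> by simp
    finally show ?thesis .
  qed
qed simp

lemma digit_sum_mod:
  assumes "\<And>i. d i \<le> i" "N \<le> M"
  shows "digit_sum M d mod fact N = digit_sum N d"
proof -
  have "digit_sum M d mod fact N = digit_sum N (digit (digit_sum M d))"
    by (simp add: digit_sum_digit)
  also have "\<dots> = digit_sum N d"
    using assms by (intro digit_sum_cong digit_digit_sum) auto
  finally show ?thesis .
qed

text \<open>
  Addition of 1 with carry.  The new digit of index \<open>i\<close> depends only on the residue modulo \<open>(i + 1)!\<close>, so
  no infinite carry has to be followed.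
\<close>

definition digit_succ :: "(nat \<Rightarrow> nat) \<Rightarrow> nat \<Rightarrow> nat" where
  "digit_succ d i = digit (digit_sum (Suc i) d + 1) i"

lemma digit_sum_digit_succ:
  assumes "\<And>i. d i \<le> i"
  shows "digit_sum N (digit_succ d) = (digit_sum N d + 1) mod fact N"
proof -
  have "digit_sum N (digit_succ d) = digit_sum N (digit (digit_sum N d + 1))"
  proof (rule digit_sum_cong)
    fix i assume i: "i < N"
    have "(digit_sum N d + 1) mod fact (Suc i) = (digit_sum N d mod fact (Suc i) + 1) mod fact (Suc i)"
      by (simp add: mod_simps del: fact_Suc)
    also have "\<dots> = (digit_sum (Suc i) d + 1) mod fact (Suc i)"
      using assms i by (subst digit_sum_mod) auto
    finally have "digit ((digit_sum (Suc i) d + 1) mod fact (Suc i)) i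
        = digit ((digit_sum N d + 1) mod fact (Suc i)) i"
      by simp
    then show "digit_succ d i = digit (digit_sum N d + 1) i"
      by (simp add: digit_succ_def digit_mod_fact del: fact_Suc)
  qed
  then show ?thesis by (simp add: digit_sum_digit)
qed

definition digit_measure :: "(nat \<Rightarrow> nat) measure" where
  "digit_measure = PiM UNIV (\<lambda>i. uniform_count_measure {..i})"

lemma space_digit_measure: "space digit_measure = {d. \<forall>i. d i \<le> i}"
  by (auto simp: digit_measure_def space_PiM space_uniform_count_measure PiE_def Pi_def)

lemma prob_space_digits: "prob_space (uniform_count_measure {..i::nat})"
  by (rule prob_space_uniform_count_measure) auto

interpretation digit_measure: prob_space digit_measure
  unfolding digit_measure_def by (intro prob_space_PiM prob_space_digits)

lemma measurable_component_digit [measurable]: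
  "(\<lambda>d. d i) \<in> measurable digit_measure (count_space UNIV)"
proof -
  have "(\<lambda>d. d i) \<in> measurable digit_measure (uniform_count_measure {..i})"
    unfolding digit_measure_def by (rule measurable_component_singleton) simp
  also have "measurable digit_measure (uniform_count_measure {..i})
      = measurable digit_measure (count_space {..i})"
    by (rule measurable_cong_sets) (auto simp: sets_uniform_count_measure)
  finally show ?thesis
    by (rule measurable_compose[where g = "\<lambda>x. x"]) simp
qed

lemma measurable_digit_sum [measurable]:
  "digit_sum N \<in> measurable digit_measure (count_space UNIV)"
proof (induction N)
  case (Suc N)
  have "(\<lambda>d. n + d N * fact N) \<in> measurable digit_measure (count_space UNIV)" for n
    by (rule measurable_compose[OF measurable_component_digit]) simp
  from measurable_compose_countable[OF this Suc]
  show ?case unfolding digit_sum_Suc .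
qed (simp add: digit_sum_def[abs_def])

lemma measurable_digit_succ [measurable]: "digit_succ \<in> measurable digit_measure digit_measure"
proof -
  have "(\<lambda>d i. digit_succ d i) \<in> measurable digit_measure (PiM UNIV (\<lambda>i. uniform_count_measure {..i}))"
  proof (rule measurable_PiM_single')
    fix i :: nat
    have "(\<lambda>d. digit_succ d i) \<in> measurable digit_measure (count_space {..i})"
      unfolding digit_succ_def
      by (rule measurable_compose[OF measurable_digit_sum]) (auto simp: digit_def less_Suc_eq_le[symmetric])
    then show "(\<lambda>d. digit_succ d i) \<in> measurable digit_measure (uniform_count_measure {..i})"
      by (subst measurable_cong_sets[OF refl, of _ "count_space {..i}"])
         (auto simp: sets_uniform_count_measure)
  qed (auto simp: digit_succ_def digit_def space_uniform_count_measure less_Suc_eq_le[symmetric])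
  then show ?thesis by (simp add: digit_measure_def)
qed

lemma prob_digit_sum_eq:
  assumes "s < fact N"
  shows "digit_measure.prob {d \<in> space digit_measure. digit_sum N d = s} = 1 / fact N"
proof -
  let ?M = "\<lambda>i. uniform_count_measure {..i::nat}"
  have "{d \<in> space digit_measure. digit_sum N d = s}
      = prod_emb UNIV ?M {..<N} (PiE {..<N} (\<lambda>i. {digit s i}))"
  proof (intro set_eqI iffI)
    fix d assume d: "d \<in> {d \<in> space digit_measure. digit_sum N d = s}"
    then show "d \<in> prod_emb UNIV ?M {..<N} (PiE {..<N} (\<lambda>i. {digit s i}))"
      using digit_digit_sum[of N d]
      by (auto simp: prod_emb_iff space_digit_measure space_uniform_count_measure)
  next
    fix d assume d: "d \<in> prod_emb UNIV ?M {..<N} (PiE {..<N} (\<lambda>i. {digit s i}))"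
    then have "digit_sum N d = digit_sum N (digit s)"
      by (intro digit_sum_cong) (auto simp: prod_emb_iff PiE_def Pi_def restrict_def split: if_splits)
    then show "d \<in> {d \<in> space digit_measure. digit_sum N d = s}"
      using d assms by (auto simp: digit_sum_digit prod_emb_iff space_digit_measure space_uniform_count_measure)
  qed
  also have "emeasure digit_measure \<dots> = (\<Prod>i<N. emeasure (?M i) {digit s i})"
    unfolding digit_measure_def
    by (rule emeasure_PiM_emb[OF prob_space_digits])
      (auto simp: sets_uniform_count_measure digit_def less_Suc_eq_le[symmetric])
  also have "\<dots> = (\<Prod>i<N. ennreal (1 / real (Suc i)))"
    by (intro prod.cong refl, subst emeasure_uniform_count_measure)
       (auto simp: digit_def less_Suc_eq_le[symmetric])
  also have "\<dots> = ennreal (\<Prod>i<N. 1 / real (Suc i))"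
    by (intro prod_ennreal) simp
  also have "(\<Prod>i<N. 1 / real (Suc i)) = 1 / fact N"
    by (induction N) (simp_all add: field_simps del: of_nat_Suc)
  finally show ?thesis by (simp add: measure_def)
qed

lemma prob_digit_sum_in:
  assumes "S \<subseteq> {..<fact N}"
  shows "digit_measure.prob {d \<in> space digit_measure. digit_sum N d \<in> S} = card S / fact N"
proof -
  have fin: "finite S" using assms finite_subset by blast
  have "{d \<in> space digit_measure. digit_sum N d \<in> S}
      = (\<Union>s\<in>S. {d \<in> space digit_measure. digit_sum N d = s})" by auto
  also have "digit_measure.prob \<dots> = (\<Sum>s\<in>S. digit_measure.prob {d \<in> space digit_measure. digit_sum N d = s})"
    by (intro digit_measure.finite_measure_finite_Union fin) (auto simp: disjoint_family_on_def)
  also have "\<dots> = (\<Sum>s\<in>S. 1 / fact N)"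
    using assms by (intro sum.cong refl prob_digit_sum_eq) auto
  finally show ?thesis by simp
qed

text \<open>
  An event about finitely many digits is an event about the residue modulo some \<open>N!\<close>, which is
  uniformly distributed; adding 1 only permutes the residues.
\<close>

lemma digit_succ_invariant: "distr digit_measure digit_measure digit_succ = digit_measure"
proof -
  let ?M = "\<lambda>i. uniform_count_measure {..i::nat}"
  have "digit_measure = distr digit_measure digit_measure digit_succ"
  proof (rule measure_eqI_PiM_infinite[of _ UNIV ?M])
    fix A :: "nat \<Rightarrow> nat set" and J :: "nat set"
    assume J: "finite J" and A: "\<And>i. i \<in> J \<Longrightarrow> A i \<in> sets (?M i)"
    let ?E = "prod_emb UNIV ?M J (PiE J A)"
    obtain N where N: "\<And>i. i \<in> J \<Longrightarrow> i < N"
      using finite_nat_set_iff_bounded[of J] J by auto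
    define S where "S = {s. s < fact N \<and> (\<forall>i\<in>J. digit s i \<in> A i)}"
    define S' where "S' = {s. s < fact N \<and> (s + 1) mod fact N \<in> S}"
    have E: "?E = {d \<in> space digit_measure. digit_sum N d \<in> S}"
    proof (rule set_eqI)
      fix d
      show "d \<in> ?E \<longleftrightarrow> d \<in> {d \<in> space digit_measure. digit_sum N d \<in> S}"
      proof (cases "d \<in> space digit_measure")
        case True
        then have "digit (digit_sum N d) i = d i" if "i \<in> J" for i
          using N[OF that] by (intro digit_digit_sum) (auto simp: space_digit_measure)
        moreover have "digit_sum N d < fact N"
          using True by (intro digit_sum_less) (auto simp: space_digit_measure)
        ultimately show ?thesis using True
          by (auto simp: S_def prod_emb_iff space_digit_measure space_uniform_count_measure PiE_def Pi_def)
      next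
        case False
        then show ?thesis
          by (auto simp: prod_emb_iff space_digit_measure space_uniform_count_measure)
      qed
    qed
    have E': "digit_succ -` ?E \<inter> space digit_measure = {d \<in> space digit_measure. digit_sum N d \<in> S'}"
    proof (rule set_eqI)
      fix d
      show "d \<in> digit_succ -` ?E \<inter> space digit_measure
          \<longleftrightarrow> d \<in> {d \<in> space digit_measure. digit_sum N d \<in> S'}"
      proof (cases "d \<in> space digit_measure")
        case True
        then have "\<And>i. d i \<le> i" by (simp add: space_digit_measure)
        then have "digit_sum N (digit_succ d) = (digit_sum N d + 1) mod fact N"
          and "digit_sum N d < fact N"
          by (simp_all add: digit_sum_digit_succ digit_sum_less)
        then show ?thesis
          using True measurable_space[OF measurable_digit_succ True] by (simp add: E S'_def)
      qed simp
    qed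
    have "bij_betw (\<lambda>s. (s + 1) mod fact N) S' S"
    proof (rule bij_betw_subset[OF bij_betw_succ_mod])
      show "(\<lambda>s. (s + 1) mod fact N) ` S' = S"
      proof (intro equalityI subsetI)
        fix t assume t: "t \<in> S"
        then have "t \<in> (\<lambda>s. (s + 1) mod fact N) ` {..<fact N}"
          using bij_betw_succ_mod[of "fact N"] by (simp add: bij_betw_def S_def)
        then show "t \<in> (\<lambda>s. (s + 1) mod fact N) ` S'"
          using t by (auto simp: S'_def)
      qed (auto simp: S'_def)
    qed (auto simp: S'_def)
    then have "card S' = card S" by (rule bij_betw_same_card)
    then have "digit_measure.prob ?E = digit_measure.prob (digit_succ -` ?E \<inter> space digit_measure)"
      unfolding E' unfolding E by (subst (1 2) prob_digit_sum_in) (auto simp: S_def S'_def)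
    moreover have "?E \<in> sets digit_measure" unfolding E by measurable
    ultimately show "emeasure digit_measure ?E = emeasure (distr digit_measure digit_measure digit_succ) ?E"
      by (simp add: emeasure_distr digit_measure.emeasure_eq_measure)
  qed (auto simp: digit_measure_def[symmetric] digit_measure.finite_measure_axioms)
  then show ?thesis by simp
qed

text \<open>
  Events about one digit are events about one residue, and the events that can be approximated by residue
  events form a \<open>\<sigma>\<close>-algebra: for a countable union it is enough to approximate a finite part, and
  finitely many residues are functions of the one with the largest modulus.
\<close>

lemma digit_sums_generate:
  assumes "A \<in> sets digit_measure" "0 < e"
  shows "\<exists>N S. digit_measure.prob (sym_diff A {d \<in> space digit_measure. digit_sum N d \<in> S}) < e"
proof -
  let ?\<Omega> = "space digit_measure"
  let ?E = "\<lambda>N S. {d \<in> ?\<Omega>. digit_sum N d \<in> S}"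
  have "sets digit_measure = sigma_sets ?\<Omega>
      {{f \<in> ?\<Omega>. f i \<in> A} |i A. A \<in> sets (uniform_count_measure {..i})}"
    unfolding digit_measure_def sets_PiM_single space_PiM by simp
  with assms(1) have "A \<in> sigma_sets ?\<Omega>
      {{f \<in> ?\<Omega>. f i \<in> A} |i A. A \<in> sets (uniform_count_measure {..i})}" (is "_ \<in> sigma_sets _ ?G")
    by simp
  then have "A \<in> sets digit_measure \<and>
      (\<forall>e>0. \<exists>N S. digit_measure.prob (sym_diff A (?E N S)) < e)"
  proof (induction rule: sigma_sets.induct)
    case (Basic A)
    then obtain i C where A: "A = {f \<in> ?\<Omega>. f i \<in> C}" by blast
    have "A = ?E (Suc i) {s. digit s i \<in> C}"
      unfolding A using digit_digit_sum[of "Suc i" _ i] by (auto simp: space_digit_measure)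
    then have "digit_measure.prob (sym_diff A (?E (Suc i) {s. digit s i \<in> C})) = 0" by simp
    moreover have "A \<in> sets digit_measure" unfolding A by measurable
    ultimately show ?case
      by (intro conjI allI impI exI[of _ "Suc i"] exI[of _ "{s. digit s i \<in> C}"]) auto
  next
    case Empty
    have "digit_measure.prob (sym_diff {} (?E 0 {})) = 0" by simp
    then show ?case by (intro conjI allI impI exI[of _ 0] exI[of _ "{}"]) auto
  next
    case (Compl A)
    have "A \<subseteq> ?\<Omega>" using Compl by (intro sets.sets_into_space) simp
    then have eq: "sym_diff (?\<Omega> - A) (?E N (- S)) = sym_diff A (?E N S)" for N S
      by auto
    have "\<exists>N S. digit_measure.prob (sym_diff (?\<Omega> - A) (?E N S)) < e" if "0 < e" for e :: real
    proof -
      obtain N S where "digit_measure.prob (sym_diff A (?E N S)) < e"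
        using Compl \<open>0 < e\<close> by blast
      then show ?thesis by (intro exI[of _ N] exI[of _ "- S"]) (simp only: eq)
    qed
    then show ?case using Compl by auto
  next
    case (Union C)
    have CM [measurable]: "C i \<in> sets digit_measure" for i using Union by simp
    have "\<exists>N S. digit_measure.prob (sym_diff (\<Union>i. C i) (?E N S)) < e" if e: "e > 0" for e :: real
    proof -
      have "(\<lambda>m. digit_measure.prob (\<Union>i<m. C i)) \<longlonglongrightarrow> digit_measure.prob (\<Union>m. \<Union>i<m. C i)"
        by (rule digit_measure.finite_Lim_measure_incseq)
          (force intro!: incseq_SucI simp: lessThan_Suc)+
      also have "(\<Union>m. \<Union>i<m. C i) = (\<Union>i. C i)" by blast
      finally have "\<forall>\<^sub>F m in sequentially.
          digit_measure.prob (\<Union>i. C i) - e / 2 < digit_measure.prob (\<Union>i<m. C i)"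
        using e by (intro order_tendstoD) auto
      then obtain m where m: "digit_measure.prob (\<Union>i. C i) - e / 2 < digit_measure.prob (\<Union>i<m. C i)"
        by (meson eventually_happens sequentially_bot)
      have "\<exists>N S. digit_measure.prob (sym_diff (C i) (?E N S)) < e / (2 * (m + 1))" for i
        using Union e by simp
      then have "\<exists>N. \<forall>i. \<exists>S. digit_measure.prob (sym_diff (C i) (?E (N i) S)) < e / (2 * (m + 1))"
        by (intro choice allI)
      then obtain N
        where "\<forall>i. \<exists>S. digit_measure.prob (sym_diff (C i) (?E (N i) S)) < e / (2 * (m + 1))" ..
      then have "\<exists>S. \<forall>i. digit_measure.prob (sym_diff (C i) (?E (N i) (S i))) < e / (2 * (m + 1))"
        by (rule choice)
      then obtain S
        where NS: "\<And>i. digit_measure.prob (sym_diff (C i) (?E (N i) (S i))) < e / (2 * (m + 1))"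
        by blast
      \<comment> \<open>The largest of the moduli determines the residues for all the others.\<close>
      define K where "K = Max (insert 0 (N ` {..<m}))"
      have K: "N i \<le> K" if "i < m" for i using that by (simp add: K_def)
      define R where "R = {s. \<exists>i<m. s mod fact (N i) \<in> S i}"
      have R: "?E K R = (\<Union>i<m. ?E (N i) (S i))"
      proof -
        have "digit_sum K d mod fact (N i) = digit_sum (N i) d" if "d \<in> ?\<Omega>" "i < m" for d i
          using that by (intro digit_sum_mod K) (simp add: space_digit_measure)
        then have "digit_sum K d \<in> R \<longleftrightarrow> (\<exists>i<m. digit_sum (N i) d \<in> S i)" if "d \<in> ?\<Omega>" for d
          using that by (simp add: R_def cong: conj_cong)
        then show ?thesis by (intro set_eqI) auto
      qed
      have "digit_measure.prob (sym_diff (\<Union>i. C i) (?E K R))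
          \<le> digit_measure.prob (((\<Union>i. C i) - (\<Union>i<m. C i)) \<union> (\<Union>i<m. sym_diff (C i) (?E (N i) (S i))))"
        unfolding R by (rule digit_measure.finite_measure_mono) (blast, measurable)
      also have "\<dots> \<le> digit_measure.prob ((\<Union>i. C i) - (\<Union>i<m. C i))
          + digit_measure.prob (\<Union>i<m. sym_diff (C i) (?E (N i) (S i)))"
        by (rule measure_Un_le) measurable
      also have "digit_measure.prob ((\<Union>i. C i) - (\<Union>i<m. C i))
          = digit_measure.prob (\<Union>i. C i) - digit_measure.prob (\<Union>i<m. C i)"
        by (rule digit_measure.finite_measure_Diff) (measurable, blast)
      also have "digit_measure.prob (\<Union>i<m. sym_diff (C i) (?E (N i) (S i)))
          \<le> (\<Sum>i<m. digit_measure.prob (sym_diff (C i) (?E (N i) (S i))))"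
        by (rule digit_measure.finite_measure_subadditive_finite) auto
      also have "\<dots> \<le> (\<Sum>i<m. e / (2 * (m + 1)))"
        by (intro sum_mono less_imp_le NS)
      also have "\<dots> \<le> e / 2" using e by (simp add: field_simps)
      finally show ?thesis using m by (intro exI[of _ K] exI[of _ R]) linarith
    qed
    then show ?case using CM by auto
  qed
  then show ?thesis using assms(2) by simp
qed

lemma odometer_digits: "odometer digit_measure digit_succ digit_sum"
proof
  fix d N M assume d: "d \<in> space digit_measure"
  then have "\<And>i. d i \<le> i" by (simp add: space_digit_measure)
  then show "digit_sum N d < fact N"
    and "digit_sum N (digit_succ d) = (digit_sum N d + 1) mod fact N"
    and "N \<le> M \<Longrightarrow> digit_sum M d mod fact N = digit_sum N d"
    by (simp_all add: digit_sum_less digit_sum_digit_succ digit_sum_mod)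
qed (simp_all add: digit_succ_invariant prob_digit_sum_eq digit_sums_generate)

section \<open>Square-integrable functions on the odometer\<close>

lemma cmod_add_square_le: "(cmod (x + y))\<^sup>2 \<le> 2 * (cmod x)\<^sup>2 + 2 * (cmod y)\<^sup>2"
proof -
  have "(cmod (x + y))\<^sup>2 \<le> (cmod x + cmod y)\<^sup>2"
    by (intro power_mono norm_triangle_ineq) simp
  also have "\<dots> \<le> 2 * (cmod x)\<^sup>2 + 2 * (cmod y)\<^sup>2"
    using sum_squares_bound[of "cmod x" "cmod y"] by (simp add: power2_sum)
  finally show ?thesis .
qed

lemma nn_integral_cmod_add_square_le:
  assumes [measurable]: "F \<in> borel_measurable M" "G \<in> borel_measurable M"
  shows "(\<integral>\<^sup>+w. ennreal ((cmod (F w + G w))\<^sup>2) \<partial>M)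
    \<le> 2 * (\<integral>\<^sup>+w. ennreal ((cmod (F w))\<^sup>2) \<partial>M) + 2 * (\<integral>\<^sup>+w. ennreal ((cmod (G w))\<^sup>2) \<partial>M)"
proof -
  have "ennreal ((cmod (x + y))\<^sup>2) \<le> 2 * ennreal ((cmod x)\<^sup>2) + 2 * ennreal ((cmod y)\<^sup>2)" for x y
    using ennreal_leI[OF cmod_add_square_le[of x y]] by (simp add: ennreal_mult')
  then have "(\<integral>\<^sup>+w. ennreal ((cmod (F w + G w))\<^sup>2) \<partial>M)
      \<le> (\<integral>\<^sup>+w. 2 * ennreal ((cmod (F w))\<^sup>2) + 2 * ennreal ((cmod (G w))\<^sup>2) \<partial>M)"
    by (intro nn_integral_mono)
  also have "\<dots> = 2 * (\<integral>\<^sup>+w. ennreal ((cmod (F w))\<^sup>2) \<partial>M) + 2 * (\<integral>\<^sup>+w. ennreal ((cmod (G w))\<^sup>2) \<partial>M)"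
    by (simp add: nn_integral_add nn_integral_cmult)
  finally show ?thesis .
qed

text \<open>
  On a probability space this follows from \<open>|z| \<le> 1 + |z|\<^sup>2\<close>.
\<close>

lemma integrable_if_square_integrable:
  assumes "prob_space M" "square_integrable M F"
  shows "integrable M F"
proof (rule Bochner_Integration.integrable_bound)
  interpret prob_space M by fact
  show "integrable M (\<lambda>w. 1 + (cmod (F w))\<^sup>2)"
    using assms by (simp add: square_integrable_def)
  have "cmod z \<le> 1 + (cmod z)\<^sup>2" for z
  proof -
    have "2 * cmod z \<le> (cmod z)\<^sup>2 + 1" using sum_squares_bound[of "cmod z" 1] by simp
    then show ?thesis using norm_ge_zero[of z] by linarith
  qed
  then show "AE w in M. norm (F w) \<le> norm (1 + (cmod (F w))\<^sup>2)"
    by (simp add: abs_of_nonneg)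
qed (use assms in \<open>simp add: square_integrable_def\<close>)

context odometer
begin

lemma expectation_tau:
  fixes G :: "'w \<Rightarrow> 'b::{banach, second_countable_topology}"
  assumes "G \<in> borel_measurable P"
  shows "(LINT w|P. G (\<tau> w)) = (LINT w|P. G w)"
  using integral_distr[OF tau_measurable assms] by (simp only: tau_invariant)

text \<open>
  Nonnegative integrals are used so that no integrability has to be carried through the closure properties
  below.
\<close>

definition approximable :: "('w \<Rightarrow> complex) \<Rightarrow> bool" where
  "approximable F \<longleftrightarrow> (\<forall>e>0. \<exists>N h. (\<integral>\<^sup>+w. ennreal ((cmod (F w - h (a N w)))\<^sup>2) \<partial>P) < ennreal e)"

lemma approximable_indicator:
  assumes [measurable]: "A \<in> events"
  shows "approximable (indicator A)"
  unfolding approximable_def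
proof (intro allI impI)
  fix e :: real assume "0 < e"
  with residues_generate[OF assms] obtain N S
    where NS: "prob (sym_diff A {w \<in> space P. a N w \<in> S}) < e" by blast
  have "(\<integral>\<^sup>+w. ennreal ((cmod (indicator A w - indicator S (a N w)))\<^sup>2) \<partial>P)
      = (\<integral>\<^sup>+w. indicator (sym_diff A {w \<in> space P. a N w \<in> S}) w \<partial>P)"
    by (intro nn_integral_cong) (auto split: split_indicator)
  also have "\<dots> = ennreal (prob (sym_diff A {w \<in> space P. a N w \<in> S}))"
    by (simp add: emeasure_eq_measure)
  also have "\<dots> < ennreal e" using NS \<open>0 < e\<close> by (simp add: ennreal_less_iff)
  finally show "\<exists>N h. (\<integral>\<^sup>+w. ennreal ((cmod (indicator A w - h (a N w)))\<^sup>2) \<partial>P) < ennreal e" 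
    by blast
qed

text \<open>
  Residues modulo \<open>N!\<close> and \<open>M!\<close> are both functions of the residue modulo the larger factorial, so sums
  of residue functions are residue functions.
\<close>

lemma approximable_add:
  assumes [measurable]: "F \<in> borel_measurable P" "G \<in> borel_measurable P"
    and "approximable F" "approximable G"
  shows "approximable (\<lambda>w. F w + G w)"
  unfolding approximable_def
proof (intro allI impI)
  fix e :: real assume "0 < e"
  then have "0 < e / 4" by simp
  obtain N h where F: "(\<integral>\<^sup>+w. ennreal ((cmod (F w - h (a N w)))\<^sup>2) \<partial>P) < ennreal (e / 4)"
    using assms(3) \<open>0 < e / 4\<close> unfolding approximable_def by blast
  obtain M g where G: "(\<integral>\<^sup>+w. ennreal ((cmod (G w - g (a M w)))\<^sup>2) \<partial>P) < ennreal (e / 4)"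
    using assms(4) \<open>0 < e / 4\<close> unfolding approximable_def by blast
  define k where "k s = h (s mod fact N) + g (s mod fact M)" for s
  have "(\<integral>\<^sup>+w. ennreal ((cmod (F w + G w - k (a (max N M) w)))\<^sup>2) \<partial>P)
      = (\<integral>\<^sup>+w. ennreal ((cmod ((F w - h (a N w)) + (G w - g (a M w))))\<^sup>2) \<partial>P)"
    by (intro nn_integral_cong) (simp add: k_def residue_mod algebra_simps)
  also have "\<dots> \<le> 2 * (\<integral>\<^sup>+w. ennreal ((cmod (F w - h (a N w)))\<^sup>2) \<partial>P)
      + 2 * (\<integral>\<^sup>+w. ennreal ((cmod (G w - g (a M w)))\<^sup>2) \<partial>P)"
    by (rule nn_integral_cmod_add_square_le) measurable
  also have "\<dots> < 2 * ennreal (e / 4) + 2 * ennreal (e / 4)"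
    using F G by (intro add_strict_mono ennreal_mult_strict_left_mono) auto
  also have "\<dots> = ennreal e"
    using \<open>0 < e\<close> by (simp add: ennreal_mult'[symmetric] ennreal_plus[symmetric] ennreal_numeral[symmetric]
      del: ennreal_plus ennreal_numeral)
  finally show "\<exists>N h. (\<integral>\<^sup>+w. ennreal ((cmod (F w + G w - h (a N w)))\<^sup>2) \<partial>P) < ennreal e"
    by blast
qed

lemma approximable_mult:
  assumes [measurable]: "F \<in> borel_measurable P" and "approximable F"
  shows "approximable (\<lambda>w. c * F w)"
  unfolding approximable_def
proof (intro allI impI)
  fix e :: real assume "0 < e"
  define b where "b = (cmod c)\<^sup>2 + 1"
  have b: "0 < b" by (simp add: b_def add_nonneg_pos)
  then have "0 < e / b" using \<open>0 < e\<close> by simp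
  then obtain N h where F: "(\<integral>\<^sup>+w. ennreal ((cmod (F w - h (a N w)))\<^sup>2) \<partial>P) < ennreal (e / b)"
    using assms(2) unfolding approximable_def by blast
  have "ennreal ((cmod (c * x - c * y))\<^sup>2) \<le> ennreal b * ennreal ((cmod (x - y))\<^sup>2)" for x y
  proof -
    have "(cmod (c * x - c * y))\<^sup>2 \<le> b * (cmod (x - y))\<^sup>2"
      unfolding right_diff_distrib[symmetric] norm_mult power_mult_distrib
      by (intro mult_right_mono) (simp_all add: b_def)
    then show ?thesis using b by (simp add: ennreal_mult'[symmetric] ennreal_leI)
  qed
  then have "(\<integral>\<^sup>+w. ennreal ((cmod (c * F w - c * h (a N w)))\<^sup>2) \<partial>P)
      \<le> (\<integral>\<^sup>+w. ennreal b * ennreal ((cmod (F w - h (a N w)))\<^sup>2) \<partial>P)"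
    by (intro nn_integral_mono)
  also have "\<dots> = ennreal b * (\<integral>\<^sup>+w. ennreal ((cmod (F w - h (a N w)))\<^sup>2) \<partial>P)"
    by (intro nn_integral_cmult) measurable
  also have "\<dots> < ennreal b * ennreal (e / b)"
    using F b by (intro ennreal_mult_strict_left_mono) auto
  also have "\<dots> = ennreal e"
    using b \<open>0 < e\<close> by (simp add: ennreal_mult'[symmetric])
  finally show "\<exists>N h. (\<integral>\<^sup>+w. ennreal ((cmod (c * F w - h (a N w)))\<^sup>2) \<partial>P) < ennreal e"
    by (intro exI[of _ N] exI[of _ "\<lambda>s. c * h s"])
qed

lemma approximable_sum:
  assumes "finite I" "\<And>i. i \<in> I \<Longrightarrow> F i \<in> borel_measurable P" "\<And>i. i \<in> I \<Longrightarrow> approximable (F i)"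
  shows "approximable (\<lambda>w. \<Sum>i\<in>I. F i w)"
  using assms
proof (induction I rule: finite_induct)
  case empty
  have "approximable (indicator {})" by (rule approximable_indicator) simp
  then show ?case by (simp add: indicator_def[abs_def])
next
  case (insert i I)
  then show ?case by (simp add: approximable_add borel_measurable_sum)
qed

lemma approximable_simple_function:
  assumes "simple_function P F"
  shows "approximable F"
proof -
  have m [measurable]: "F -` {v} \<inter> space P \<in> events" for v
    using assms by (rule simple_functionD(2))
  define G where "G w = (\<Sum>v\<in>F ` space P. v * indicator (F -` {v} \<inter> space P) w)" for w
  have "approximable G"
    unfolding G_def[abs_def] using simple_functionD(1)[OF assms]
    by (intro approximable_sum approximable_mult approximable_indicator) measurable
  moreover have "F w = G w" if "w \<in> space P" for w
    unfolding G_def using simple_functionD(1)[OF assms] that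
    by (subst sum.mono_neutral_right[of _ "{F w}"]) (auto simp: indicator_def)
  then have "(\<integral>\<^sup>+w. ennreal ((cmod (F w - h (a N w)))\<^sup>2) \<partial>P)
      = (\<integral>\<^sup>+w. ennreal ((cmod (G w - h (a N w)))\<^sup>2) \<partial>P)" for N h
    by (intro nn_integral_cong) simp
  ultimately show ?thesis unfolding approximable_def by simp
qed

lemma square_integrable_approximable:
  assumes "square_integrable P F"
  shows "approximable F"
  unfolding approximable_def
proof (intro allI impI)
  fix e :: real assume "0 < e"
  have F [measurable]: "F \<in> borel_measurable P" and F2: "integrable P (\<lambda>w. (cmod (F w))\<^sup>2)"
    using assms by (auto simp: square_integrable_def)
  obtain f where "(\<forall>i. simple_function P (f i)) \<and> (\<forall>w\<in>space P. (\<lambda>i. f i w) \<longlonglongrightarrow> F w)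
      \<and> (\<forall>i. \<forall>w\<in>space P. dist (f i w) 0 \<le> 2 * dist (F w) 0)"
    using borel_measurable_implies_sequence_metric[OF F, of 0] by (elim exE)
  then have f: "\<And>i. simple_function P (f i)"
    and lim: "\<And>w. w \<in> space P \<Longrightarrow> (\<lambda>i. f i w) \<longlonglongrightarrow> F w"
    and bound: "\<And>i w. w \<in> space P \<Longrightarrow> cmod (f i w) \<le> 2 * cmod (F w)"
    by auto
  have [measurable]: "f i \<in> borel_measurable P" for i
    by (rule borel_measurable_simple_function[OF f])
  have "(\<lambda>i. LINT w|P. (cmod (F w - f i w))\<^sup>2) \<longlonglongrightarrow> (LINT w|P. 0)"
  proof (rule integral_dominated_convergence)
    show "integrable P (\<lambda>w. 9 * (cmod (F w))\<^sup>2)" using F2 by simp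
    show "AE w in P. (\<lambda>i. (cmod (F w - f i w))\<^sup>2) \<longlonglongrightarrow> 0"
    proof (rule AE_I2)
      fix w assume "w \<in> space P"
      have "(\<lambda>i. (cmod (F w - f i w))\<^sup>2) \<longlonglongrightarrow> (cmod (F w - F w))\<^sup>2"
        by (intro tendsto_intros lim \<open>w \<in> space P\<close>)
      then show "(\<lambda>i. (cmod (F w - f i w))\<^sup>2) \<longlonglongrightarrow> 0" by simp
    qed
    show "AE w in P. norm ((cmod (F w - f i w))\<^sup>2) \<le> 9 * (cmod (F w))\<^sup>2" for i
    proof (rule AE_I2)
      fix w assume "w \<in> space P"
      have "cmod (F w - f i w) \<le> cmod (F w) + cmod (f i w)" by (rule norm_triangle_ineq4)
      then have "cmod (F w - f i w) \<le> 3 * cmod (F w)" using bound[OF \<open>w \<in> space P\<close>, of i] by simp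
      then have "(cmod (F w - f i w))\<^sup>2 \<le> (3 * cmod (F w))\<^sup>2" by (intro power_mono) auto
      then show "norm ((cmod (F w - f i w))\<^sup>2) \<le> 9 * (cmod (F w))\<^sup>2"
        by (simp add: power_mult_distrib)
    qed
  qed measurable
  then have "\<forall>\<^sub>F i in sequentially. (LINT w|P. (cmod (F w - f i w))\<^sup>2) < e / 4"
    using \<open>0 < e\<close> by (intro order_tendstoD) auto
  then obtain i where i: "(LINT w|P. (cmod (F w - f i w))\<^sup>2) < e / 4"
    by (meson eventually_happens sequentially_bot)
  have "integrable P (\<lambda>w. (cmod (F w - f i w))\<^sup>2)"
  proof (rule Bochner_Integration.integrable_bound)
    show "integrable P (\<lambda>w. 2 * (cmod (F w))\<^sup>2 + 2 * (4 * (cmod (F w))\<^sup>2))" using F2 by simp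
    show "AE w in P. norm ((cmod (F w - f i w))\<^sup>2) \<le> norm (2 * (cmod (F w))\<^sup>2 + 2 * (4 * (cmod (F w))\<^sup>2))"
    proof (rule AE_I2)
      fix w assume "w \<in> space P"
      then have "(cmod (f i w))\<^sup>2 \<le> (2 * cmod (F w))\<^sup>2" by (intro power_mono bound) auto
      then have "(cmod (f i w))\<^sup>2 \<le> 4 * (cmod (F w))\<^sup>2" by (simp add: power_mult_distrib)
      then show "norm ((cmod (F w - f i w))\<^sup>2) \<le> norm (2 * (cmod (F w))\<^sup>2 + 2 * (4 * (cmod (F w))\<^sup>2))"
        using cmod_add_square_le[of "F w" "- f i w"] by simp
    qed
  qed measurable
  then have fi: "(\<integral>\<^sup>+w. ennreal ((cmod (F w - f i w))\<^sup>2) \<partial>P) < ennreal (e / 4)"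
    using i \<open>0 < e\<close> by (subst nn_integral_eq_integral) (auto simp: ennreal_less_iff)
  have "0 < e / 4" using \<open>0 < e\<close> by simp
  then obtain N h where h: "(\<integral>\<^sup>+w. ennreal ((cmod (f i w - h (a N w)))\<^sup>2) \<partial>P) < ennreal (e / 4)"
    using approximable_simple_function[OF f, of i] unfolding approximable_def by blast
  have "(\<integral>\<^sup>+w. ennreal ((cmod (F w - h (a N w)))\<^sup>2) \<partial>P)
      = (\<integral>\<^sup>+w. ennreal ((cmod ((F w - f i w) + (f i w - h (a N w))))\<^sup>2) \<partial>P)"
    by simp
  also have "\<dots> \<le> 2 * (\<integral>\<^sup>+w. ennreal ((cmod (F w - f i w))\<^sup>2) \<partial>P)
      + 2 * (\<integral>\<^sup>+w. ennreal ((cmod (f i w - h (a N w)))\<^sup>2) \<partial>P)"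
    by (rule nn_integral_cmod_add_square_le) measurable
  also have "\<dots> < 2 * ennreal (e / 4) + 2 * ennreal (e / 4)"
    using fi h by (intro add_strict_mono ennreal_mult_strict_left_mono) auto
  also have "\<dots> = ennreal e"
    using \<open>0 < e\<close> by (simp add: ennreal_mult'[symmetric] ennreal_plus[symmetric] ennreal_numeral[symmetric]
      del: ennreal_plus ennreal_numeral)
  finally show "\<exists>N h. (\<integral>\<^sup>+w. ennreal ((cmod (F w - h (a N w)))\<^sup>2) \<partial>P) < ennreal e"
    by blast
qed

text \<open>
  Indicators of events are limits of functions of a residue by the generation axiom; linear combinations and
  limits stay in the closure.
\<close>

lemma residue_functions_dense:
  assumes F: "square_integrable P F" and "0 < e"
  obtains N h where "integrable P (\<lambda>w. (cmod (F w - h (a N w)))\<^sup>2)"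
    and "(LINT w|P. (cmod (F w - h (a N w)))\<^sup>2) < e"
proof -
  have [measurable]: "F \<in> borel_measurable P" using F by (simp add: square_integrable_def)
  obtain N h where h: "(\<integral>\<^sup>+w. ennreal ((cmod (F w - h (a N w)))\<^sup>2) \<partial>P) < ennreal e"
    using square_integrable_approximable[OF F] \<open>0 < e\<close> unfolding approximable_def by blast
  have int: "integrable P (\<lambda>w. (cmod (F w - h (a N w)))\<^sup>2)"
    using h by (intro integrableI_nonneg) (auto intro: less_trans)
  moreover have "(LINT w|P. (cmod (F w - h (a N w)))\<^sup>2) < e"
    using h \<open>0 < e\<close> by (subst (asm) nn_integral_eq_integral[OF int]) (auto simp: ennreal_less_iff)
  ultimately show ?thesis by (rule that)
qed

abbreviation cylinder :: "nat \<Rightarrow> nat \<Rightarrow> 'w set" where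
  "cylinder N s \<equiv> {w \<in> space P. a N w = s}"

lemma sum_cylinder:
  fixes h :: "nat \<Rightarrow> complex"
  assumes "w \<in> space P"
  shows "(\<Sum>s<fact N. h s * (indicator (cylinder N s) w *\<^sub>R z)) = h (a N w) * z"
  using assms residue_less[OF assms, of N]
  by (subst sum.mono_neutral_right[of _ "{a N w}"]) (auto simp: indicator_def)

lemma integral_residue_function_mult:
  fixes F :: "'w \<Rightarrow> complex"
  assumes "integrable P F"
  shows "integrable P (\<lambda>w. h (a N w) * F w)"
    and "(LINT w|P. h (a N w) * F w) = (\<Sum>s<fact N. h s * (LINT w:cylinder N s|P. F w))"
proof -
  have int: "integrable P (\<lambda>w. h s * (indicator (cylinder N s) w *\<^sub>R F w))" for s
    using assms by (intro integrable_mult_right integrable_mult_indicator) measurable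
  have "integrable P (\<lambda>w. \<Sum>s<fact N. h s * (indicator (cylinder N s) w *\<^sub>R F w))"
    by (intro Bochner_Integration.integrable_sum int)
  then show "integrable P (\<lambda>w. h (a N w) * F w)"
    by (rule Bochner_Integration.integrable_cong[THEN iffD1, rotated 2]) (simp_all only: sum_cylinder)
  have "(LINT w|P. h (a N w) * F w)
      = (LINT w|P. (\<Sum>s<fact N. h s * (indicator (cylinder N s) w *\<^sub>R F w)))"
    by (intro Bochner_Integration.integral_cong refl) (simp only: sum_cylinder)
  also have "\<dots> = (\<Sum>s<fact N. h s * (LINT w:cylinder N s|P. F w))"
    by (simp only: Bochner_Integration.integral_sum[OF int] set_lebesgue_integral_def
        integral_mult_right_zero)
  finally show "(LINT w|P. h (a N w) * F w) = (\<Sum>s<fact N. h s * (LINT w:cylinder N s|P. F w))" .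
qed

text \<open>
  Such an \<open>F\<close> is orthogonal to every function of a residue, and these are dense.
\<close>

lemma AE_zero_if_integral_cylinders_zero:
  assumes F: "square_integrable P F"
    and zero: "\<And>N s. s < fact N \<Longrightarrow> (LINT w:cylinder N s|P. F w) = 0"
  shows "AE w in P. F w = 0"
proof -
  have [measurable]: "F \<in> borel_measurable P" and F2: "integrable P (\<lambda>w. (cmod (F w))\<^sup>2)"
    using F by (auto simp: square_integrable_def)
  have F1: "integrable P F" by (rule integrable_if_square_integrable[OF prob_space_axioms F])
  have "(LINT w|P. (cmod (F w))\<^sup>2) \<le> 0 + e" if "0 < e" for e
  proof -
    obtain N h where h: "integrable P (\<lambda>w. (cmod (F w - h (a N w)))\<^sup>2)"
      "(LINT w|P. (cmod (F w - h (a N w)))\<^sup>2) < e"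
      by (rule residue_functions_dense[OF F \<open>0 < e\<close>])
    let ?G = "\<lambda>w. cnj (h (a N w)) * F w"
    have G: "integrable P ?G" "(LINT w|P. ?G w) = 0"
      using integral_residue_function_mult[OF F1, of "\<lambda>s. cnj (h s)" N] zero by simp_all
    \<comment> \<open>Expand \<open>|F - h|\<^sup>2 = |F|\<^sup>2 + |h|\<^sup>2 - 2 Re (F \<sqdot> cnj h)\<close> and drop \<open>|h|\<^sup>2\<close>; the mixed term integrates
      to 0.\<close>
    have "(LINT w|P. (cmod (F w))\<^sup>2) \<le> (LINT w|P. (cmod (F w - h (a N w)))\<^sup>2 + 2 * Re (?G w))"
    proof (rule integral_mono[OF F2])
      show "integrable P (\<lambda>w. (cmod (F w - h (a N w)))\<^sup>2 + 2 * Re (?G w))"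
        using h(1) G(1)
        by (intro Bochner_Integration.integrable_add integrable_mult_right integrable_Re)
      show "(cmod (F w))\<^sup>2 \<le> (cmod (F w - h (a N w)))\<^sup>2 + 2 * Re (?G w)" for w
        by (simp add: cmod_power2 power2_diff algebra_simps)
    qed
    also have "\<dots> = (LINT w|P. (cmod (F w - h (a N w)))\<^sup>2) + (LINT w|P. 2 * Re (?G w))"
      by (intro Bochner_Integration.integral_add h(1) integrable_mult_right integrable_Re G(1))
    also have "(LINT w|P. 2 * Re (?G w)) = 2 * Re (LINT w|P. ?G w)"
      using integral_Re[OF G(1)] by (simp only: integral_mult_right_zero)
    finally show ?thesis using h(2) G(2) by simp
  qed
  then have "(LINT w|P. (cmod (F w))\<^sup>2) \<le> 0" by (rule field_le_epsilon)
  moreover have "0 \<le> (LINT w|P. (cmod (F w))\<^sup>2)" by simp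
  ultimately have "(LINT w|P. (cmod (F w))\<^sup>2) = 0" by linarith
  then show ?thesis
    using integral_nonneg_eq_0_iff_AE[OF F2] by simp
qed

text \<open>
  Substituting \<open>\<tau> w\<close> for \<open>w\<close> moves the residue class \<open>s\<close> to the class \<open>s + 1\<close> and multiplies
  \<open>F\<close> by \<open>c\<close>.
\<close>

lemma integral_cylinder_succ:
  fixes F :: "'w \<Rightarrow> complex"
  assumes F: "integrable P F" and eigen: "AE w in P. F (\<tau> w) = c * F w" and s: "s < fact N"
  shows "(LINT w:cylinder N ((s + 1) mod fact N)|P. F w) = c * (LINT w:cylinder N s|P. F w)"
proof -
  have [measurable]: "F \<in> borel_measurable P" using F by auto
  let ?t = "(s + 1) mod fact N"
  have "indicator (cylinder N ?t) (\<tau> w) = (indicator (cylinder N s) w :: real)" if w: "w \<in> space P" for w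
  proof -
    have "(a N w + 1) mod fact N = ?t \<longleftrightarrow> a N w = s"
      using bij_betw_succ_mod[of "fact N"] residue_less[OF w, of N] s
      by (intro inj_on_eq_iff[of "\<lambda>s. (s + 1) mod fact N" "{..<fact N}"]) (auto simp: bij_betw_def)
    then show ?thesis
      using w measurable_space[OF tau_measurable w] residue_tau[OF w, of N]
      by (simp add: indicator_def)
  qed
  then have "(LINT w|P. indicator (cylinder N ?t) (\<tau> w) *\<^sub>R F (\<tau> w))
      = (LINT w|P. c * (indicator (cylinder N s) w *\<^sub>R F w))"
    using eigen by (intro integral_cong_AE) (measurable, auto)
  also have "(LINT w|P. indicator (cylinder N ?t) (\<tau> w) *\<^sub>R F (\<tau> w))
      = (LINT w|P. indicator (cylinder N ?t) w *\<^sub>R F w)"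
    by (intro expectation_tau) measurable
  finally show ?thesis by (simp only: set_lebesgue_integral_def integral_mult_right_zero)
qed

lemma integral_cylinder_add:
  fixes F :: "'w \<Rightarrow> complex"
  assumes "integrable P F" and "AE w in P. F (\<tau> w) = c * F w" and "s < fact N"
  shows "(LINT w:cylinder N ((s + j) mod fact N)|P. F w) = c ^ j * (LINT w:cylinder N s|P. F w)"
proof (induction j)
  case 0
  then show ?case using assms(3) by simp
next
  case (Suc j)
  have "(s + Suc j) mod fact N = ((s + j) mod fact N + 1) mod fact N" by (simp add: mod_simps)
  then show ?case
    using integral_cylinder_succ[OF assms(1,2), of "(s + j) mod fact N" N] Suc by (simp add: mult.assoc)
qed

text \<open>
  Some residue class modulo some \<open>N!\<close> carries a nonzero integral of \<open>F\<close>.  After \<open>N!\<close> steps one returns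
  to the same class, having multiplied this integral by \<open>c ^ N!\<close>.
\<close>

lemma eigenvalue_root_of_unity:
  assumes F: "square_integrable P F" and nz: "\<not> (AE w in P. F w = 0)"
    and eigen: "AE w in P. F (\<tau> w) = c * F w"
  shows "\<exists>q>0. c ^ q = 1"
proof -
  obtain N s where s: "s < fact N" and I: "(LINT w:cylinder N s|P. F w) \<noteq> 0"
    using AE_zero_if_integral_cylinders_zero[OF F] nz by blast
  have "(LINT w:cylinder N s|P. F w) = c ^ fact N * (LINT w:cylinder N s|P. F w)"
    using integral_cylinder_add[OF integrable_if_square_integrable[OF prob_space_axioms F] eigen s, of "fact N"] s by simp
  then have "c ^ fact N = 1" using I by simp
  then show ?thesis by (intro exI[of _ "fact N"]) simp
qed

text \<open>
  The centred indicator is an eigenfunction with eigenvalue 1, so its integrals over the classes modulo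
  \<open>N!\<close> are all equal; they add up to 0, hence vanish, and the indicator is almost surely constant.
\<close>

lemma invariant_event_trivial:
  assumes A [measurable]: "A \<in> events" and inv: "\<And>w. w \<in> space P \<Longrightarrow> \<tau> w \<in> A \<longleftrightarrow> w \<in> A"
  shows "prob A = 0 \<or> prob A = 1"
proof -
  define F :: "'w \<Rightarrow> complex" where "F w = of_real (indicator A w - prob A)" for w
  have [measurable]: "F \<in> borel_measurable P" unfolding F_def by measurable
  have "cmod (F w) \<le> 1" for w
    by (auto simp: F_def norm_of_real indicator_def simp del: of_real_diff)
  then have F: "square_integrable P F"
    unfolding square_integrable_def
    by (intro conjI integrable_const_bound[of _ 1]) (auto intro!: power_le_one)
  have F1: "integrable P F" by (rule integrable_if_square_integrable[OF prob_space_axioms F])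
  have eigen: "AE w in P. F (\<tau> w) = 1 * F w"
    using inv by (intro AE_I2) (auto simp: F_def indicator_def)
  have "(LINT w|P. F w) = of_real (LINT w|P. indicator A w - prob A)"
    unfolding F_def by (rule integral_complex_of_real)
  also have "(LINT w|P. indicator A w - prob A) = (LINT w|P. indicator A w) - (LINT w|P. prob A)"
    by (intro Bochner_Integration.integral_diff integrable_const integrable_real_indicator A)
      (simp add: emeasure_eq_measure)
  also have "\<dots> = 0" by (simp add: prob_space)
  finally have int0: "(LINT w|P. F w) = 0" by simp
  have zero: "(LINT w:cylinder N s|P. F w) = 0" if "s < fact N" for N s
  proof -
    have const: "(LINT w:cylinder N t|P. F w) = (LINT w:cylinder N 0|P. F w)" if "t < fact N" for t
      using integral_cylinder_add[OF F1 eigen, of 0 N t] that by simp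
    have "(LINT w|P. F w) = (\<Sum>t<fact N. (LINT w:cylinder N t|P. F w))"
      using integral_residue_function_mult(2)[OF F1, of "\<lambda>_. 1" N] by simp
    also have "\<dots> = (\<Sum>t<(fact N :: nat). (LINT w:cylinder N 0|P. F w))"
      by (intro sum.cong refl const) simp
    finally have "(LINT w:cylinder N 0|P. F w) = 0" using int0 by simp
    then show ?thesis using const[OF that] by simp
  qed
  have "AE w in P. F w = 0" by (rule AE_zero_if_integral_cylinders_zero[OF F zero])
  then have "AE w in P. indicator A w = prob A"
    by (simp add: F_def)
  then have "AE w in P. prob A = 0 \<or> prob A = 1"
  proof eventually_elim
    case (elim w)
    then show ?case by (cases "w \<in> A") auto
  qed
  then show ?thesis by simp
qed

end

section \<open>Spectrum of factors of the odometer\<close>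

text \<open>
  Passes from families of possibly vanishing, possibly coinciding eigenvectors to a set of genuine
  eigenfunctions: vanishing members are dropped and the coefficients of equal members are added.
\<close>

lemma discrete_spectrumI:
  assumes "\<And>g e. square_integrable M g \<Longrightarrow> 0 < e \<Longrightarrow>
    \<exists>(n::nat) E b. (\<forall>l<n. square_integrable M (E l) \<and> (\<exists>c. AE x in M. E l (T x) = c * E l x)) \<and>
      sqrt (LINT x|M. (cmod (g x - (\<Sum>l<n. b l * E l x)))\<^sup>2) < e"
  shows "discrete_spectrum T M"
  unfolding discrete_spectrum_def
proof (intro allI impI)
  fix g and e :: real assume g: "square_integrable M g" and "0 < e"
  obtain n :: nat and E b
    where E: "\<And>l. l < n \<Longrightarrow> square_integrable M (E l) \<and> (\<exists>c. AE x in M. E l (T x) = c * E l x)"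
      and less: "sqrt (LINT x|M. (cmod (g x - (\<Sum>l<n. b l * E l x)))\<^sup>2) < e"
    using assms[OF g \<open>0 < e\<close>] by (elim exE conjE) blast
  have [measurable]: "g \<in> borel_measurable M" using g by (simp add: square_integrable_def)
  have Em [measurable]: "E l \<in> borel_measurable M" if "l < n" for l
    using E[OF that] by (simp add: square_integrable_def)
  define J where "J = {l. l < n \<and> \<not> (AE x in M. E l x = 0)}"
  \<comment> \<open>Distinct indices may give the same function.\<close>
  define c where "c f = (\<Sum>l\<in>{l\<in>J. E l = f}. b l)" for f
  have J: "finite J" by (simp add: J_def)
  have sum: "(\<Sum>f\<in>E ` J. c f * f x) = (\<Sum>l\<in>J. b l * E l x)" for x
  proof -
    have "(\<Sum>l\<in>J. b l * E l x) = (\<Sum>f\<in>E ` J. \<Sum>l\<in>{l\<in>J. E l = f}. b l * E l x)"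
      by (rule sum.image_gen[OF J])
    also have "\<dots> = (\<Sum>f\<in>E ` J. c f * f x)"
      unfolding c_def sum_distrib_right by (intro sum.cong refl) auto
    finally show ?thesis by simp
  qed
  have "AE x in M. \<forall>l\<in>{..<n} - J. E l x = 0"
    by (intro AE_finite_allI) (auto simp: J_def)
  then have "AE x in M. (\<Sum>l\<in>J. b l * E l x) = (\<Sum>l<n. b l * E l x)"
  proof eventually_elim
    case (elim x)
    then show ?case by (intro sum.mono_neutral_left) (auto simp: J_def)
  qed
  then have "(LINT x|M. (cmod (g x - (\<Sum>f\<in>E ` J. c f * f x)))\<^sup>2)
      = (LINT x|M. (cmod (g x - (\<Sum>l<n. b l * E l x)))\<^sup>2)"
    unfolding sum
    by (intro integral_cong_AE) (auto intro!: borel_measurable_power borel_measurable_norm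
        borel_measurable_diff borel_measurable_sum borel_measurable_times Em simp: J_def)
  then show "\<exists>F a. finite F \<and> (\<forall>f\<in>F. \<exists>c. koopman_eigenfunction T M c f) \<and>
      sqrt (LINT x|M. (cmod (g x - (\<Sum>f\<in>F. a f * f x)))\<^sup>2) < e"
    using less E J by (intro exI[of _ "E ` J"] exI[of _ c]) (auto simp: J_def koopman_eigenfunction_def)
qed

text \<open>
  Jensen's inequality for the square of the distance to \<open>z\<close>.
\<close>

lemma cmod_average_diff_square_le:
  fixes k :: "'i \<Rightarrow> real" and h :: "'i \<Rightarrow> complex"
  assumes nonneg: "\<And>s. s \<in> S \<Longrightarrow> 0 \<le> k s" and one: "(\<Sum>s\<in>S. k s) = 1"
  shows "(cmod (z - (\<Sum>s\<in>S. h s * of_real (k s))))\<^sup>2 \<le> (\<Sum>s\<in>S. k s * (cmod (z - h s))\<^sup>2)"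
proof -
  have "(\<Sum>s\<in>S. z * of_real (k s)) = z * of_real (\<Sum>s\<in>S. k s)"
    by (simp only: of_real_sum sum_distrib_left)
  then have "z - (\<Sum>s\<in>S. h s * of_real (k s)) = (\<Sum>s\<in>S. of_real (k s) * (z - h s))"
    by (simp add: one algebra_simps sum_subtractf)
  also have "cmod \<dots> \<le> (\<Sum>s\<in>S. k s * cmod (z - h s))"
    by (rule order_trans[OF norm_sum]) (simp add: norm_mult nonneg)
  finally have "(cmod (z - (\<Sum>s\<in>S. h s * of_real (k s))))\<^sup>2 \<le> (\<Sum>s\<in>S. k s * cmod (z - h s))\<^sup>2"
    by (intro power_mono) auto
  also have "(\<Sum>s\<in>S. k s * cmod (z - h s)) = (\<Sum>s\<in>S. sqrt (k s) * (sqrt (k s) * cmod (z - h s)))"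
    using nonneg by (intro sum.cong refl) (simp flip: mult.assoc)
  also have "\<dots>\<^sup>2 \<le> (\<Sum>s\<in>S. (sqrt (k s))\<^sup>2) * (\<Sum>s\<in>S. (sqrt (k s) * cmod (z - h s))\<^sup>2)"
    by (rule Cauchy_Schwarz_ineq_sum)
  also have "\<dots> = (\<Sum>s\<in>S. k s * (cmod (z - h s))\<^sup>2)"
    using nonneg one by (simp add: power_mult_distrib)
  finally show ?thesis .
qed

definition root_of_unity :: "nat \<Rightarrow> nat \<Rightarrow> complex" where
  "root_of_unity Q l = cis (2 * pi * real l / real Q)"

lemma root_of_unity_power: "0 < Q \<Longrightarrow> root_of_unity Q l ^ Q = 1"
  using cis_multiple_2pi[of "real l"] unfolding root_of_unity_def Complex.DeMoivre by (simp add: mult_ac)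

lemma root_of_unity_commute: "root_of_unity Q l ^ s = root_of_unity Q s ^ l"
  unfolding root_of_unity_def Complex.DeMoivre by (simp add: mult_ac)

lemma cmod_root_of_unity [simp]: "cmod (root_of_unity Q l) = 1"
  by (simp add: root_of_unity_def)

text \<open>
  Orthogonality of the characters of the cyclic group of order \<open>Q\<close>.
\<close>

lemma sum_roots_of_unity:
  assumes "s < Q" "t < Q"
  shows "(\<Sum>l<Q. root_of_unity Q l ^ s * cnj (root_of_unity Q l) ^ t) = (if s = t then of_nat Q else 0)"
proof -
  let ?u = "root_of_unity Q s * cnj (root_of_unity Q t)"
  have *: "root_of_unity Q l ^ s * cnj (root_of_unity Q l) ^ t = ?u ^ l" for l
  proof -
    have "cnj (root_of_unity Q l) ^ t = cnj (root_of_unity Q t) ^ l"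
      using root_of_unity_commute[of Q l t] by (metis complex_cnj_power)
    then show ?thesis using root_of_unity_commute[of Q l s] by (simp add: power_mult_distrib)
  qed
  have cnj: "root_of_unity Q t * cnj (root_of_unity Q t) = 1"
    using complex_norm_square[of "root_of_unity Q t"] by simp
  show ?thesis
  proof (cases "s = t")
    case True
    then show ?thesis unfolding * using cnj by simp
  next
    case False
    have "?u \<noteq> 1"
    proof
      assume "?u = 1"
      then have "root_of_unity Q s * (root_of_unity Q t * cnj (root_of_unity Q t)) = root_of_unity Q t"
        by (simp add: mult.left_commute)
      then have "root_of_unity Q s = root_of_unity Q t" using cnj by simp
      then show False
        using Complex.bij_betw_roots_unity[of Q] assms False
        by (auto simp: bij_betw_def inj_on_def root_of_unity_def)
    qed
    moreover have "?u ^ Q = 1"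
      using root_of_unity_power[of Q s] root_of_unity_power[of Q t] assms
      by (simp add: power_mult_distrib flip: complex_cnj_power)
    ultimately show ?thesis unfolding * using False by (simp add: geometric_sum)
  qed
qed

text \<open>
  \<open>T'\<close> is a measurable left inverse of \<open>T\<close>.  It is needed to know that every measurable set is
  a preimage under \<open>T\<close> of a measurable set.
\<close>

locale odometer_factor = odometer P \<tau> a
  for P :: "'w measure" and \<tau> a +
  fixes \<phi> :: "'w \<Rightarrow> 'x::topological_space" and T T' :: "'x \<Rightarrow> 'x"
  assumes factor_measurable [measurable]: "\<phi> \<in> borel_measurable P"
    and T_measurable [measurable]: "T \<in> borel_measurable borel"
    and T'_measurable [measurable]: "T' \<in> borel_measurable borel"
    and T'_T: "\<And>x. T' (T x) = x"
    and factor_tau: "\<And>w. w \<in> space P \<Longrightarrow> \<phi> (\<tau> w) = T (\<phi> w)"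
begin

definition factor_measure :: "'x measure" where
  "factor_measure = distr P borel \<phi>"

lemma sets_factor_measure [simp, measurable_cong]: "sets factor_measure = sets borel"
  by (simp add: factor_measure_def)

lemma space_factor_measure [simp]: "space factor_measure = UNIV"
  by (simp add: factor_measure_def)

lemma measurable_factor_measure [simp]: "measurable factor_measure M = measurable borel M"
  by (rule measurable_cong_sets) simp_all

sublocale factor: prob_space factor_measure
  unfolding factor_measure_def by (rule prob_space_distr) measurable

lemma distr_T_factor_measure: "distr factor_measure borel T = factor_measure"
proof -
  have "distr factor_measure borel T = distr P borel (\<lambda>w. T (\<phi> w))"
    unfolding factor_measure_def by (simp add: distr_distr comp_def)
  also have "\<dots> = distr P borel (\<lambda>w. \<phi> (\<tau> w))"
    by (intro distr_cong refl) (simp add: factor_tau)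
  also have "\<dots> = distr (distr P P \<tau>) borel \<phi>"
    by (simp add: distr_distr comp_def)
  finally show ?thesis by (simp add: tau_invariant factor_measure_def)
qed

lemma invariant_factor_measure: "invariant_prob T factor_measure"
  unfolding invariant_prob_def
  using distr_cong[of factor_measure factor_measure factor_measure borel T T] distr_T_factor_measure
    factor.prob_space_axioms by simp

lemma ergodic_factor_measure: "ergodic_prob T factor_measure"
  unfolding ergodic_prob_def
proof (intro conjI ballI impI invariant_factor_measure)
  fix A assume A: "A \<in> sets factor_measure" and inv: "T -` A = A"
  let ?A = "\<phi> -` A \<inter> space P"
  have [measurable]: "A \<in> sets borel" using A by simp
  have "prob ?A = 0 \<or> prob ?A = 1"
  proof (rule invariant_event_trivial)
    fix w assume w: "w \<in> space P"
    then show "\<tau> w \<in> ?A \<longleftrightarrow> w \<in> ?A"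
      using inv measurable_space[OF tau_measurable w] by (auto simp: factor_tau)
  qed measurable
  then show "factor.prob A = 0 \<or> factor.prob A = 1"
    by (simp add: factor_measure_def measure_distr)
qed

lemma square_integrable_factor:
  assumes "square_integrable factor_measure f"
  shows "square_integrable P (\<lambda>w. f (\<phi> w))"
proof -
  have [measurable]: "f \<in> borel_measurable borel"
    using assms by (simp add: square_integrable_def)
  show ?thesis
    using assms unfolding square_integrable_def factor_measure_def
    by (subst (asm) integrable_distr_eq) auto
qed

text \<open>
  Composition with the factor map turns an eigenfunction of the factor into one of the odometer with the
  same eigenvalue.
\<close>

lemma eigenvalue_factor:
  assumes "koopman_eigenfunction T factor_measure c f"
  shows "\<exists>q>0. c ^ q = 1"
proof (rule eigenvalue_root_of_unity)
  have f: "square_integrable factor_measure f" "\<not> (AE x in factor_measure. f x = 0)"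
      "AE x in factor_measure. f (T x) = c * f x"
    using assms by (auto simp: koopman_eigenfunction_def)
  have [measurable]: "f \<in> borel_measurable borel"
    using f(1) by (simp add: square_integrable_def)
  show "square_integrable P (\<lambda>w. f (\<phi> w))" by (rule square_integrable_factor[OF f(1)])
  show "\<not> (AE w in P. f (\<phi> w) = 0)"
    using f(2) unfolding factor_measure_def by (subst (asm) AE_distr_iff) auto
  have "AE w in P. f (T (\<phi> w)) = c * f (\<phi> w)"
    using f(3) unfolding factor_measure_def by (rule AE_distrD[rotated]) simp
  then show "AE w in P. f (\<phi> (\<tau> w)) = c * f (\<phi> w)"
    by (rule AE_mp) (simp add: factor_tau)
qed

text \<open>
  Both events correspond to each other under \<open>\<tau>\<close>, which preserves the measure.
\<close>

lemma emeasure_fibre_succ: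
  assumes [measurable]: "C \<in> sets borel" and s: "s < fact N"
  shows "emeasure P {w \<in> space P. T' (\<phi> w) \<in> C \<and> a N w = (s + 1) mod fact N}
    = emeasure P {w \<in> space P. \<phi> w \<in> C \<and> a N w = s}"
proof -
  let ?A = "{w \<in> space P. T' (\<phi> w) \<in> C \<and> a N w = (s + 1) mod fact N}"
  have "emeasure P ?A = emeasure (distr P P \<tau>) ?A" by (simp add: tau_invariant)
  also have "\<dots> = emeasure P (\<tau> -` ?A \<inter> space P)" by (rule emeasure_distr) measurable
  also have "\<tau> -` ?A \<inter> space P = {w \<in> space P. \<phi> w \<in> C \<and> a N w = s}"
  proof (rule set_eqI)
    fix w
    show "w \<in> \<tau> -` ?A \<inter> space P \<longleftrightarrow> w \<in> {w \<in> space P. \<phi> w \<in> C \<and> a N w = s}"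
    proof (cases "w \<in> space P")
      case True
      have "(a N w + 1) mod fact N = (s + 1) mod fact N \<longleftrightarrow> a N w = s"
        using bij_betw_succ_mod[of "fact N"] residue_less[OF True, of N] s
        by (intro inj_on_eq_iff[of "\<lambda>s. (s + 1) mod fact N" "{..<fact N}"]) (auto simp: bij_betw_def)
      then show ?thesis
        using True measurable_space[OF tau_measurable True]
        by (simp add: factor_tau T'_T residue_tau)
    qed simp
  qed
  finally show ?thesis .
qed

text \<open>
  \<open>k s x\<close> is the conditional probability of the residue class \<open>s\<close> modulo \<open>N!\<close> given the point \<open>x\<close> of
  the factor, obtained as a Radon--Nikodym derivative with respect to the factor measure.
\<close>

lemma conditional_probabilities:
  obtains k :: "nat \<Rightarrow> 'x \<Rightarrow> real" where "\<And>s. k s \<in> borel_measurable borel" and "\<And>s x. 0 \<le> k s x"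
    and "\<And>s C. C \<in> sets borel \<Longrightarrow>
      (\<integral>\<^sup>+x. ennreal (k s x) * indicator C x \<partial>factor_measure) = emeasure P {w \<in> space P. \<phi> w \<in> C \<and> a N w = s}"
    and "\<And>s f. f \<in> borel_measurable borel \<Longrightarrow>
      (\<integral>\<^sup>+x. ennreal (k s x) * f x \<partial>factor_measure) = (\<integral>\<^sup>+w. indicator (cylinder N s) w * f (\<phi> w) \<partial>P)"
proof -
  define \<kappa> where "\<kappa> s = distr (density P (indicator (cylinder N s))) borel \<phi>" for s
  have int_\<kappa>: "integral\<^sup>N (\<kappa> s) f = (\<integral>\<^sup>+w. indicator (cylinder N s) w * f (\<phi> w) \<partial>P)"
    if [measurable]: "f \<in> borel_measurable borel" for s f
    unfolding \<kappa>_def by (simp add: nn_integral_distr nn_integral_density)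
  have em_\<kappa>: "emeasure (\<kappa> s) C = emeasure P {w \<in> space P. \<phi> w \<in> C \<and> a N w = s}"
    if [measurable]: "C \<in> sets borel" for s C
  proof -
    have "emeasure (\<kappa> s) C = (\<integral>\<^sup>+x. indicator C x \<partial>\<kappa> s)"
      by (simp add: \<kappa>_def)
    also have "\<dots> = (\<integral>\<^sup>+w. indicator (cylinder N s) w * indicator C (\<phi> w) \<partial>P)"
      by (rule int_\<kappa>) measurable
    also have "\<dots> = (\<integral>\<^sup>+w. indicator {w \<in> space P. \<phi> w \<in> C \<and> a N w = s} w \<partial>P)"
      by (intro nn_integral_cong) (auto simp: indicator_def)
    finally show ?thesis by simp
  qed
  have "\<exists>k. k \<in> borel_measurable borel \<and> (\<forall>x. 0 \<le> k x) \<and> density factor_measure (\<lambda>x. ennreal (k x)) = \<kappa> s" for s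
  proof -
    have ac: "absolutely_continuous factor_measure (\<kappa> s)"
      unfolding absolutely_continuous_def
    proof
      fix C assume C: "C \<in> null_sets factor_measure"
      then have [measurable]: "C \<in> sets borel" by auto
      have "emeasure P {w \<in> space P. \<phi> w \<in> C \<and> a N w = s} \<le> emeasure P (\<phi> -` C \<inter> space P)"
        by (rule emeasure_mono) auto
      also have "\<dots> = 0"
        using C by (auto simp: factor_measure_def emeasure_distr null_sets_def)
      finally show "C \<in> null_sets (\<kappa> s)"
        using em_\<kappa>[of C s] by (auto simp: null_sets_def \<kappa>_def)
    qed
    have fin: "finite_measure (\<kappa> s)"
      using em_\<kappa>[of UNIV s] by (intro finite_measureI) (simp add: \<kappa>_def emeasure_eq_measure)
    have sets: "sets (\<kappa> s) = sets factor_measure" by (simp add: \<kappa>_def)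
    obtain k where k: "k \<in> borel_measurable factor_measure"
        "AE x in factor_measure. RN_deriv factor_measure (\<kappa> s) x = ennreal (k x)"
        "AE x in \<kappa> s. 0 < k x" "\<And>x. 0 \<le> k x"
      by (rule factor.real_RN_deriv[OF fin ac sets]) blast
    then have "density factor_measure (\<lambda>x. ennreal (k x))
        = density factor_measure (RN_deriv factor_measure (\<kappa> s))"
      by (intro density_cong) auto
    then show ?thesis using k factor.density_RN_deriv[OF ac sets] by auto
  qed
  then obtain k where k [measurable]: "\<And>s. k s \<in> borel_measurable borel" and k0: "\<And>s x. 0 \<le> k s x"
    and dens: "\<And>s. density factor_measure (\<lambda>x. ennreal (k s x)) = \<kappa> s"
    by (atomize_elim, simp only: all_conj_distrib[symmetric], intro choice allI)
  show ?thesis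
  proof
    fix s and f :: "'x \<Rightarrow> ennreal" assume [measurable]: "f \<in> borel_measurable borel"
    have "(\<integral>\<^sup>+x. ennreal (k s x) * f x \<partial>factor_measure)
        = integral\<^sup>N (density factor_measure (\<lambda>x. ennreal (k s x))) f"
      by (subst nn_integral_density) auto
    then show "(\<integral>\<^sup>+x. ennreal (k s x) * f x \<partial>factor_measure)
        = (\<integral>\<^sup>+w. indicator (cylinder N s) w * f (\<phi> w) \<partial>P)"
      by (simp add: dens int_\<kappa>)
  next
    fix s and C :: "'x set" assume C [measurable]: "C \<in> sets borel"
    have "(\<integral>\<^sup>+x. ennreal (k s x) * indicator C x \<partial>factor_measure)
        = emeasure (density factor_measure (\<lambda>x. ennreal (k s x))) C"
      by (subst emeasure_density) auto
    then show "(\<integral>\<^sup>+x. ennreal (k s x) * indicator C x \<partial>factor_measure)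
        = emeasure P {w \<in> space P. \<phi> w \<in> C \<and> a N w = s}"
      by (simp add: dens em_\<kappa>)
  qed (use k k0 in auto)
qed

text \<open>
  Residues of \<open>w\<close> need not be functions of the factor, but their conditional probabilities \<open>k s\<close> are.
  Since \<open>k (s + 1) \<circ> T = k s\<close>, the Fourier transforms \<open>E l\<close> of \<open>s \<mapsto> k s\<close> are eigenvectors, and they have the
  same span as the \<open>k s\<close>.  If \<open>h (a N w)\<close> is close to \<open>g (\<phi> w)\<close> then its conditional expectation
  \<open>\<Sum> h s * k s\<close> is at least as close to \<open>g\<close>.
\<close>

lemma discrete_spectrum_factor: "discrete_spectrum T factor_measure"
proof (rule discrete_spectrumI)
  fix g and e :: real
  assume g: "square_integrable factor_measure g" and "0 < e"
  have [measurable]: "g \<in> borel_measurable borel" using g by (simp add: square_integrable_def)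
  have "0 < e\<^sup>2" using \<open>0 < e\<close> by simp
  obtain N h where int: "integrable P (\<lambda>w. (cmod (g (\<phi> w) - h (a N w)))\<^sup>2)"
    and less: "(LINT w|P. (cmod (g (\<phi> w) - h (a N w)))\<^sup>2) < e\<^sup>2"
    by (rule residue_functions_dense[OF square_integrable_factor[OF g] \<open>0 < e\<^sup>2\<close>])
  define Q :: nat where "Q = fact N"
  have Q: "0 < Q" by (simp add: Q_def)
  obtain k where k [measurable]: "\<And>s. k s \<in> borel_measurable (borel :: 'x measure)"
    and k0: "\<And>s x. 0 \<le> k s x"
    and k_set: "\<And>s C. C \<in> sets borel \<Longrightarrow> (\<integral>\<^sup>+x. ennreal (k s x) * indicator C x \<partial>factor_measure)
        = emeasure P {w \<in> space P. \<phi> w \<in> C \<and> a N w = s}"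
    and k_int: "\<And>s f. f \<in> borel_measurable borel \<Longrightarrow> (\<integral>\<^sup>+x. ennreal (k s x) * f x \<partial>factor_measure)
        = (\<integral>\<^sup>+w. indicator (cylinder N s) w * f (\<phi> w) \<partial>P)"
    by (rule conditional_probabilities[of N]) blast
  have sum_cyl: "(\<Sum>s<Q. indicator (cylinder N s) w * f s) = f (a N w)"
    if "w \<in> space P" for w and f :: "nat \<Rightarrow> ennreal"
    using that residue_less[OF that, of N]
    by (subst sum.mono_neutral_right[of _ "{a N w}"]) (auto simp: indicator_def Q_def)
  have "AE x in factor_measure. (\<Sum>s<Q. ennreal (k s x)) = 1"
  proof (rule factor.density_unique2)
    fix C assume "C \<in> sets factor_measure"
    then have [measurable]: "C \<in> sets borel" by simp
    have "(\<integral>\<^sup>+x. (\<Sum>s<Q. ennreal (k s x)) * indicator C x \<partial>factor_measure)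
        = (\<Sum>s<Q. \<integral>\<^sup>+x. ennreal (k s x) * indicator C x \<partial>factor_measure)"
      unfolding sum_distrib_right by (rule nn_integral_sum) measurable
    also have "\<dots> = (\<Sum>s<Q. \<integral>\<^sup>+w. indicator (cylinder N s) w * indicator C (\<phi> w) \<partial>P)"
      by (intro sum.cong refl k_int) measurable
    also have "\<dots> = (\<integral>\<^sup>+w. (\<Sum>s<Q. indicator (cylinder N s) w * indicator C (\<phi> w)) \<partial>P)"
      by (rule nn_integral_sum[symmetric]) measurable
    also have "\<dots> = (\<integral>\<^sup>+w. indicator C (\<phi> w) \<partial>P)"
      by (intro nn_integral_cong sum_cyl)
    also have "\<dots> = (\<integral>\<^sup>+x. 1 * indicator C x \<partial>factor_measure)"
      unfolding factor_measure_def by (subst nn_integral_distr) auto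
    finally show "(\<integral>\<^sup>+x. (\<Sum>s<Q. ennreal (k s x)) * indicator C x \<partial>factor_measure)
        = (\<integral>\<^sup>+x. 1 * indicator C x \<partial>factor_measure)" .
  qed auto
  then have k1: "AE x in factor_measure. (\<Sum>s<Q. k s x) = 1"
    by eventually_elim (simp add: k0)
  have k_succ: "AE x in factor_measure. k ((s + 1) mod Q) (T x) = k s x" if "s < Q" for s
  proof -
    let ?t = "(s + 1) mod Q"
    have "AE x in factor_measure. ennreal (k ?t (T x)) = ennreal (k s x)"
    proof (rule factor.density_unique2)
      fix C assume "C \<in> sets factor_measure"
      then have [measurable]: "C \<in> sets borel" by simp
      have [measurable]: "T' -` C \<in> sets borel"
        using measurable_sets[OF T'_measurable, of C] by simp
      have "(\<integral>\<^sup>+x. ennreal (k ?t (T x)) * indicator C x \<partial>factor_measure)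
          = (\<integral>\<^sup>+x. ennreal (k ?t (T x)) * indicator (T' -` C) (T x) \<partial>factor_measure)"
        by (intro nn_integral_cong) (simp add: indicator_def T'_T)
      also have "\<dots> = (\<integral>\<^sup>+x. ennreal (k ?t x) * indicator (T' -` C) x \<partial>distr factor_measure borel T)"
        by (subst nn_integral_distr) auto
      also have "\<dots> = emeasure P {w \<in> space P. \<phi> w \<in> T' -` C \<and> a N w = ?t}"
        unfolding distr_T_factor_measure by (rule k_set) measurable
      also have "\<dots> = emeasure P {w \<in> space P. \<phi> w \<in> C \<and> a N w = s}"
        using emeasure_fibre_succ[of C s N] that by (simp add: Q_def)
      also have "\<dots> = (\<integral>\<^sup>+x. ennreal (k s x) * indicator C x \<partial>factor_measure)"
        by (rule k_set[symmetric]) measurable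
      finally show "(\<integral>\<^sup>+x. ennreal (k ?t (T x)) * indicator C x \<partial>factor_measure)
          = (\<integral>\<^sup>+x. ennreal (k s x) * indicator C x \<partial>factor_measure)" .
    qed auto
    then show ?thesis by eventually_elim (simp add: k0)
  qed
  define \<zeta> where "\<zeta> = root_of_unity Q"
  define E where "E l x = (\<Sum>s<Q. \<zeta> l ^ s * of_real (k s x))" for l x
  define b where "b l = (\<Sum>t<Q. h t * cnj (\<zeta> l) ^ t) / of_nat Q" for l
  have [measurable]: "E l \<in> borel_measurable borel" for l unfolding E_def by measurable
  have E_eigen: "AE x in factor_measure. E l (T x) = \<zeta> l * E l x" for l
  proof -
    have "AE x in factor_measure. \<forall>s\<in>{..<Q}. k ((s + 1) mod Q) (T x) = k s x"
      by (intro AE_finite_allI k_succ) auto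
    then show ?thesis
    proof eventually_elim
      case (elim x)
      have "E l (T x) = (\<Sum>s<Q. \<zeta> l ^ ((s + 1) mod Q) * of_real (k ((s + 1) mod Q) (T x)))"
        unfolding E_def by (rule sum.reindex_bij_betw[OF bij_betw_succ_mod[OF Q], symmetric])
      also have "\<dots> = (\<Sum>s<Q. \<zeta> l * (\<zeta> l ^ s * of_real (k s x)))"
      proof (intro sum.cong refl)
        fix s assume s: "s \<in> {..<Q}"
        \<comment> \<open>The exponent matters only modulo \<open>Q\<close>, so the wrap-around from \<open>Q - 1\<close> to 0 is harmless.\<close>
        have "\<zeta> l ^ (s + 1) = \<zeta> l ^ (Q * ((s + 1) div Q) + (s + 1) mod Q)" by simp
        also have "\<dots> = \<zeta> l ^ ((s + 1) mod Q)"
          using root_of_unity_power[OF Q, of l] by (simp only: power_add power_mult \<zeta>_def) simp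
        finally show "\<zeta> l ^ ((s + 1) mod Q) * of_real (k ((s + 1) mod Q) (T x)) = \<zeta> l * (\<zeta> l ^ s * of_real (k s x))"
          using elim s by simp
      qed
      finally show ?case by (simp add: E_def sum_distrib_left)
    qed
  qed
  have "square_integrable factor_measure (E l)" for l
    unfolding square_integrable_def
  proof (intro conjI factor.integrable_const_bound[of _ 1])
    show "AE x in factor_measure. norm ((cmod (E l x))\<^sup>2) \<le> 1"
      using k1
    proof eventually_elim
      case (elim x)
      have "cmod (E l x) \<le> (\<Sum>s<Q. k s x)"
        unfolding E_def by (rule order_trans[OF norm_sum]) (simp add: norm_mult norm_power \<zeta>_def k0)
      then show ?case using elim by (simp add: power_le_one)
    qed
  qed auto
  moreover have sum_bE: "(\<Sum>l<Q. b l * E l x) = (\<Sum>s<Q. h s * of_real (k s x))" for x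
  proof -
    have "(\<Sum>l<Q. b l * E l x)
        = (\<Sum>l<Q. \<Sum>t<Q. \<Sum>s<Q. h t * of_real (k s x) * (\<zeta> l ^ s * cnj (\<zeta> l) ^ t) / of_nat Q)"
      unfolding b_def E_def sum_divide_distrib sum_product by (intro sum.cong refl) (simp add: mult_ac)
    also have "\<dots> = (\<Sum>t<Q. \<Sum>l<Q. \<Sum>s<Q. h t * of_real (k s x) * (\<zeta> l ^ s * cnj (\<zeta> l) ^ t) / of_nat Q)"
      by (rule sum.swap)
    also have "\<dots> = (\<Sum>t<Q. \<Sum>s<Q. \<Sum>l<Q. h t * of_real (k s x) * (\<zeta> l ^ s * cnj (\<zeta> l) ^ t) / of_nat Q)"
      by (intro sum.cong refl sum.swap)
    also have "\<dots> = (\<Sum>t<Q. \<Sum>s<Q. h t * of_real (k s x) * (if s = t then of_nat Q else 0) / of_nat Q)"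
      by (intro sum.cong refl)
        (simp add: sum_roots_of_unity \<zeta>_def sum_distrib_left[symmetric] sum_divide_distrib[symmetric])
    also have "\<dots> = (\<Sum>t<Q. h t * of_real (k t x))"
      using Q by (intro sum.cong refl) (simp add: if_distrib[of "\<lambda>z. _ * z / _"] cong: if_cong)
    finally show ?thesis .
  qed
  have "sqrt (LINT x|factor_measure. (cmod (g x - (\<Sum>l<Q. b l * E l x)))\<^sup>2) < e"
  proof -
    have "(\<integral>\<^sup>+x. ennreal ((cmod (g x - (\<Sum>l<Q. b l * E l x)))\<^sup>2) \<partial>factor_measure)
        \<le> (\<integral>\<^sup>+x. (\<Sum>s<Q. ennreal (k s x) * ennreal ((cmod (g x - h s))\<^sup>2)) \<partial>factor_measure)"
    proof (rule nn_integral_mono_AE)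
      show "AE x in factor_measure. ennreal ((cmod (g x - (\<Sum>l<Q. b l * E l x)))\<^sup>2)
          \<le> (\<Sum>s<Q. ennreal (k s x) * ennreal ((cmod (g x - h s))\<^sup>2))"
        using k1
      proof eventually_elim
        case (elim x)
        have "(cmod (g x - (\<Sum>l<Q. b l * E l x)))\<^sup>2 \<le> (\<Sum>s<Q. k s x * (cmod (g x - h s))\<^sup>2)"
          unfolding sum_bE by (intro cmod_average_diff_square_le k0 elim)
        then have "ennreal ((cmod (g x - (\<Sum>l<Q. b l * E l x)))\<^sup>2)
            \<le> ennreal (\<Sum>s<Q. k s x * (cmod (g x - h s))\<^sup>2)" by (rule ennreal_leI)
        also have "\<dots> = (\<Sum>s<Q. ennreal (k s x) * ennreal ((cmod (g x - h s))\<^sup>2))"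
          by (simp add: k0 ennreal_mult' sum_ennreal[symmetric])
        finally show ?case .
      qed
    qed
    also have "\<dots> = (\<Sum>s<Q. \<integral>\<^sup>+x. ennreal (k s x) * ennreal ((cmod (g x - h s))\<^sup>2) \<partial>factor_measure)"
      by (rule nn_integral_sum) measurable
    also have "\<dots> = (\<Sum>s<Q. \<integral>\<^sup>+w. indicator (cylinder N s) w * ennreal ((cmod (g (\<phi> w) - h s))\<^sup>2) \<partial>P)"
      by (intro sum.cong refl k_int) measurable
    also have "\<dots> = (\<integral>\<^sup>+w. (\<Sum>s<Q. indicator (cylinder N s) w * ennreal ((cmod (g (\<phi> w) - h s))\<^sup>2)) \<partial>P)"
      by (rule nn_integral_sum[symmetric]) measurable
    also have "\<dots> = (\<integral>\<^sup>+w. ennreal ((cmod (g (\<phi> w) - h (a N w)))\<^sup>2) \<partial>P)"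
      by (intro nn_integral_cong sum_cyl)
    also have "\<dots> = ennreal (LINT w|P. (cmod (g (\<phi> w) - h (a N w)))\<^sup>2)"
      by (intro nn_integral_eq_integral int) auto
    finally have le: "(\<integral>\<^sup>+x. ennreal ((cmod (g x - (\<Sum>l<Q. b l * E l x)))\<^sup>2) \<partial>factor_measure)
        \<le> ennreal (LINT w|P. (cmod (g (\<phi> w) - h (a N w)))\<^sup>2)" .
    have "(LINT x|factor_measure. (cmod (g x - (\<Sum>l<Q. b l * E l x)))\<^sup>2)
        = enn2real (\<integral>\<^sup>+x. ennreal ((cmod (g x - (\<Sum>l<Q. b l * E l x)))\<^sup>2) \<partial>factor_measure)"
      by (rule integral_eq_nn_integral) auto
    also have "\<dots> \<le> (LINT w|P. (cmod (g (\<phi> w) - h (a N w)))\<^sup>2)"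
      using enn2real_mono[OF le] by simp
    finally have "sqrt (LINT x|factor_measure. (cmod (g x - (\<Sum>l<Q. b l * E l x)))\<^sup>2) < sqrt (e\<^sup>2)"
      using less by (simp only: real_sqrt_less_iff)
    then show ?thesis using \<open>0 < e\<close> by simp
  qed
  then show "\<exists>(n::nat) E b.
      (\<forall>l<n. square_integrable factor_measure (E l) \<and> (\<exists>c. AE x in factor_measure. E l (T x) = c * E l x)) \<and>
      sqrt (LINT x|factor_measure. (cmod (g x - (\<Sum>l<n. b l * E l x)))\<^sup>2) < e"
    using calculation E_eigen by blast
qed

lemma rational_discrete_spectrum_factor: "rational_discrete_spectrum T factor_measure"
  unfolding rational_discrete_spectrum_def
  using discrete_spectrum_factor eigenvalue_factor by blast

end

section \<open>Entropy of factors of the odometer\<close>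

lemma measurable_funpow:
  assumes [measurable]: "T \<in> measurable M M"
  shows "T ^^ n \<in> measurable M M"
proof (induction n)
  case 0
  then show ?case by (simp add: id_def)
next
  case (Suc n)
  note Suc [measurable]
  show ?case unfolding funpow.simps(2) comp_def by measurable
qed

lemma finite_partition_iterated:
  assumes T: "T \<in> measurable M M" and P: "finite_partition M P"
  shows "finite_partition M (iterated_partition T M P n)"
proof (induction n)
  case 0
  then show ?case by (simp add: finite_partition_def)
next
  case (Suc n)
  let ?I = "iterated_partition T M P n" and ?f = "\<lambda>(A, C). A \<inter> ((T ^^ n) -` C \<inter> space M)"
  have Tn: "T ^^ n \<in> measurable M M" by (rule measurable_funpow[OF T])
  have eq: "iterated_partition T M P (Suc n) = ?f ` (?I \<times> P)" by auto
  have "finite (?f ` (?I \<times> P))" using Suc P by (auto simp: finite_partition_def)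
  moreover have "?f ` (?I \<times> P) \<subseteq> sets M"
    using Suc P measurable_sets[OF Tn] by (auto simp: finite_partition_def)
  moreover have "disjoint (?f ` (?I \<times> P))"
  proof (rule disjointI)
    fix A A' assume A: "A \<in> ?f ` (?I \<times> P)" "A' \<in> ?f ` (?I \<times> P)" "A \<noteq> A'"
    then obtain D C D' C' where D: "D \<in> ?I" "C \<in> P" "A = ?f (D, C)" "D' \<in> ?I" "C' \<in> P" "A' = ?f (D', C')"
      by blast
    then have "D \<noteq> D' \<or> C \<noteq> C'" using A(3) by auto
    then have "D \<inter> D' = {} \<or> C \<inter> C' = {}"
      using D Suc P disjointD[of ?I D D'] disjointD[of P C C'] by (auto simp: finite_partition_def)
    then show "A \<inter> A' = {}" using D by auto
  qed
  moreover have "\<Union>(?f ` (?I \<times> P)) = space M"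
  proof (intro equalityI subsetI)
    fix x assume x: "x \<in> space M"
    then have "(T ^^ n) x \<in> space M" using measurable_space[OF Tn] by blast
    then obtain A C where "A \<in> ?I" "x \<in> A" "C \<in> P" "(T ^^ n) x \<in> C"
      using x Suc P unfolding finite_partition_def by (metis UnionE)
    then show "x \<in> \<Union>(?f ` (?I \<times> P))" using x by (intro UnionI[of "?f (A, C)"]) auto
  qed auto
  ultimately show ?case unfolding eq finite_partition_def by blast
qed

lemma iterated_partition_cell:
  assumes "A \<in> iterated_partition T M P n" "i < n"
  shows "\<exists>C\<in>P. A \<subseteq> (T ^^ i) -` C"
  using assms
proof (induction n arbitrary: A)
  case (Suc n)
  from Suc.prems(1) obtain D C where A: "A = D \<inter> ((T ^^ n) -` C \<inter> space M)"
    "D \<in> iterated_partition T M P n" "C \<in> P" by auto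
  show ?case
  proof (cases "i = n")
    case True
    then show ?thesis using A by auto
  next
    case False
    then have "i < n" using Suc.prems(2) by simp
    from Suc.IH[OF A(2) this] show ?thesis using A(1) by blast
  qed
qed simp

lemma finite_partition_same_cell:
  assumes "finite_partition M P" "C \<in> P" "C' \<in> P" "x \<in> C" "x \<in> C'"
  shows "C = C'"
  using assms disjointD[of P C C'] by (auto simp: finite_partition_def)

text \<open>
  For a nonempty cell \<open>A\<close> of the iterated partition and cells \<open>z i\<close> of the original one, this is the Hamming distance between the itinerary of \<open>A\<close>
  and the word \<open>z\<close>: a cell is contained in \<open>(T ^^ i) -` z i\<close> as soon as it meets it.
\<close>

definition mismatches :: "('a \<Rightarrow> 'a) \<Rightarrow> (nat \<Rightarrow> 'a set) \<Rightarrow> nat \<Rightarrow> 'a set \<Rightarrow> nat" where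
  "mismatches T z n A = card {i. i < n \<and> \<not> A \<subseteq> (T ^^ i) -` z i}"

lemma mismatches_Suc:
  assumes P: "finite_partition M P" and z: "\<And>i. z i \<in> P"
    and A: "A \<in> iterated_partition T M P n" and C: "C \<in> P"
    and x: "x \<in> A \<inter> ((T ^^ n) -` C \<inter> space M)"
  shows "mismatches T z n A + (if C = z n then 0 else 1)
    \<le> mismatches T z (Suc n) (A \<inter> ((T ^^ n) -` C \<inter> space M))" (is "_ \<le> mismatches T z _ ?A")
proof -
  have "{i. i < n \<and> \<not> A \<subseteq> (T ^^ i) -` z i} \<union> (if C = z n then {} else {n})
      \<subseteq> {i. i < Suc n \<and> \<not> ?A \<subseteq> (T ^^ i) -` z i}" (is "?L \<subseteq> ?R")
  proof
    fix i assume i: "i \<in> ?L"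
    have "(T ^^ i) x \<notin> z i" "i < Suc n"
    proof -
      have "i < n \<and> \<not> A \<subseteq> (T ^^ i) -` z i \<or> i = n \<and> C \<noteq> z n"
        using i by (auto split: if_splits)
      then have "i < Suc n \<and> (T ^^ i) x \<notin> z i"
      proof
        assume *: "i < n \<and> \<not> A \<subseteq> (T ^^ i) -` z i"
        then obtain C' where "C' \<in> P" "A \<subseteq> (T ^^ i) -` C'"
          using iterated_partition_cell[OF A, of i] by blast
        then show ?thesis
          using * x finite_partition_same_cell[OF P \<open>C' \<in> P\<close> z, of "(T ^^ i) x" i] by auto
      next
        assume "i = n \<and> C \<noteq> z n"
        then show ?thesis using x finite_partition_same_cell[OF P C z, of "(T ^^ n) x" n] by auto
      qed
      then show "(T ^^ i) x \<notin> z i" "i < Suc n" by auto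
    qed
    then show "i \<in> ?R" using x by auto
  qed
  then have "card ?L \<le> card ?R" by (intro card_mono) auto
  moreover have "card ?L = mismatches T z n A + (if C = z n then 0 else 1)"
    by (auto simp: mismatches_def)
  ultimately show ?thesis by (simp add: mismatches_def)
qed

text \<open>
  If cells were words of length \<open>n\<close> over an alphabet of \<open>r\<close> letters, the sum over all words of
  \<open>exp (- t * distance)\<close> would be the product \<open>(1 + (r - 1) * exp (- t)) ^ n\<close>.
\<close>

lemma sum_exp_mismatches_le:
  fixes t :: real
  assumes T: "T \<in> measurable M M" and P: "finite_partition M P" and z: "\<And>i. z i \<in> P" and "0 \<le> t"
  shows "(\<Sum>A\<in>iterated_partition T M P n - {{}}. exp (- t * mismatches T z n A))
    \<le> (1 + card P * exp (- t)) ^ n"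
proof (induction n)
  case 0
  then show ?case by (cases "space M = {}") (auto simp: mismatches_def)
next
  case (Suc n)
  let ?I = "iterated_partition T M P n" and ?f = "\<lambda>(A, C). A \<inter> ((T ^^ n) -` C \<inter> space M)"
  let ?g = "\<lambda>A. exp (- t * mismatches T z (Suc n) A)"
  let ?w = "\<lambda>C. if C = z n then 1 else exp (- t)"
  have finI: "finite ?I" using finite_partition_iterated[OF T P] by (simp add: finite_partition_def)
  have finP: "finite P" using P by (simp add: finite_partition_def)
  \<comment> \<open>Pairs with empty intersection must be excluded before the estimate: the empty cell has no mismatches
    and would contribute 1.\<close>
  define J where "J = {p \<in> (?I - {{}}) \<times> P. ?f p \<noteq> {}}"
  have J: "finite J" unfolding J_def using finI finP by simp
  have eq: "iterated_partition T M P (Suc n) - {{}} = ?f ` J"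
    unfolding J_def by auto
  have "(\<Sum>A\<in>iterated_partition T M P (Suc n) - {{}}. ?g A) \<le> (\<Sum>p\<in>J. ?g (?f p))"
    unfolding eq using sum_image_le[OF J, of ?g ?f] by (simp add: comp_def)
  also have "\<dots> \<le> (\<Sum>(A, C)\<in>J. exp (- t * mismatches T z n A) * ?w C)"
  proof (rule sum_mono)
    fix p assume "p \<in> J"
    then obtain A C x where p: "p = (A, C)" "A \<in> ?I" "C \<in> P" and x: "x \<in> A \<inter> ((T ^^ n) -` C \<inter> space M)"
      unfolding J_def by fastforce
    have "real (mismatches T z n A) + (if C = z n then 0 else 1) \<le> mismatches T z (Suc n) (?f p)"
      using of_nat_mono[OF mismatches_Suc[where z = z, OF P z p(2,3) x], where 'a = real] p(1)
      by (simp split: if_splits)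
    then have "?g (?f p) \<le> exp (- t * (real (mismatches T z n A) + (if C = z n then 0 else 1)))"
      using \<open>0 \<le> t\<close> by (simp add: mult_left_mono)
    also have "\<dots> = exp (- t * mismatches T z n A) * ?w C"
      by (simp add: exp_add[symmetric] algebra_simps)
    finally show "?g (?f p) \<le> (case p of (A, C) \<Rightarrow> exp (- t * mismatches T z n A) * ?w C)"
      by (simp add: p(1))
  qed
  also have "\<dots> \<le> (\<Sum>(A, C)\<in>(?I - {{}}) \<times> P. exp (- t * mismatches T z n A) * ?w C)"
    using finI finP by (intro sum_mono2) (auto simp: J_def)
  also have "\<dots> = (\<Sum>A\<in>?I - {{}}. exp (- t * mismatches T z n A)) * (\<Sum>C\<in>P. ?w C)"
    by (simp add: sum_product sum.cartesian_product)
  also have "\<dots> \<le> (1 + card P * exp (- t)) ^ n * (1 + card P * exp (- t))"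
  proof (rule mult_mono[OF Suc.IH])
    have "(\<Sum>C\<in>P. ?w C) \<le> (\<Sum>C\<in>P. (if C = z n then 1 else 0) + exp (- t))"
      by (intro sum_mono) auto
    also have "\<dots> = 1 + card P * exp (- t)"
      using finP z by (simp add: sum.distrib sum.delta)
    finally show "(\<Sum>C\<in>P. ?w C) \<le> 1 + card P * exp (- t)" .
  qed (auto intro!: sum_nonneg)
  finally show ?case by (simp add: mult.commute)
qed

lemma sum_measure_partition:
  assumes "prob_space M" "finite_partition M P"
  shows "(\<Sum>A\<in>P. measure M A) = 1"
proof -
  interpret prob_space M by fact
  have "measure M (\<Union>A\<in>P. A) = (\<Sum>A\<in>P. measure M A)"
    using assms(2) by (intro finite_measure_finite_Union)
      (auto simp: finite_partition_def disjoint_family_on_def dest: disjointD)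
  then show ?thesis using assms(2) prob_space by (simp add: finite_partition_def)
qed

text \<open>
  Gibbs' inequality: the numbers \<open>exp (- c A) / K\<close> form a subprobability vector, against which the cross
  entropy of the partition is at least its entropy.  It reduces to \<open>ln x \<le> x - 1\<close>.
\<close>

lemma partition_entropy_le:
  assumes M: "prob_space M" and P: "finite_partition M P"
    and K: "(\<Sum>A\<in>P - {{}}. exp (- c A)) \<le> K"
  shows "partition_entropy M P \<le> (\<Sum>A\<in>P. measure M A * c A) + ln K"
proof -
  interpret prob_space M by fact
  have fin: "finite P" using P by (simp add: finite_partition_def)
  have "P - {{}} \<noteq> {}"
    using P not_empty by (auto simp: finite_partition_def)
  then have "0 < (\<Sum>A\<in>P - {{}}. exp (- c A))"
    using fin by (intro sum_pos) auto
  then have "0 < K" using K by simp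
  let ?d = "\<lambda>A. if A = {} then 0 else exp (- c A) / K"
  have term_le: "- (measure M A * ln (measure M A)) \<le> measure M A * c A + measure M A * ln K - measure M A + ?d A"
    if "A \<in> P" for A
  proof (cases "measure M A = 0")
    case True
    then show ?thesis using \<open>0 < K\<close> by simp
  next
    case False
    define p where "p = measure M A"
    have p: "0 < p" using False by (simp add: p_def zero_less_measure_iff)
    have "A \<noteq> {}" using False by auto
    have "ln (exp (- c A) / (p * K)) \<le> exp (- c A) / (p * K) - 1"
      using p \<open>0 < K\<close> by (intro ln_le_minus_one) simp
    moreover have "ln (exp (- c A) / (p * K)) = - c A - ln p - ln K"
      using p \<open>0 < K\<close> by (simp add: ln_div ln_mult)
    ultimately have "p * (- c A - ln p - ln K) \<le> p * (exp (- c A) / (p * K) - 1)"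
      using p by (intro mult_left_mono) auto
    also have "\<dots> = exp (- c A) / K - p" using p by (simp add: field_simps)
    finally show ?thesis using \<open>A \<noteq> {}\<close> by (simp add: p_def algebra_simps)
  qed
  have "partition_entropy M P \<le> (\<Sum>A\<in>P. measure M A * c A + measure M A * ln K - measure M A + ?d A)"
    unfolding partition_entropy_def sum_negf[symmetric] by (intro sum_mono term_le)
  also have "\<dots> = (\<Sum>A\<in>P. measure M A * c A) + ln K - 1 + (\<Sum>A\<in>P. ?d A)"
    by (simp add: sum.distrib sum_subtractf sum_distrib_right[symmetric] sum_measure_partition[OF M P])
  also have "(\<Sum>A\<in>P. ?d A) = (\<Sum>A\<in>P - {{}}. exp (- c A)) / K"
    using fin by (simp add: sum_divide_distrib sum.If_cases Diff_eq Collect_neg_eq[symmetric] Int_def) 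
  also have "\<dots> \<le> 1" using K \<open>0 < K\<close> by simp
  finally show ?thesis by simp
qed

lemma partition_entropy_nonneg:
  assumes "prob_space M"
  shows "0 \<le> partition_entropy M P"
proof -
  interpret prob_space M by fact
  have "measure M A * ln (measure M A) \<le> 0" for A
    by (cases "measure M A = 0") (auto simp: mult_nonneg_nonpos zero_less_measure_iff)
  then show ?thesis unfolding partition_entropy_def by (simp add: sum_nonpos)
qed

text \<open>
  Let \<open>M\<close> be the law of \<open>\<phi>\<close>, and suppose that the itinerary of \<open>\<phi> w\<close> agrees with the word \<open>z (s w)\<close> except with
  probability \<open>\<epsilon>\<close> at each time, where \<open>s w\<close> takes only \<open>card S\<close> values.  Assign to a cell
  \<open>t\<close> times its distance to the nearest code word as code length and apply Gibbs' inequality: the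
  normalizing constant is at most \<open>card S * (1 + r * exp (- t)) ^ n\<close>, and the expected code length is at
  most \<open>t * n * \<epsilon>\<close>.
\<close>

lemma partition_entropy_coded_le:
  assumes W: "prob_space W" and M: "distr W M \<phi> = M" and \<phi>: "\<phi> \<in> measurable W M"
    and T: "T \<in> measurable M M" and P: "finite_partition M P"
    and S: "finite S" "S \<noteq> {}" "\<And>w. w \<in> space W \<Longrightarrow> s w \<in> S" and z: "\<And>j i. z j i \<in> P"
    and ev: "\<And>i. {w \<in> space W. (T ^^ i) (\<phi> w) \<notin> z (s w) i} \<in> sets W"
    and \<epsilon>: "\<And>i. measure W {w \<in> space W. (T ^^ i) (\<phi> w) \<notin> z (s w) i} \<le> \<epsilon>"
    and "0 \<le> t"
  shows "partition_entropy M (iterated_partition T M P n)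
    \<le> ln (card S) + n * (ln (1 + card P * exp (- t)) + t * \<epsilon>)"
proof -
  interpret W: prob_space W by fact
  have pM: "prob_space M" using W.prob_space_distr[OF \<phi>] by (simp add: M)
  let ?I = "iterated_partition T M P n" and ?K = "1 + card P * exp (- t)"
  let ?E = "\<lambda>i. {w \<in> space W. (T ^^ i) (\<phi> w) \<notin> z (s w) i}"
  have I: "finite_partition M ?I" by (rule finite_partition_iterated[OF T P])
  then have finI: "finite ?I" and setsI: "\<And>A. A \<in> ?I \<Longrightarrow> A \<in> sets M"
    and UI: "\<Union>?I = space M" by (auto simp: finite_partition_def)
  define c where "c A = t * real (Min ((\<lambda>j. mismatches T (z j) n A) ` S))" for A
  have c_le: "c A \<le> t * mismatches T (z j) n A" if "j \<in> S" for A j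
    using that S \<open>0 \<le> t\<close> unfolding c_def by (intro mult_left_mono) auto
  have "(\<Sum>A\<in>?I - {{}}. exp (- c A)) \<le> (\<Sum>A\<in>?I - {{}}. \<Sum>j\<in>S. exp (- t * mismatches T (z j) n A))"
  proof (rule sum_mono)
    fix A
    have "Min ((\<lambda>j. mismatches T (z j) n A) ` S) \<in> (\<lambda>j. mismatches T (z j) n A) ` S"
      using S by (intro Min_in) auto
    then obtain j where j: "j \<in> S" "c A = t * mismatches T (z j) n A"
      unfolding c_def by auto
    then have "exp (- c A) = exp (- t * mismatches T (z j) n A)" by simp
    also have "\<dots> \<le> (\<Sum>j\<in>S. exp (- t * mismatches T (z j) n A))"
      using S(1) j(1) by (intro member_le_sum) auto
    finally show "exp (- c A) \<le> (\<Sum>j\<in>S. exp (- t * mismatches T (z j) n A))" .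
  qed
  also have "\<dots> = (\<Sum>j\<in>S. \<Sum>A\<in>?I - {{}}. exp (- t * mismatches T (z j) n A))" by (rule sum.swap)
  also have "\<dots> \<le> (\<Sum>j\<in>S. ?K ^ n)"
    by (intro sum_mono sum_exp_mismatches_le T P z \<open>0 \<le> t\<close>)
  finally have K: "(\<Sum>A\<in>?I - {{}}. exp (- c A)) \<le> card S * ?K ^ n" by simp
  have "0 < ?K" by (simp add: add_pos_nonneg)
  moreover have "0 < card S" using S by (simp add: card_gt_0_iff)
  ultimately have lnK: "ln (card S * ?K ^ n) = ln (card S) + n * ln ?K"
    by (simp add: ln_mult ln_realpow)
  have "(\<Sum>A\<in>?I. measure M A * c A) = (\<Sum>A\<in>?I. LINT w|W. indicator (\<phi> -` A \<inter> space W) w * c A)"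
  proof (intro sum.cong refl)
    fix A assume "A \<in> ?I"
    then have A: "A \<in> sets M" by (rule setsI)
    have "measure M A = measure W (\<phi> -` A \<inter> space W)"
      using measure_distr[OF \<phi> A] by (simp add: M)
    then show "measure M A * c A = (LINT w|W. indicator (\<phi> -` A \<inter> space W) w * c A)"
      using measurable_sets[OF \<phi> A] by simp
  qed
  also have "\<dots> = (LINT w|W. (\<Sum>A\<in>?I. indicator (\<phi> -` A \<inter> space W) w * c A))"
    using measurable_sets[OF \<phi> setsI]
    by (intro Bochner_Integration.integral_sum[symmetric] integrable_mult_left integrable_real_indicator)
      (auto simp: W.emeasure_eq_measure)
  also have "\<dots> \<le> (LINT w|W. (\<Sum>i<n. t * indicator (?E i) w))"
  proof (rule integral_mono)
    show "integrable W (\<lambda>w. \<Sum>A\<in>?I. indicator (\<phi> -` A \<inter> space W) w * c A)"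
      using measurable_sets[OF \<phi> setsI]
      by (intro Bochner_Integration.integrable_sum integrable_mult_left integrable_real_indicator)
        (auto simp: W.emeasure_eq_measure)
    show "integrable W (\<lambda>w. \<Sum>i<n. t * indicator (?E i) w)"
      using ev by (intro Bochner_Integration.integrable_sum integrable_mult_right integrable_real_indicator)
        (auto simp: W.emeasure_eq_measure)
    fix w assume w: "w \<in> space W"
    then have "\<phi> w \<in> \<Union>?I" using measurable_space[OF \<phi>] UI by auto
    then obtain A where A: "A \<in> ?I" "\<phi> w \<in> A" by blast
    have "(\<Sum>A\<in>?I. indicator (\<phi> -` A \<inter> space W) w * c A) = (\<Sum>A\<in>{A}. indicator (\<phi> -` A \<inter> space W) w * c A)"
    proof (intro sum.mono_neutral_right finI ballI)
      fix B assume "B \<in> ?I - {A}"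
      then have "\<phi> w \<notin> B" using finite_partition_same_cell[OF I A(1) _ A(2)] by blast
      then show "indicator (\<phi> -` B \<inter> space W) w * c B = 0" by simp
    qed (use A in auto)
    also have "\<dots> = c A" using A w by simp
    also have "\<dots> \<le> t * mismatches T (z (s w)) n A" by (rule c_le[OF S(3)[OF w]])
    also have "\<dots> \<le> t * card {i. i < n \<and> w \<in> ?E i}"
    proof -
      have "{i. i < n \<and> \<not> A \<subseteq> (T ^^ i) -` z (s w) i} \<subseteq> {i. i < n \<and> w \<in> ?E i}"
      proof
        fix i assume "i \<in> {i. i < n \<and> \<not> A \<subseteq> (T ^^ i) -` z (s w) i}"
        then have i: "i < n" "\<not> A \<subseteq> (T ^^ i) -` z (s w) i" by auto
        obtain C where C: "C \<in> P" "A \<subseteq> (T ^^ i) -` C"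
          using iterated_partition_cell[OF A(1) i(1)] by blast
        have "(T ^^ i) (\<phi> w) \<notin> z (s w) i"
        proof
          assume "(T ^^ i) (\<phi> w) \<in> z (s w) i"
          then have "C = z (s w) i"
            using C A(2) finite_partition_same_cell[OF P C(1) z, of "(T ^^ i) (\<phi> w)"] by auto
          then show False using C(2) i(2) by simp
        qed
        then show "i \<in> {i. i < n \<and> w \<in> ?E i}" using i(1) w by simp
      qed
      then have "mismatches T (z (s w)) n A \<le> card {i. i < n \<and> w \<in> ?E i}"
        unfolding mismatches_def by (intro card_mono) auto
      then show ?thesis using \<open>0 \<le> t\<close> by (intro mult_left_mono) auto
    qed
    also have "\<dots> = (\<Sum>i<n. t * indicator (?E i) w)"
    proof -
      have "(\<Sum>i<n. indicator (?E i) w) = (\<Sum>i<n. if w \<in> ?E i then 1 else (0::real))"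
        by (intro sum.cong refl) (simp add: indicator_def)
      also have "\<dots> = (\<Sum>i\<in>{i\<in>{..<n}. w \<in> ?E i}. 1)"
        by (rule sum.inter_filter[symmetric]) simp
      also have "\<dots> = card {i. i < n \<and> w \<in> ?E i}" by simp
      finally show ?thesis by (simp only: sum_distrib_left[symmetric])
    qed
    finally show "(\<Sum>A\<in>?I. indicator (\<phi> -` A \<inter> space W) w * c A) \<le> (\<Sum>i<n. t * indicator (?E i) w)" .
  qed
  also have "\<dots> = (\<Sum>i<n. t * measure W (?E i))"
    using ev by (subst Bochner_Integration.integral_sum)
      (auto simp: W.emeasure_eq_measure intro!: integrable_mult_right integrable_real_indicator)
  also have "\<dots> \<le> (\<Sum>i<n. t * \<epsilon>)"
    using \<open>0 \<le> t\<close> by (intro sum_mono mult_left_mono \<epsilon>)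
  finally have "(\<Sum>A\<in>?I. measure M A * c A) \<le> n * (t * \<epsilon>)" by simp
  then show ?thesis
    using partition_entropy_le[OF pM I K] unfolding lnK by (simp add: algebra_simps)
qed

lemma entropy_wrt_eq_0:
  assumes M: "prob_space M"
    and bound: "\<And>\<epsilon>. 0 < \<epsilon> \<Longrightarrow> \<exists>L::real. \<forall>n t. 0 \<le> t \<longrightarrow>
      partition_entropy M (iterated_partition T M P n) \<le> L + n * (ln (1 + card P * exp (- t)) + t * \<epsilon>)"
  shows "entropy_wrt T M P = 0"
proof -
  let ?H = "\<lambda>n. partition_entropy M (iterated_partition T M P n)"
  have "(\<lambda>n. ?H n / real n) \<longlonglongrightarrow> 0"
  proof (rule LIMSEQ_I)
    fix \<delta> :: real assume "0 < \<delta>"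
    have "((\<lambda>t::real. exp (- t)) \<longlongrightarrow> 0) at_top"
      by (rule filterlim_compose[OF exp_at_bot filterlim_uminus_at_bot_at_top])
    then have "((\<lambda>t::real. 1 + real (card P) * exp (- t)) \<longlongrightarrow> 1 + real (card P) * 0) at_top"
      by (rule tendsto_add[OF tendsto_const tendsto_mult[OF tendsto_const]])
    then have "((\<lambda>t::real. ln (1 + card P * exp (- t))) \<longlongrightarrow> ln (1 + real (card P) * 0)) at_top"
      by (rule tendsto_ln) simp
    then have "\<forall>\<^sub>F t in at_top. ln (1 + card P * exp (- t)) < \<delta> / 3"
      using \<open>0 < \<delta>\<close> by (intro order_tendstoD) auto
    then have "\<forall>\<^sub>F t in at_top. ln (1 + card P * exp (- t)) < \<delta> / 3 \<and> 0 \<le> t"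
      using eventually_ge_at_top[of "0::real"] by eventually_elim simp
    then have "\<exists>t::real. ln (1 + card P * exp (- t)) < \<delta> / 3 \<and> 0 \<le> t"
      by (rule eventually_happens'[rotated]) simp
    then obtain t :: real where t: "ln (1 + card P * exp (- t)) < \<delta> / 3" "0 \<le> t"
      by (elim exE conjE)
    \<comment> \<open>First \<open>t\<close> makes the logarithm small, then \<open>\<epsilon>\<close> makes \<open>t * \<epsilon>\<close> small.\<close>
    define \<epsilon> where "\<epsilon> = \<delta> / (3 * (t + 1))"
    have \<epsilon>: "0 < \<epsilon>" using t \<open>0 < \<delta>\<close> by (simp add: \<epsilon>_def)
    have "t * \<epsilon> \<le> (t + 1) * \<epsilon>" using \<epsilon> by (intro mult_right_mono) auto
    also have "\<dots> = \<delta> / 3" using t by (simp add: \<epsilon>_def field_simps)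
    finally have t\<epsilon>: "t * \<epsilon> \<le> \<delta> / 3" .
    obtain L :: real where L: "\<And>n. ?H n \<le> L + n * (ln (1 + card P * exp (- t)) + t * \<epsilon>)"
      using bound[OF \<epsilon>] t(2) by (elim exE) blast
    have "(\<lambda>n. L / real n) \<longlonglongrightarrow> 0" by (rule lim_const_over_n)
    then have "\<forall>\<^sub>F n in sequentially. L / real n < \<delta> / 3"
      using \<open>0 < \<delta>\<close> by (intro order_tendstoD) auto
    then obtain n0 where n0: "\<And>n. n0 \<le> n \<Longrightarrow> L / real n < \<delta> / 3"
      by (auto simp: eventually_sequentially)
    show "\<exists>n0. \<forall>n\<ge>n0. norm (?H n / real n - 0) < \<delta>"
    proof (intro exI allI impI)
      fix n assume n: "max n0 1 \<le> n"
      have "?H n / n \<le> (L + n * (ln (1 + card P * exp (- t)) + t * \<epsilon>)) / n"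
        by (intro divide_right_mono L) simp
      also have "\<dots> = L / n + (ln (1 + card P * exp (- t)) + t * \<epsilon>)"
        using n by (simp add: add_divide_distrib)
      also have "\<dots> < \<delta>"
      proof -
        have "L / real n < \<delta> / 3" using n0[of n] n by simp
        then show ?thesis using t(1) t\<epsilon> by linarith
      qed
      finally have "?H n / n < \<delta>" .
      moreover have "0 \<le> ?H n / n" using partition_entropy_nonneg[OF M] by simp
      ultimately show "norm (?H n / real n - 0) < \<delta>" by simp
    qed
  qed
  then show ?thesis unfolding entropy_wrt_def by (rule limI)
qed

lemma (in odometer) tau_funpow:
  shows "distr P P (\<tau> ^^ i) = P"
    and "w \<in> space P \<Longrightarrow> (\<tau> ^^ i) w \<in> space P"
    and "w \<in> space P \<Longrightarrow> a N ((\<tau> ^^ i) w) = (a N w + i) mod fact N"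
proof -
  note m [measurable] = measurable_funpow[OF tau_measurable]
  show "distr P P (\<tau> ^^ i) = P"
  proof (induction i)
    case (Suc i)
    have "distr P P (\<tau> ^^ Suc i) = distr (distr P P (\<tau> ^^ i)) P \<tau>"
      by (simp add: distr_distr m)
    then show ?case by (simp only: Suc tau_invariant)
  qed (simp add: id_def)
  show "w \<in> space P \<Longrightarrow> (\<tau> ^^ i) w \<in> space P" for i
    using measurable_space[OF m] by blast
  then show "w \<in> space P \<Longrightarrow> a N ((\<tau> ^^ i) w) = (a N w + i) mod fact N"
    by (induction i) (simp_all add: residue_less residue_tau mod_simps)
qed

context odometer_factor
begin

lemma factor_tau_funpow: "w \<in> space P \<Longrightarrow> \<phi> ((\<tau> ^^ i) w) = (T ^^ i) (\<phi> w)"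
  by (induction i) (simp_all add: factor_tau tau_funpow)

text \<open>
  Number the cells by integers and approximate the number of the cell of \<open>\<phi> w\<close> in \<open>L\<^sup>2\<close> by \<open>h (a N w)\<close>.
  Different integers are at distance at least 1, so rounding \<open>h\<close> recovers the cell wherever the error is
  below \<open>1 / 2\<close>, and the exceptional set is small by Chebyshev's inequality.
\<close>

lemma partition_coding:
  assumes C: "finite_partition factor_measure C" and "0 < \<epsilon>"
  obtains N c where "\<And>s. c s \<in> C" and "{w \<in> space P. \<phi> w \<notin> c (a N w)} \<in> events"
    and "prob {w \<in> space P. \<phi> w \<notin> c (a N w)} \<le> \<epsilon>"
proof -
  have fin: "finite C" and sets [measurable]: "\<And>A. A \<in> C \<Longrightarrow> A \<in> sets borel" and U: "\<Union>C = UNIV"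
    using C by (auto simp: finite_partition_def)
  obtain index :: "'x set \<Rightarrow> nat" where index: "inj_on index C"
    using finite_imp_inj_to_nat_seg[OF fin] by blast
  define g :: "'x \<Rightarrow> complex" where "g x = (\<Sum>A\<in>C. of_nat (index A) * indicator A x)" for x
  have g_eq: "g x = of_nat (index A)" if "A \<in> C" "x \<in> A" for x A
  proof -
    have "g x = (\<Sum>B\<in>{A}. of_nat (index B) * indicator B x)"
      unfolding g_def
    proof (intro sum.mono_neutral_right fin ballI)
      fix B assume "B \<in> C - {A}"
      then have "x \<notin> B" using finite_partition_same_cell[OF C that(1) _ that(2)] by blast
      then show "of_nat (index B) * indicator B x = (0 :: complex)" by simp
    qed (use that in auto)
    then show ?thesis using that by simp
  qed
  have [measurable]: "g \<in> borel_measurable borel" unfolding g_def using sets by measurable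
  have "cmod (g x) \<le> (\<Sum>A\<in>C. index A)" for x
  proof -
    have "cmod (g x) \<le> (\<Sum>A\<in>C. cmod (of_nat (index A) * indicator A x))"
      unfolding g_def by (rule norm_sum)
    also have "\<dots> \<le> (\<Sum>A\<in>C. real (index A))" by (intro sum_mono) (simp add: indicator_def)
    finally show ?thesis by simp
  qed
  then have "square_integrable factor_measure g"
    unfolding square_integrable_def
    by (intro conjI factor.integrable_const_bound[of _ "(real (\<Sum>A\<in>C. index A))\<^sup>2"])
      (auto intro!: power_mono simp del: of_nat_sum)
  then have g: "square_integrable P (\<lambda>w. g (\<phi> w))" by (rule square_integrable_factor)
  have "0 < \<epsilon> / 4" using \<open>0 < \<epsilon>\<close> by simp
  obtain N h where int: "integrable P (\<lambda>w. (cmod (g (\<phi> w) - h (a N w)))\<^sup>2)"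
    and less: "(LINT w|P. (cmod (g (\<phi> w) - h (a N w)))\<^sup>2) < \<epsilon> / 4"
    by (rule residue_functions_dense[OF g \<open>0 < \<epsilon> / 4\<close>])
  obtain A0 where A0: "A0 \<in> C" using U by blast
  define c where "c s = (if \<exists>A\<in>C. cmod (of_nat (index A) - h s) < 1 / 2
    then SOME A. A \<in> C \<and> cmod (of_nat (index A) - h s) < 1 / 2 else A0)" for s
  have c_some: "c s \<in> C \<and> cmod (of_nat (index (c s)) - h s) < 1 / 2"
    if "A \<in> C" "cmod (of_nat (index A) - h s) < 1 / 2" for s A
    using someI[of "\<lambda>A. A \<in> C \<and> cmod (of_nat (index A) - h s) < 1 / 2" A] that
    unfolding c_def by auto
  have c: "c s \<in> C" for s
  proof (cases "\<exists>A\<in>C. cmod (of_nat (index A) - h s) < 1 / 2")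
    case True
    then show ?thesis using c_some by blast
  qed (simp add: c_def A0)
  have c_eq: "c s = A" if "A \<in> C" "cmod (of_nat (index A) - h s) < 1 / 2" for s A
  proof -
    have "cmod (of_nat (index (c s)) - of_nat (index A))
        = cmod ((of_nat (index (c s)) - h s) - (of_nat (index A) - h s))" by simp
    also have "\<dots> \<le> cmod (of_nat (index (c s)) - h s) + cmod (of_nat (index A) - h s)"
      by (rule norm_triangle_ineq4)
    also have "\<dots> < 1" using c_some[OF that] that by simp
    finally have "cmod (of_int (int (index (c s)) - int (index A))) < 1" by simp
    then have "\<bar>int (index (c s)) - int (index A)\<bar> < 1" unfolding norm_of_int by linarith
    then have "index (c s) = index A" by simp
    then show ?thesis using index c that(1) by (simp add: inj_on_def)
  qed
  let ?E = "{w \<in> space P. \<phi> w \<notin> c (a N w)}"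
  have "?E = (\<Union>s<fact N. cylinder N s - \<phi> -` c s)"
    using residue_less by auto
  also have "(\<Union>s<fact N. cylinder N s - \<phi> -` c s) = (\<Union>s<fact N. cylinder N s - (\<phi> -` c s \<inter> space P))"
    by blast
  also have "\<dots> \<in> events"
    using measurable_sets[OF factor_measurable sets[OF c]] by (intro sets.finite_UN sets.Diff) auto
  finally have E: "?E \<in> events" .
  have "prob ?E = (LINT w|P. indicator ?E w)" using E by simp
  also have "\<dots> \<le> (LINT w|P. 4 * (cmod (g (\<phi> w) - h (a N w)))\<^sup>2)"
  proof (rule integral_mono)
    show "integrable P (indicator ?E :: _ \<Rightarrow> real)"
      using E by (intro integrable_real_indicator) (auto simp: emeasure_eq_measure)
    show "integrable P (\<lambda>w. 4 * (cmod (g (\<phi> w) - h (a N w)))\<^sup>2)" using int by simp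
    fix w
    show "indicator ?E w \<le> 4 * (cmod (g (\<phi> w) - h (a N w)))\<^sup>2"
    proof (cases "w \<in> ?E")
      case True
      obtain A where A: "A \<in> C" "\<phi> w \<in> A" using U by blast
      then have "\<not> cmod (of_nat (index A) - h (a N w)) < 1 / 2"
        using True c_eq by auto
      then have "(1 / 2)\<^sup>2 \<le> (cmod (g (\<phi> w) - h (a N w)))\<^sup>2"
        unfolding g_eq[OF A] by (intro power_mono) auto
      then show ?thesis using True by (simp add: power2_eq_square)
    qed simp
  qed
  also have "\<dots> \<le> \<epsilon>" using less by simp
  finally show ?thesis using that c E by blast
qed

text \<open>
  The code words for \<open>partition_entropy_coded_le\<close> are the \<open>N!\<close> translates of the periodic word given by
  \<open>partition_coding\<close>.
\<close>

lemma KS_entropy_factor: "KS_entropy T factor_measure = 0"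
proof -
  have "entropy_wrt T factor_measure C = 0" if C: "finite_partition factor_measure C" for C
  proof (rule entropy_wrt_eq_0[OF factor.prob_space_axioms])
    fix \<epsilon> :: real assume "0 < \<epsilon>"
    obtain N c where c: "\<And>s. c s \<in> C" and ev: "{w \<in> space P. \<phi> w \<notin> c (a N w)} \<in> events"
      and prob: "prob {w \<in> space P. \<phi> w \<notin> c (a N w)} \<le> \<epsilon>"
      by (rule partition_coding[OF C \<open>0 < \<epsilon>\<close>]) blast
    let ?E = "{w \<in> space P. \<phi> w \<notin> c (a N w)}"
    let ?Ei = "\<lambda>i. {w \<in> space P. (T ^^ i) (\<phi> w) \<notin> c ((a N w + i) mod fact N)}"
    have \<tau>i: "\<tau> ^^ i \<in> measurable P P" for i by (rule measurable_funpow) simp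
    have Ei: "?Ei i = (\<tau> ^^ i) -` ?E \<inter> space P" for i
      by (auto simp: factor_tau_funpow tau_funpow)
    have Ei_ev: "?Ei i \<in> events" for i
      unfolding Ei by (rule measurable_sets[OF \<tau>i ev])
    have nonempty: "{..<fact N :: nat} \<noteq> {}"
      using fact_gt_zero[of N, where 'a = nat] by blast
    have Ei_prob: "prob (?Ei i) \<le> \<epsilon>" for i
      using measure_distr[OF \<tau>i ev, of i] prob unfolding Ei tau_funpow(1) by simp
    have "partition_entropy factor_measure (iterated_partition T factor_measure C n)
        \<le> ln (card {..<fact N :: nat}) + n * (ln (1 + card C * exp (- t)) + t * \<epsilon>)"
      if "0 \<le> t" for n t
      using Ei_ev Ei_prob nonempty
      by (intro partition_entropy_coded_le[where W = P and \<phi> = \<phi> and s = "a N"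
            and z = "\<lambda>j i. c ((j + i) mod fact N)"] C c that)
        (auto simp: prob_space_axioms factor_measure_def residue_less cong: distr_cong measurable_cong_sets)
    then show "\<exists>L. \<forall>n t. 0 \<le> t \<longrightarrow> partition_entropy factor_measure (iterated_partition T factor_measure C n)
        \<le> L + n * (ln (1 + card C * exp (- t)) + t * \<epsilon>)" by blast
  qed
  then have "(\<lambda>P. ereal (entropy_wrt T factor_measure P)) ` {P. finite_partition factor_measure P}
      = (\<lambda>_. 0) ` {P. finite_partition factor_measure P}"
    by (intro image_cong) (auto simp: zero_ereal_def)
  moreover have "finite_partition factor_measure {UNIV}"
    by (simp add: finite_partition_def)
  ultimately show ?thesis unfolding KS_entropy_def by (auto simp: image_constant_conv)
qed

end

section \<open>The shift space\<close>

lemma compact_UNIV_bool_seq: "compact (UNIV :: (int \<Rightarrow> bool) set)"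
proof -
  have "compact_space (euclidean :: bool topology)"
    by (simp add: compact_space_def compactin_euclidean_iff finite_imp_compact)
  then have "compact_space (product_topology (\<lambda>i::int. euclidean :: bool topology) UNIV)"
    by (simp add: compact_space_product_topology)
  then show ?thesis
    by (simp add: euclidean_product_topology compact_space_def compactin_euclidean_iff)
qed

text \<open>
  A basic neighbourhood in the product topology prescribes finitely many coordinates.
\<close>

lemma open_window_nhd:
  assumes "open U" "x \<in> (U :: (int \<Rightarrow> bool) set)"
  obtains J where "finite J" "\<And>y. (\<And>i. i \<in> J \<Longrightarrow> y i = x i) \<Longrightarrow> y \<in> U"
proof -
  have "openin (product_topology (\<lambda>i. euclidean) UNIV) U"
    using assms(1) by (simp add: euclidean_product_topology)
  from product_topology_open_contains_basis[OF this assms(2)]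
  obtain V where V: "x \<in> PiE UNIV V" "finite {i. V i \<noteq> UNIV}" "PiE UNIV V \<subseteq> U"
    by auto
  show ?thesis
  proof (rule that[OF V(2)])
    fix y assume "\<And>i. i \<in> {i. V i \<noteq> UNIV} \<Longrightarrow> y i = x i"
    then have "y i \<in> V i" for i
      using PiE_mem[OF V(1), of i] by (cases "V i = UNIV") auto
    then have "y \<in> PiE UNIV V" by (auto simp: PiE_def extensional_def)
    then show "y \<in> U" using V(3) by blast
  qed
qed

lemma tendsto_bool_seqI:
  fixes y :: "int \<Rightarrow> bool"
  assumes "\<And>j. \<forall>\<^sub>F m in G. x m j = y j"
  shows "(x \<longlongrightarrow> y) G"
proof (rule topological_tendstoI)
  fix S assume "open S" "y \<in> S"
  then obtain J where J: "finite J" "\<And>z. (\<And>i. i \<in> J \<Longrightarrow> z i = y i) \<Longrightarrow> z \<in> S"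
    by (rule open_window_nhd) blast
  have "\<forall>\<^sub>F m in G. \<forall>j\<in>J. x m j = y j"
    using J(1) assms by (simp add: eventually_ball_finite)
  then show "\<forall>\<^sub>F m in G. x m \<in> S" by eventually_elim (simp add: J(2))
qed

lemma open_if_window:
  assumes "finite J" "\<And>x y. (\<And>i. i \<in> J \<Longrightarrow> y i = x i) \<Longrightarrow> x \<in> A \<Longrightarrow> y \<in> (A :: (int \<Rightarrow> bool) set)"
  shows "open A"
proof -
  have "open (\<Inter>i\<in>J. (\<lambda>y. y i) -` {x i})" for x :: "int \<Rightarrow> bool"
    using assms(1) by (intro open_INT ballI open_vimage continuous_on_product_coordinates Topological_Spaces.open_discrete)
  then have "open (\<Union>x\<in>A. \<Inter>i\<in>J. (\<lambda>y. y i) -` {x i})" by blast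
  also have "(\<Union>x\<in>A. \<Inter>i\<in>J. (\<lambda>y. y i) -` {x i}) = A"
    using assms(2) by (auto simp: vimage_def)
  finally show ?thesis .
qed

lemma closed_finite_bool_seq:
  assumes "finite (S :: (int \<Rightarrow> bool) set)"
  shows "closed S"
proof -
  have "closed {s}" for s :: "int \<Rightarrow> bool"
  proof -
    have "open {y. y i \<noteq> s i}" for i
      by (rule open_if_window[of "{i}"]) auto
    then have "open (\<Union>i. {y. y i \<noteq> s i})" by blast
    also have "(\<Union>i. {y. y i \<noteq> s i}) = - {s}" by auto
    finally show ?thesis by (simp add: closed_def)
  qed
  then have "closed (\<Union>s\<in>S. {s})" using assms by (intro closed_UN) auto
  then show ?thesis by simp
qed

lemma continuous_on_window_indicator:
  assumes J: "finite J" and A: "\<And>x y. (\<And>i. i \<in> J \<Longrightarrow> y i = x i) \<Longrightarrow> x \<in> A \<Longrightarrow> y \<in> (A :: (int \<Rightarrow> bool) set)"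
  shows "continuous_on UNIV (indicator A :: _ \<Rightarrow> real)"
proof -
  have o: "open A" by (rule open_if_window[OF J A])
  have o': "open (- A)"
  proof (rule open_if_window[OF J])
    fix x y :: "int \<Rightarrow> bool" assume "\<And>i. i \<in> J \<Longrightarrow> y i = x i" "x \<in> - A"
    then show "y \<in> - A" using A[of x y] by auto
  qed
  have "continuous_on (A \<union> - A) (indicator A :: _ \<Rightarrow> real)"
  proof (rule continuous_on_open_Un[OF o o'])
    show "continuous_on A (indicator A :: _ \<Rightarrow> real)"
      by (rule continuous_on_eq[OF continuous_on_const[of _ 1]]) simp
    show "continuous_on (- A) (indicator A :: _ \<Rightarrow> real)"
      by (rule continuous_on_eq[OF continuous_on_const[of _ 0]]) simp
  qed
  then show ?thesis by simp
qed

text \<open>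
  Uniform continuity in terms of coordinates: by compactness, finitely many coordinates determine \<open>f\<close> up to \<open>e\<close>.
\<close>

lemma continuous_uniform_window:
  fixes f :: "(int \<Rightarrow> bool) \<Rightarrow> real"
  assumes f: "continuous_on UNIV f" and "0 < e"
  obtains J where "finite J" "\<And>x y. (\<And>i. i \<in> J \<Longrightarrow> x i = y i) \<Longrightarrow> \<bar>f x - f y\<bar> < e"
proof -
  have "\<exists>J. finite J \<and> (\<forall>y. (\<forall>i\<in>J. y i = x i) \<longrightarrow> f y \<in> ball (f x) (e / 2))" for x
  proof -
    have "open (f -` ball (f x) (e / 2))" by (intro open_vimage f open_ball)
    moreover have "x \<in> f -` ball (f x) (e / 2)" using \<open>0 < e\<close> by simp
    ultimately obtain J where "finite J" "\<And>y. (\<And>i. i \<in> J \<Longrightarrow> y i = x i) \<Longrightarrow> y \<in> f -` ball (f x) (e / 2)"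
      by (rule open_window_nhd) blast
    then show ?thesis by (intro exI[of _ J]) auto
  qed
  then have "\<exists>W. \<forall>x. finite (W x) \<and> (\<forall>y. (\<forall>i\<in>W x. y i = x i) \<longrightarrow> f y \<in> ball (f x) (e / 2))"
    by (intro choice allI)
  then obtain W where "\<forall>x. finite (W x) \<and> (\<forall>y. (\<forall>i\<in>W x. y i = x i) \<longrightarrow> f y \<in> ball (f x) (e / 2))" ..
  then have W: "\<And>x. finite (W x)"
    "\<And>x y. (\<And>i. i \<in> W x \<Longrightarrow> y i = x i) \<Longrightarrow> f y \<in> ball (f x) (e / 2)" by simp_all
  define U where "U x = {y. \<forall>i\<in>W x. y i = x i}" for x
  have "open (U x)" for x
    by (rule open_if_window[OF W(1)[of x]]) (simp add: U_def)
  moreover have "UNIV \<subseteq> (\<Union>x\<in>UNIV. U x)" by (auto simp: U_def)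
  ultimately obtain D where D: "finite D" "UNIV \<subseteq> (\<Union>x\<in>D. U x)"
    using compactE_image[OF compact_UNIV_bool_seq, of UNIV U] by auto
  show ?thesis
  proof (rule that[of "\<Union>x\<in>D. W x"])
    fix y z :: "int \<Rightarrow> bool" assume yz: "\<And>i. i \<in> (\<Union>x\<in>D. W x) \<Longrightarrow> y i = z i"
    obtain x where x: "x \<in> D" "y \<in> U x" using D(2) by blast
    have "f y \<in> ball (f x) (e / 2)" using x by (intro W(2)) (simp add: U_def)
    moreover have "f z \<in> ball (f x) (e / 2)"
    proof (rule W(2))
      fix i assume "i \<in> W x"
      then show "z i = x i" using x yz[of i] by (auto simp: U_def)
    qed
    ultimately show "\<bar>f y - f z\<bar> < e" unfolding mem_ball dist_real_def by linarith
  qed (use D W(1) in auto)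
qed

lemma continuous_bool_seq_bounded:
  fixes f :: "(int \<Rightarrow> bool) \<Rightarrow> real"
  assumes "continuous_on UNIV f"
  obtains K where "0 < K" "\<And>x. \<bar>f x\<bar> \<le> K"
proof -
  have "bounded (range f)"
    by (intro compact_imp_bounded compact_continuous_image assms compact_UNIV_bool_seq)
  then show ?thesis using that unfolding bounded_pos by auto
qed

definition unshift :: "(int \<Rightarrow> 'a) \<Rightarrow> int \<Rightarrow> 'a" where
  "unshift x = (\<lambda>i. x (i - 1))"

lemma measurable_shift_map [measurable]: "shift_map \<in> borel_measurable (borel :: (int \<Rightarrow> bool) measure)"
  unfolding shift_map_def
  by (intro borel_measurable_continuous_onI continuous_on_coordinatewise_then_product
      continuous_on_product_coordinates)

lemma measurable_unshift [measurable]: "unshift \<in> borel_measurable (borel :: (int \<Rightarrow> bool) measure)"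
  unfolding unshift_def
  by (intro borel_measurable_continuous_onI continuous_on_coordinatewise_then_product
      continuous_on_product_coordinates)

lemma shift_map_funpow: "(shift_map ^^ j) x = (\<lambda>i. x (i + int j))"
  by (induction j) (auto simp: shift_map_def algebra_simps)

lemma borel_measurable_bool_seqI:
  assumes "\<And>j. Measurable.pred M (\<lambda>w. f w j)"
  shows "(f :: _ \<Rightarrow> int \<Rightarrow> bool) \<in> borel_measurable M"
proof (rule measurable_coordinatewise_then_product)
  fix j
  have "sets (borel :: bool measure) = sets (count_space UNIV)"
    using borel_open[OF Topological_Spaces.open_discrete] by auto
  then show "(\<lambda>w. f w j) \<in> borel_measurable M"
    using assms[of j] measurable_cong_sets[of M M "borel :: bool measure" "count_space UNIV"] by simp
qed

text \<open>
  Expresses membership in the orbit closure by countably many conditions, each of which depends on finitely many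
  coordinates.
\<close>

lemma subshift_window:
  assumes "\<And>L::nat. \<exists>m. \<forall>i\<in>{- int L..int L}. x i = eta B (i + m)"
  shows "x \<in> subshift B"
  unfolding subshift_def closure_iff_nhds_not_empty
proof (intro allI impI)
  fix A S assume S: "S \<subseteq> A" "open S" "x \<in> S"
  obtain J where J: "finite J" "\<And>y. (\<And>i. i \<in> J \<Longrightarrow> y i = x i) \<Longrightarrow> y \<in> S"
    using open_window_nhd[OF S(2,3)] by blast
  define L where "L = nat (Max (insert 0 (abs ` J)))"
  have "\<bar>i\<bar> \<le> int L" if "i \<in> J" for i using J(1) that by (simp add: L_def)
  then have "i \<in> {- int L..int L}" if "i \<in> J" for i using that by (fastforce simp: abs_le_iff)
  moreover obtain m where "\<forall>i\<in>{- int L..int L}. x i = eta B (i + m)" using assms by blast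
  ultimately have "(\<lambda>i. eta B (i + m)) \<in> S" by (intro J(2)) auto
  moreover have "(\<lambda>i. eta B (i + m)) \<in> shift_orbit (eta B)" by (auto simp: shift_orbit_def)
  ultimately show "shift_orbit (eta B) \<inter> A \<noteq> {}" using S(1) by blast
qed

section \<open>Averages along orbits\<close>

lemma sum_periodic_shift:
  fixes u :: "nat \<Rightarrow> real"
  assumes "\<And>i. u (i + Q) = u i"
  shows "(\<Sum>s<Q. u (s + t)) = (\<Sum>s<Q. u s)"
proof (induction t)
  case (Suc t)
  have "(\<Sum>s<Suc Q. u (s + t)) = u t + (\<Sum>s<Q. u (s + Suc t))"
    by (simp only: sum.lessThan_Suc_shift) simp
  moreover have "(\<Sum>s<Suc Q. u (s + t)) = (\<Sum>s<Q. u (s + t)) + u t"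
    using assms[of t] by (simp add: add.commute)
  ultimately show ?case using Suc by simp
qed simp

text \<open>
  The centred partial sums are periodic in \<open>n\<close>, hence bounded.
\<close>

lemma average_periodic:
  fixes u :: "nat \<Rightarrow> real"
  assumes Q: "0 < Q" and u: "\<And>i. u (i + Q) = u i"
  shows "(\<lambda>n. (\<Sum>j<n. u j) / real n) \<longlonglongrightarrow> (\<Sum>s<Q. u s) / real Q"
proof -
  define c where "c = (\<Sum>s<Q. u s) / real Q"
  \<comment> \<open>\<open>c\<close> is the mean over a period, so a full period adds 0 to \<open>D\<close>.\<close>
  define D where "D n = (\<Sum>j<n. u j - c)" for n
  have per: "D (n + Q) = D n" for n
  proof -
    have "D (n + R) = D n + (\<Sum>j<R. u (n + j) - c)" for R
      by (induction R) (simp_all add: D_def)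
    then have "D (n + Q) = D n + (\<Sum>j<Q. u (n + j) - c)" .
    also have "(\<Sum>j<Q. u (n + j) - c) = (\<Sum>j<Q. u (j + n)) - Q * c"
      by (simp add: sum_subtractf add.commute)
    also have "\<dots> = 0" unfolding sum_periodic_shift[of u, OF u] using Q by (simp add: c_def)
    finally show ?thesis by simp
  qed
  have mult: "D (n + k * Q) = D n" for n k
    
  proof (induction k)
    case (Suc k)
    have "n + Suc k * Q = (n + k * Q) + Q" by simp
    then show ?case using per[of "n + k * Q"] Suc by (simp only:)
  qed simp
  have bound: "\<bar>D n\<bar> \<le> (\<Sum>r<Q. \<bar>D r\<bar>)" for n
  proof -
    have "D n = D (n mod Q)" using mult[of "n mod Q" "n div Q"] by (simp add: add.commute)
    also have "\<bar>D (n mod Q)\<bar> \<le> (\<Sum>r<Q. \<bar>D r\<bar>)"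
      using Q by (intro member_le_sum[of _ _ "\<lambda>r. \<bar>D r\<bar>"]) auto
    finally show ?thesis .
  qed
  have "(\<lambda>n. D n / real n) \<longlonglongrightarrow> 0"
  proof (rule Lim_null_comparison[OF _ lim_const_over_n])
    show "\<forall>\<^sub>F n in sequentially. norm (D n / real n) \<le> (\<Sum>r<Q. \<bar>D r\<bar>) / real n"
      using bound by (intro always_eventually allI) (simp add: divide_right_mono)
  qed
  then have "(\<lambda>n. c + D n / real n) \<longlonglongrightarrow> c + 0" by (intro tendsto_intros)
  moreover have "\<forall>\<^sub>F n in sequentially. c + D n / real n = (\<Sum>j<n. u j) / real n"
    using eventually_gt_at_top[of 0] by eventually_elim (simp add: D_def sum_subtractf field_simps)
  ultimately show ?thesis unfolding c_def[symmetric] using tendsto_cong by force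
qed

text \<open>
  Translating a window of length \<open>n\<close> by \<open>i\<close> exchanges at most \<open>|i|\<close> of its positions.
\<close>

lemma card_shifted_le:
  "card {j. j < n \<and> d (int j + i)} \<le> card {j. j < n \<and> d (int j)} + nat \<bar>i\<bar>"
proof -
  let ?G = "{j. j < n \<and> d (int j + i) \<and> 0 \<le> int j + i \<and> int j + i < int n}"
  let ?R = "{..<nat (- i)} \<union> {n - nat i..<n}"
  have "card ?G \<le> card {j. j < n \<and> d (int j)}"
    by (rule card_inj_on_le[of "\<lambda>j. nat (int j + i)"]) (auto simp: inj_on_def)
  moreover have "card ?R \<le> nat \<bar>i\<bar>"
    by (rule order_trans[OF card_Un_le]) auto
  moreover have "{j. j < n \<and> d (int j + i)} \<subseteq> ?G \<union> ?R" by auto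
  then have "card {j. j < n \<and> d (int j + i)} \<le> card (?G \<union> ?R)" by (intro card_mono) auto
  then have "card {j. j < n \<and> d (int j + i)} \<le> card ?G + card ?R"
    using card_Un_le[of ?G ?R] by linarith
  ultimately show ?thesis by linarith
qed

text \<open>
  The values of \<open>f\<close> along the two orbits differ by more than \<open>e\<close> only at times at which the sequences
  disagree somewhere in the window \<open>J\<close>; each disagreement at a single position spoils at most \<open>card J\<close> times.
\<close>

lemma average_difference_le:
  fixes f :: "(int \<Rightarrow> bool) \<Rightarrow> real" and J :: "int set"
  assumes J: "finite J" "\<And>x y. (\<And>i. i \<in> J \<Longrightarrow> x i = y i) \<Longrightarrow> \<bar>f x - f y\<bar> < e"
    and K: "\<And>x. \<bar>f x\<bar> \<le> K" and "0 < n"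
  shows "\<bar>(\<Sum>j<n. f ((shift_map ^^ j) x)) / real n - (\<Sum>j<n. f ((shift_map ^^ j) y)) / real n\<bar>
    \<le> e + 2 * K * (card J * (card {j. j < n \<and> x (int j) \<noteq> y (int j)} / n) + (\<Sum>i\<in>J. real_of_int \<bar>i\<bar>) / n)"
proof -
  let ?D = "{j. j < n \<and> x (int j) \<noteq> y (int j)}"
  let ?W = "{j. j < n \<and> (\<exists>i\<in>J. x (int j + i) \<noteq> y (int j + i))}"
  have K0: "0 \<le> K" using K[of x] by linarith
  have "card ?W \<le> (\<Sum>i\<in>J. card {j. j < n \<and> x (int j + i) \<noteq> y (int j + i)})"
  proof -
    have "?W = (\<Union>i\<in>J. {j. j < n \<and> x (int j + i) \<noteq> y (int j + i)})" by auto
    then show ?thesis using card_UN_le[OF J(1)] by simp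
  qed
  also have "\<dots> \<le> (\<Sum>i\<in>J. card ?D + nat \<bar>i\<bar>)"
    by (intro sum_mono card_shifted_le[of n "\<lambda>j. x j \<noteq> y j"])
  finally have "real (card ?W) \<le> real (\<Sum>i\<in>J. card ?D + nat \<bar>i\<bar>)" by (rule of_nat_mono)
  then have W: "real (card ?W) \<le> card J * card ?D + (\<Sum>i\<in>J. real_of_int \<bar>i\<bar>)"
    by (simp add: sum.distrib)
  have "\<bar>f ((shift_map ^^ j) x) - f ((shift_map ^^ j) y)\<bar> \<le> e + 2 * K * indicator ?W j" if "j < n" for j
  proof (cases "j \<in> ?W")
    case True
    have "0 < e" using J(2)[of x x] by simp
    then show ?thesis using True K[of "(shift_map ^^ j) x"] K[of "(shift_map ^^ j) y"] by simp
  next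
    case False
    then have "\<bar>f ((shift_map ^^ j) x) - f ((shift_map ^^ j) y)\<bar> < e"
      using that by (intro J(2)) (auto simp: shift_map_funpow add.commute)
    then show ?thesis using False by simp
  qed
  then have "\<bar>\<Sum>j<n. f ((shift_map ^^ j) x) - f ((shift_map ^^ j) y)\<bar> \<le> (\<Sum>j<n. e + 2 * K * indicator ?W j)"
    by (intro order_trans[OF sum_abs] sum_mono) auto
  also have "\<dots> = n * e + 2 * K * card ?W"
  proof -
    have "(\<Sum>j<n. indicator ?W j) = (\<Sum>j\<in>?W. 1 :: real)"
      by (intro sum.mono_neutral_cong_right) auto
    then show ?thesis by (simp add: sum.distrib sum_distrib_left[symmetric])
  qed
  also have "\<dots> \<le> n * e + 2 * K * (card J * card ?D + (\<Sum>i\<in>J. real_of_int \<bar>i\<bar>))"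
    using W K0 by (intro add_left_mono mult_left_mono) auto
  finally have "\<bar>\<Sum>j<n. f ((shift_map ^^ j) x) - f ((shift_map ^^ j) y)\<bar> / n
      \<le> (n * e + 2 * K * (card J * card ?D + (\<Sum>i\<in>J. real_of_int \<bar>i\<bar>))) / n"
    by (rule divide_right_mono) simp
  also have "\<dots> = e + 2 * K * (card J * (card ?D / n) + (\<Sum>i\<in>J. real_of_int \<bar>i\<bar>) / n)"
    using \<open>0 < n\<close> by (simp add: field_simps)
  finally show ?thesis
    by (simp add: sum_subtractf diff_divide_distrib[symmetric] abs_divide)
qed

text \<open>
  Let \<open>A L\<close> be the set of sequences whose central block of radius \<open>L\<close> occurs in \<open>\<eta>\<^sub>B\<close>.  It is clopen and contains the
  orbit, so the averages of its indicator are 1 and the set has full measure.  The orbit closure is the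
  intersection of these sets.
\<close>

lemma measure_subshift_quasi_generic:
  assumes M: "invariant_prob shift_map M" and q: "quasi_generic_along n (eta B) M"
    and n: "filterlim n at_top sequentially"
  shows "measure M (subshift B) = 1"
proof -
  interpret M: prob_space M using M by (simp add: invariant_prob_def)
  have sets: "sets M = sets borel" using M by (auto simp: invariant_prob_def)
  define A where "A L = {x. \<exists>m. \<forall>i\<in>{- int L..int L}. x i = eta B (i + m)}" for L :: nat
  have win: "y \<in> A L" if "\<And>i. i \<in> {- int L..int L} \<Longrightarrow> y i = x i" "x \<in> A L" for x y L
    using that by (auto simp: A_def)
  have "AE x in M. x \<in> A L" for L
  proof -
    have A: "A L \<in> sets M"
      unfolding sets by (intro borel_open open_if_window[OF finite_atLeastAtMost_int win])
    have "(\<lambda>k. (\<Sum>j<n k. indicator (A L) ((shift_map ^^ j) (eta B))) / real (n k))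
        \<longlonglongrightarrow> integral\<^sup>L M (indicator (A L))"
      by (rule q[unfolded quasi_generic_along_def, rule_format,
            OF continuous_on_window_indicator[OF finite_atLeastAtMost_int win]])
    moreover have "(shift_map ^^ j) (eta B) \<in> A L" for j
      unfolding A_def shift_map_funpow by (intro CollectI exI[of _ "int j"]) simp
    then have "\<forall>\<^sub>F k in sequentially.
        (\<Sum>j<n k. indicator (A L) ((shift_map ^^ j) (eta B))) / real (n k) = 1"
      using eventually_compose_filterlim[OF eventually_gt_at_top n, of 0]
      by (auto elim!: eventually_mono)
    then have "(\<lambda>k. (\<Sum>j<n k. indicator (A L) ((shift_map ^^ j) (eta B))) / real (n k)) \<longlonglongrightarrow> 1"
      by (rule tendsto_eventually)
    ultimately have "integral\<^sup>L M (indicator (A L)) = (1 :: real)" by (rule LIMSEQ_unique)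
    then have "measure M (A L) = 1" using A by simp
    then show ?thesis using A by (simp add: M.prob_eq_1)
  qed
  then have "AE x in M. \<forall>L. x \<in> A L" by (simp add: AE_all_countable)
  then have "AE x in M. x \<in> subshift B"
  proof eventually_elim
    case (elim x)
    then show ?case by (intro subshift_window) (auto simp: A_def)
  qed
  moreover have "subshift B \<in> sets M" by (simp add: sets subshift_def)
  ultimately show ?thesis by (simp add: M.prob_eq_1)
qed

section \<open>Sets of multiples and periodic orbits\<close>

lemma eta_iff: "eta B j \<longleftrightarrow> (\<forall>b\<in>B. \<not> int b dvd j)"
  by (auto simp: eta_def free_set_def dvd_def)

lemma smallest_subset: "smallest B m \<subseteq> B"
  by (auto simp: smallest_def)

lemma finite_smallest: "finite (smallest B m)"
proof (rule finite_imageD)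
  let ?c = "\<lambda>b. card {a \<in> B. a < b}"
  show "finite (?c ` smallest B m)"
    by (rule finite_subset[of _ "{..<m}"]) (auto simp: smallest_def)
  have less: "?c b < ?c b'" if "b \<in> B" "b < b'" for b b'
    using that by (intro psubset_card_mono) auto
  show "inj_on ?c (smallest B m)"
  proof (rule inj_onI)
    fix b b' assume "b \<in> smallest B m" "b' \<in> smallest B m" "?c b = ?c b'"
    then show "b = b'" using less[of b b'] less[of b' b]
      by (cases b b' rule: linorder_cases) (auto simp: smallest_def)
  qed
qed

lemma eventually_in_smallest:
  assumes "b \<in> B"
  shows "\<forall>\<^sub>F m in sequentially. b \<in> smallest B m"
  by (rule eventually_mono[OF eventually_gt_at_top[of "card {a \<in> B. a < b}"]])
    (use assms in \<open>simp add: smallest_def\<close>)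

lemma eta_periodic:
  assumes "\<forall>b\<in>B. 0 < b \<and> b \<le> N"
  shows "eta B (j + int (fact N) * k) = eta B j"
proof -
  have "int b dvd int (fact N) * k" if "b \<in> B" for b
  proof -
    have "b dvd fact N" using assms that by (intro dvd_fact) auto
    then show ?thesis by (intro dvd_mult2) (simp only: int_dvd_int_iff)
  qed
  then show ?thesis by (auto simp: eta_iff dvd_add_left_iff)
qed

text \<open>
  On the orbit the average of the indicator of \<open>A\<close> over \<open>N!\<close> successive shifts is constant, since \<open>N!\<close> is a
  period; by invariance its integral is the measure of \<open>A\<close>.  Thus there is only one invariant measure.
\<close>

lemma measure_on_periodic_orbit:
  assumes M: "invariant_prob shift_map M" and orbit: "measure M (subshift B) = 1"
    and B: "\<forall>b\<in>B. 0 < b \<and> b \<le> N" and A: "A \<in> sets M"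
  shows "measure M A = (\<Sum>s<fact N. indicator A (\<lambda>i. eta B (i + int s))) / fact N"
proof -
  interpret M: prob_space M using M by (simp add: invariant_prob_def)
  have sets [measurable_cong]: "sets M = sets borel" and inv: "distr M M shift_map = M"
    using M by (auto simp: invariant_prob_def)
  have space: "space M = UNIV" using sets_eq_imp_space_eq[OF sets] by simp
  have sm [measurable]: "shift_map \<in> measurable M M" using M by (simp add: invariant_prob_def)
  note smi [measurable] = measurable_funpow[OF sm]
  have inv_i: "distr M M (shift_map ^^ s) = M" for s
  proof (induction s)
    case (Suc s)
    have "distr M M (shift_map ^^ Suc s) = distr (distr M M (shift_map ^^ s)) M shift_map"
      by (simp add: distr_distr smi)
    then show ?case by (simp only: Suc inv)
  qed (simp add: id_def)
  define \<eta> where "\<eta> t = (\<lambda>i. eta B (i + int t))" for t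
  have per: "\<eta> (t + fact N) = \<eta> t" for t
  proof
    fix i
    have "i + int (t + fact N) = (i + int t) + int (fact N) * 1" by simp
    then show "\<eta> (t + fact N) i = \<eta> t i"
      unfolding \<eta>_def using eta_periodic[OF B, where j = "i + int t" and k = 1] by (simp only:)
  qed
  have "shift_orbit (eta B) \<subseteq> range \<eta>"
  proof
    fix x assume "x \<in> shift_orbit (eta B)"
    then obtain m where x: "x = (\<lambda>i. eta B (i + m))" by (auto simp: shift_orbit_def)
    define r where "r = nat (m mod int (fact N))"
    have m: "m = int r + int (fact N) * (m div int (fact N))"
      by (simp add: r_def)
    have "eta B (i + m) = eta B (i + int r)" for i
    proof -
      have "i + m = (i + int r) + int (fact N) * (m div int (fact N))" using m by linarith
      then show ?thesis using eta_periodic[OF B, where j = "i + int r" and k = "m div int (fact N)"]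
        by (simp only:)
    qed
    then have "x = \<eta> r" by (simp add: x \<eta>_def)
    then show "x \<in> range \<eta>" by blast
  qed
  moreover have "range \<eta> \<subseteq> \<eta> ` {..<fact N}"
  proof
    fix x assume "x \<in> range \<eta>"
    then obtain t where "x = \<eta> t" by blast
    moreover have "\<eta> (r + k * fact N) = \<eta> r" for r k
      
    proof (induction k)
      case (Suc k)
      have "r + Suc k * fact N = (r + k * fact N) + fact N" by simp
      then show ?case using per[of "r + k * fact N"] Suc by (simp only:)
    qed simp
    from this[of "t mod fact N" "t div fact N"] have "\<eta> t = \<eta> (t mod fact N)" by (simp add: add.commute)
    ultimately show "x \<in> \<eta> ` {..<fact N}" by auto
  qed
  then have "finite (range \<eta>)" by (rule finite_subset) simp
  ultimately have "closure (shift_orbit (eta B)) \<subseteq> range \<eta>"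
    by (intro closure_minimal closed_finite_bool_seq)
  then have sub: "subshift B \<subseteq> range \<eta>" by (simp add: subshift_def)
  have "subshift B \<in> sets M" using sets by (simp add: subshift_def)
  then have AE: "AE x in M. x \<in> subshift B" using orbit by (simp add: M.prob_eq_1)
  let ?S = "\<Sum>s<fact N. indicator A (\<eta> s) :: real"
  have "(\<Sum>s<fact N :: nat. measure M A) = (\<Sum>s<fact N. LINT x|M. indicator A ((shift_map ^^ s) x))"
  proof (intro sum.cong refl)
    fix s
    have "measure M A = (LINT x|distr M M (shift_map ^^ s). indicator A x)"
      using A by (simp add: inv_i)
    also have "\<dots> = (LINT x|M. indicator A ((shift_map ^^ s) x))"
      using A by (intro integral_distr) auto
    finally show "measure M A = (LINT x|M. indicator A ((shift_map ^^ s) x))" .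
  qed
  also have "\<dots> = (LINT x|M. (\<Sum>s<fact N. indicator A ((shift_map ^^ s) x)))"
    using A by (intro Bochner_Integration.integral_sum[symmetric] M.integrable_const_bound[of _ 1]) auto
  also have "\<dots> = (LINT x|M. ?S)"
  proof (rule integral_cong_AE)
    show "AE x in M. (\<Sum>s<fact N. indicator A ((shift_map ^^ s) x)) = ?S"
      using AE
    proof eventually_elim
      case (elim x)
      then obtain t where x: "x = \<eta> t" using sub by blast
      have "(\<Sum>s<fact N. indicator A ((shift_map ^^ s) x)) = (\<Sum>s<fact N. indicator A (\<eta> (s + t)) :: real)"
        by (simp add: x \<eta>_def shift_map_funpow add_ac)
      also have "\<dots> = ?S" by (rule sum_periodic_shift) (simp add: per)
      finally show ?case .
    qed
  qed (use A in auto)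
  finally show ?thesis by (simp add: M.prob_space \<eta>_def field_simps)
qed

lemma periodic_measure_eq:
  assumes "0 \<notin> B" and erg: "ergodic_prob shift_map M" and orbit: "measure M (subshift (smallest B m)) = 1"
  shows "periodic_measure B m = M"
  unfolding periodic_measure_def
proof (rule the_equality)
  fix M' assume M': "ergodic_prob shift_map M' \<and> measure M' (subshift (smallest B m)) = 1"
  define N where "N = Max (insert 0 (smallest B m))"
  have N: "\<forall>b\<in>smallest B m. 0 < b \<and> b \<le> N"
    using finite_smallest smallest_subset[of B m] assms(1) by (auto simp: N_def intro: gr0I)
  have inv: "invariant_prob shift_map M" "invariant_prob shift_map M'"
    using erg M' by (auto simp: ergodic_prob_def)
  then interpret M: prob_space M + M': prob_space M' by (auto simp: invariant_prob_def)
  have sets: "sets M = sets borel" "sets M' = sets borel" using inv by (auto simp: invariant_prob_def)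
  show "M' = M"
  proof (rule measure_eqI)
    fix A assume "A \<in> sets M'"
    then show "emeasure M' A = emeasure M A"
      using measure_on_periodic_orbit[where A = A, OF inv(1) orbit N] sets M'
        measure_on_periodic_orbit[where A = A, OF inv(2) conjunct2[OF M'] N]
      by (simp add: M.emeasure_eq_measure M'.emeasure_eq_measure)
  qed (simp add: sets)
qed (use assms in auto)

section \<open>The Mirsky measure\<close>

context odometer
begin

text \<open>
  The translate of \<open>\<eta>\<^sub>B\<close> by the profinite integer \<open>w\<close>.  As \<open>b\<close> divides \<open>b!\<close>, the residue \<open>a b w\<close>
  determines \<open>w\<close> modulo \<open>b\<close>.
\<close>

definition translated_eta :: "nat set \<Rightarrow> 'w \<Rightarrow> int \<Rightarrow> bool" where
  "translated_eta B w j \<longleftrightarrow> (\<forall>b\<in>B. \<not> int b dvd j + int (a b w))"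

lemma dvd_residue_iff:
  assumes w: "w \<in> space P" and b: "0 < b" "b \<le> N"
  shows "int b dvd j + int (a N w) \<longleftrightarrow> int b dvd j + int (a b w)"
proof -
  have "b dvd fact b" using b(1) by (intro dvd_fact) auto
  then have "int b dvd int (fact b * (a N w div fact b))" by (simp only: int_dvd_int_iff dvd_mult2)
  moreover have "a N w = fact b * (a N w div fact b) + a b w"
    using residue_mod[OF w b(2)] mult_div_mod_eq[of "fact b" "a N w"] by simp
  then have "j + int (a N w) = int (fact b * (a N w div fact b)) + (j + int (a b w))" by linarith
  ultimately show ?thesis by (simp only: dvd_add_right_iff)
qed

lemma translated_eta_tau:
  assumes w: "w \<in> space P" and B: "0 \<notin> B"
  shows "translated_eta B (\<tau> w) = shift_map (translated_eta B w)"
proof -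
  have "int b dvd j + int (a b (\<tau> w)) \<longleftrightarrow> int b dvd j + 1 + int (a b w)" if "b \<in> B" for b j
  proof -
    have "0 < b" using B that by (cases b) auto
    then have "b dvd fact b" by (intro dvd_fact) auto
    then have "int b dvd int (fact b * ((a b w + 1) div fact b))" by (simp only: int_dvd_int_iff dvd_mult2)
    moreover have "a b w + 1 = fact b * ((a b w + 1) div fact b) + a b (\<tau> w)"
      using mult_div_mod_eq[of "fact b" "a b w + 1"] by (simp only: residue_tau[OF w])
    then have "j + 1 + int (a b w) = int (fact b * ((a b w + 1) div fact b)) + (j + int (a b (\<tau> w)))"
      by linarith
    ultimately show ?thesis by (simp only: dvd_add_right_iff)
  qed
  then show ?thesis by (auto simp: translated_eta_def shift_map_def fun_eq_iff)
qed

text \<open>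
  When the elements of \<open>B\<close> are bounded by \<open>N\<close>, the translate depends on \<open>w\<close> only through its residue modulo \<open>N!\<close>,
  so it belongs to the orbit of \<open>\<eta>\<^sub>B\<close>.
\<close>

lemma translated_eta_finite:
  assumes w: "w \<in> space P" and B: "\<forall>b\<in>B. 0 < b \<and> b \<le> N"
  shows "translated_eta B w = (\<lambda>i. eta B (i + int (a N w)))"
proof
  fix i
  have "int b dvd i + int (a N w) \<longleftrightarrow> int b dvd i + int (a b w)" if "b \<in> B" for b
    using B that by (intro dvd_residue_iff w) auto
  then show "translated_eta B w i = eta B (i + int (a N w))"
    by (simp add: translated_eta_def eta_iff)
qed

lemma measurable_translated_eta_coordinate: "Measurable.pred P (\<lambda>w. translated_eta B w j)"
proof -
  have "Measurable.pred P (\<lambda>w. \<forall>b. b \<in> B \<longrightarrow> \<not> int b dvd j + int (a b w))"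
  proof (intro pred_intros_countable pred_intros_logic)
    fix b
    show "Measurable.pred P (\<lambda>w. int b dvd j + int (a b w))"
      by (rule measurable_compose[OF residue_measurable]) simp
  qed auto
  then show ?thesis by (simp add: translated_eta_def Ball_def)
qed

lemma measurable_translated_eta [measurable]: "translated_eta B \<in> borel_measurable P"
  by (intro borel_measurable_bool_seqI measurable_translated_eta_coordinate)

lemma odometer_factor_translated_eta:
  assumes "0 \<notin> B"
  shows "odometer_factor P \<tau> a (translated_eta B) shift_map unshift"
proof
  show "unshift (shift_map x) = x" for x :: "int \<Rightarrow> bool"
    by (simp add: unshift_def shift_map_def)
qed (simp_all add: translated_eta_tau assms)

abbreviation mirsky_measure :: "nat set \<Rightarrow> (int \<Rightarrow> bool) measure" where
  "mirsky_measure B \<equiv> distr P borel (translated_eta B)"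

lemma mirsky_measure_eq:
  assumes "0 \<notin> B"
  shows "odometer_factor.factor_measure P (translated_eta B) = mirsky_measure B"
  by (rule odometer_factor.factor_measure_def[OF odometer_factor_translated_eta[OF assms]])

lemma integral_mirsky:
  fixes f :: "(int \<Rightarrow> bool) \<Rightarrow> real"
  assumes "f \<in> borel_measurable borel"
  shows "integral\<^sup>L (mirsky_measure B) f = (LINT w|P. f (translated_eta B w))"
  using assms by (intro integral_distr) measurable

lemma integral_mirsky_finite:
  fixes f :: "(int \<Rightarrow> bool) \<Rightarrow> real"
  assumes B: "\<forall>b\<in>B. 0 < b \<and> b \<le> N"
  shows "(LINT w|P. f (translated_eta B w)) = (\<Sum>s<fact N. f (\<lambda>i. eta B (i + int s))) / fact N"
proof -
  have "complex_of_real (LINT w|P. f (translated_eta B w))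
      = (LINT w|P. complex_of_real (f (\<lambda>i. eta B (i + int (a N w)))) * 1)"
    unfolding integral_complex_of_real[symmetric] 
    by (intro Bochner_Integration.integral_cong refl) (simp add: translated_eta_finite[OF _ B])
  also have "\<dots> = (\<Sum>s<fact N. complex_of_real (f (\<lambda>i. eta B (i + int s))) * (LINT w:cylinder N s|P. 1))"
    by (rule integral_residue_function_mult(2)[of "\<lambda>_. 1" "\<lambda>s. complex_of_real (f (\<lambda>i. eta B (i + int s)))"])
      simp
  also have "\<dots> = (\<Sum>s<fact N. complex_of_real (f (\<lambda>i. eta B (i + int s)) / fact N))"
  proof (intro sum.cong refl)
    fix s :: nat assume "s \<in> {..<fact N}"
    then have "(LINT w:cylinder N s|P. (1::complex)) = complex_of_real (1 / fact N)"
      using residue_uniform[of s N]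
      by (simp add: set_lebesgue_integral_def scaleR_conv_of_real)
    then show "complex_of_real (f (\<lambda>i. eta B (i + int s))) * (LINT w:cylinder N s|P. 1)
        = complex_of_real (f (\<lambda>i. eta B (i + int s)) / fact N)" by simp
  qed
  also have "\<dots> = complex_of_real ((\<Sum>s<fact N. f (\<lambda>i. eta B (i + int s))) / fact N)"
    by (simp add: sum_divide_distrib)
  finally show ?thesis by (simp only: of_real_eq_iff)
qed

text \<open>
  A coordinate for \<open>B\<close> is 0 because of a single \<open>b\<close>, which belongs to all but finitely many of the \<open>B(m)\<close>.
\<close>

lemma eventually_translated_eta_smallest:
  "\<forall>\<^sub>F m in sequentially. translated_eta (smallest B m) w j = translated_eta B w j"
proof (cases "translated_eta B w j")
  case True
  then have "translated_eta (smallest B m) w j" for m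
    using smallest_subset[of B m] by (auto simp: translated_eta_def)
  then show ?thesis using True by simp
next
  case False
  then obtain b where b: "b \<in> B" "int b dvd j + int (a b w)" by (auto simp: translated_eta_def)
  show ?thesis
    using eventually_in_smallest[OF b(1)]
    by (rule eventually_mono) (use b(2) False in \<open>auto simp: translated_eta_def\<close>)
qed

lemma smallest_bounds:
  assumes "0 \<notin> B"
  obtains N where "\<forall>b\<in>smallest B m. 0 < b \<and> b \<le> N"
proof (rule that[of "Max (insert 0 (smallest B m))"])
  show "\<forall>b\<in>smallest B m. 0 < b \<and> b \<le> Max (insert 0 (smallest B m))"
    using finite_smallest smallest_subset[of B m] assms by (auto intro: gr0I)
qed

lemma prob_disagree_tendsto_0:
  "(\<lambda>m. prob {w \<in> space P. translated_eta (smallest B m) w 0 \<noteq> translated_eta B w 0}) \<longlonglongrightarrow> 0"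
proof -
  let ?E = "\<lambda>m. {w \<in> space P. translated_eta (smallest B m) w 0 \<noteq> translated_eta B w 0}"
  note measurable_translated_eta_coordinate [measurable]
  have E: "?E m \<in> events" for m
    by measurable
  have "(\<lambda>m. LINT w|P. indicator (?E m) w :: real) \<longlonglongrightarrow> (LINT w|P. 0)"
  proof (rule integral_dominated_convergence[where w = "\<lambda>_. 1"])
    show "AE w in P. (\<lambda>m. indicator (?E m) w :: real) \<longlonglongrightarrow> 0"
    proof (intro AE_I2 tendsto_eventually)
      fix w show "\<forall>\<^sub>F m in sequentially. indicator (?E m) w = (0 :: real)"
        using eventually_translated_eta_smallest[of B w 0] by eventually_elim simp
    qed
  qed (use E in auto)
  then show ?thesis using E by simp
qed

lemma tendsto_integral_smallest:
  fixes f :: "(int \<Rightarrow> bool) \<Rightarrow> real"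
  assumes f: "continuous_on UNIV f"
  shows "(\<lambda>m. LINT w|P. f (translated_eta (smallest B m) w)) \<longlonglongrightarrow> (LINT w|P. f (translated_eta B w))"
proof -
  have [measurable]: "f \<in> borel_measurable borel" by (rule borel_measurable_continuous_onI[OF f])
  obtain K where K: "\<And>x. \<bar>f x\<bar> \<le> K" using continuous_bool_seq_bounded[OF f] by blast
  show ?thesis
  proof (rule integral_dominated_convergence[where w = "\<lambda>_. K"])
    show "AE w in P. (\<lambda>m. f (translated_eta (smallest B m) w)) \<longlonglongrightarrow> f (translated_eta B w)"
    proof (rule AE_I2)
      fix w
      have "(\<lambda>m. translated_eta (smallest B m) w) \<longlonglongrightarrow> translated_eta B w"
        by (intro tendsto_bool_seqI eventually_translated_eta_smallest)
      then show "(\<lambda>m. f (translated_eta (smallest B m) w)) \<longlonglongrightarrow> f (translated_eta B w)"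
        by (rule continuous_on_tendsto_compose[OF f]) simp_all
    qed
  qed (use K in auto)
qed

text \<open>
  The two translates by the same \<open>w\<close> are shifted simultaneously by \<open>\<tau>\<close>, so their joint law is a joining.
\<close>

lemma joining_mirsky:
  assumes "0 \<notin> B" "0 \<notin> C"
  obtains L where "L \<in> joinings (mirsky_measure C) (mirsky_measure B)"
    and "measure L {(x, y). x 0 \<noteq> y 0} = prob {w \<in> space P. translated_eta C w 0 \<noteq> translated_eta B w 0}"
proof -
  let ?\<psi> = "\<lambda>w. (translated_eta C w, translated_eta B w)"
  let ?S = "map_prod shift_map shift_map :: _ \<Rightarrow> (int \<Rightarrow> bool) \<times> (int \<Rightarrow> bool)"
  have \<psi> [measurable]: "?\<psi> \<in> borel_measurable P" by (rule borel_measurable_Pair) auto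
  have S [measurable]: "?S \<in> borel_measurable borel"
  proof -
    have "(\<lambda>x. (shift_map (fst x), shift_map (snd x))) \<in>
        borel_measurable (borel :: ((int \<Rightarrow> bool) \<times> (int \<Rightarrow> bool)) measure)"
      by (intro borel_measurable_Pair measurable_compose[OF _ measurable_shift_map]
          borel_measurable_continuous_onI continuous_intros)
    then show ?thesis by (simp add: map_prod_def case_prod_beta')
  qed
  have proj: "fst \<in> borel_measurable (borel :: ((int \<Rightarrow> bool) \<times> (int \<Rightarrow> bool)) measure)"
    "snd \<in> borel_measurable (borel :: ((int \<Rightarrow> bool) \<times> (int \<Rightarrow> bool)) measure)"
    by (intro borel_measurable_continuous_onI continuous_intros)+
  define L where "L = distr P borel ?\<psi>"
  have sets: "sets L = sets borel" by (simp add: L_def)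
  have "prob_space L" unfolding L_def by (rule prob_space_distr) measurable
  moreover have "distr L borel ?S = L"
  proof -
    have "distr L borel ?S = distr P borel (\<lambda>w. ?S (?\<psi> w))"
      unfolding L_def by (simp add: distr_distr comp_def)
    also have "\<dots> = distr P borel (\<lambda>w. ?\<psi> (\<tau> w))"
      by (intro distr_cong refl) (simp add: translated_eta_tau assms)
    also have "\<dots> = distr (distr P P \<tau>) borel ?\<psi>"
      by (simp add: distr_distr comp_def)
    finally show ?thesis by (simp add: tau_invariant L_def)
  qed
  ultimately have "invariant_prob ?S L"
    unfolding invariant_prob_def
    using sets S distr_cong[of L L L borel ?S ?S] measurable_cong_sets[OF sets sets] by auto
  moreover have "distr L borel fst = mirsky_measure C" "distr L borel snd = mirsky_measure B"
    using proj by (simp_all add: L_def distr_distr comp_def)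
  ultimately have L: "L \<in> joinings (mirsky_measure C) (mirsky_measure B)"
    by (simp add: joinings_def)
  have "measure L {(x, y). x 0 \<noteq> y 0} = prob (?\<psi> -` {(x, y). x 0 \<noteq> y 0} \<inter> space P)"
    unfolding L_def
  proof (rule measure_distr[OF \<psi>])
    have "open {p :: (int \<Rightarrow> bool) \<times> (int \<Rightarrow> bool). fst p 0 \<noteq> snd p 0}"
      by (intro open_Collect_neq continuous_intros
          continuous_on_compose2[OF continuous_on_product_coordinates]) auto
    then show "{(x, y). x 0 \<noteq> y 0} \<in> sets (borel :: ((int \<Rightarrow> bool) \<times> (int \<Rightarrow> bool)) measure)"
      by (simp add: case_prod_beta')
  qed
  also have "?\<psi> -` {(x, y). x 0 \<noteq> y 0} \<inter> space P
      = {w \<in> space P. translated_eta C w 0 \<noteq> translated_eta B w 0}" by auto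
  finally show ?thesis using L that by blast
qed

lemma dbar_mirsky_le:
  assumes "0 \<notin> B" "0 \<notin> C"
  shows "dbar (mirsky_measure C) (mirsky_measure B)
    \<le> prob {w \<in> space P. translated_eta C w 0 \<noteq> translated_eta B w 0}"
proof -
  obtain L where L: "L \<in> joinings (mirsky_measure C) (mirsky_measure B)"
    "measure L {(x, y). x 0 \<noteq> y 0} = prob {w \<in> space P. translated_eta C w 0 \<noteq> translated_eta B w 0}"
    by (rule joining_mirsky[OF assms])
  show ?thesis
    unfolding dbar_def L(2)[symmetric]
    by (rule cINF_lower[OF _ L(1)]) (auto intro!: bdd_belowI[of _ 0])
qed

lemma dbar_mirsky_nonneg:
  assumes "0 \<notin> B" "0 \<notin> C"
  shows "0 \<le> dbar (mirsky_measure C) (mirsky_measure B)"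
proof -
  have "joinings (mirsky_measure C) (mirsky_measure B) \<noteq> {}"
    by (rule joining_mirsky[OF assms]) blast
  then show ?thesis unfolding dbar_def by (intro cINF_greatest) auto
qed

lemma periodic_measure_mirsky:
  assumes B: "0 \<notin> B"
  shows "periodic_measure B m = mirsky_measure (smallest B m)"
proof (rule periodic_measure_eq[OF B])
  have B': "0 \<notin> smallest B m" using B smallest_subset[of B m] by auto
  show "ergodic_prob shift_map (mirsky_measure (smallest B m))"
    using odometer_factor.ergodic_factor_measure[OF odometer_factor_translated_eta[OF B']]
    by (simp only: mirsky_measure_eq[OF B'])
  obtain N where N: "\<forall>b\<in>smallest B m. 0 < b \<and> b \<le> N"
    by (rule smallest_bounds[OF B])
  have "measure (mirsky_measure (smallest B m)) (subshift (smallest B m))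
      = prob (translated_eta (smallest B m) -` subshift (smallest B m) \<inter> space P)"
    by (intro measure_distr) (auto simp: subshift_def)
  also have "translated_eta (smallest B m) -` subshift (smallest B m) \<inter> space P = space P"
  proof -
    have "translated_eta (smallest B m) w \<in> subshift (smallest B m)" if "w \<in> space P" for w
      unfolding translated_eta_finite[OF that N] subshift_def shift_orbit_def
      by (intro closure_subset[THEN subsetD]) auto
    then show ?thesis by auto
  qed
  finally show "measure (mirsky_measure (smallest B m)) (subshift (smallest B m)) = 1"
    by (simp add: prob_space)
qed

lemma dbar_periodic_mirsky_tendsto_0:
  assumes B: "0 \<notin> B"
  shows "(\<lambda>m. dbar (periodic_measure B m) (mirsky_measure B)) \<longlonglongrightarrow> 0"
proof (rule tendsto_sandwich[OF _ _ tendsto_const prob_disagree_tendsto_0])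
  have B': "0 \<notin> smallest B m" for m using B smallest_subset[of B m] by auto
  show "\<forall>\<^sub>F m in sequentially. 0 \<le> dbar (periodic_measure B m) (mirsky_measure B)"
    using dbar_mirsky_nonneg[OF B B'] by (simp add: periodic_measure_mirsky[OF B])
  show "\<forall>\<^sub>F m in sequentially. dbar (periodic_measure B m) (mirsky_measure B)
      \<le> prob {w \<in> space P. translated_eta (smallest B m) w 0 \<noteq> translated_eta B w 0}"
    using dbar_mirsky_le[OF B B'] by (simp add: periodic_measure_mirsky[OF B])
qed

lemma average_eta_smallest:
  fixes f :: "(int \<Rightarrow> bool) \<Rightarrow> real"
  assumes B: "0 \<notin> B" and n: "filterlim n at_top sequentially"
  shows "(\<lambda>k. (\<Sum>j<n k. f ((shift_map ^^ j) (eta (smallest B m)))) / real (n k))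
    \<longlonglongrightarrow> (LINT w|P. f (translated_eta (smallest B m) w))"
proof -
  obtain N where N: "\<forall>b\<in>smallest B m. 0 < b \<and> b \<le> N"
    by (rule smallest_bounds[OF B])
  let ?u = "\<lambda>j. f ((shift_map ^^ j) (eta (smallest B m)))"
  have "?u (j + fact N) = ?u j" for j
  proof -
    have "eta (smallest B m) (i + int (j + fact N)) = eta (smallest B m) (i + int j)" for i
    proof -
      have "i + int (j + fact N) = (i + int j) + int (fact N) * 1" by simp
      then show ?thesis
        using eta_periodic[OF N, where j = "i + int j" and k = 1] by (simp only:)
    qed
    then show ?thesis unfolding shift_map_funpow by (simp only:)
  qed
  then have "(\<lambda>n. (\<Sum>j<n. ?u j) / real n) \<longlonglongrightarrow> (\<Sum>s<fact N. ?u s) / real (fact N)"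
    by (intro average_periodic) auto
  from filterlim_compose[OF this n] show ?thesis
    unfolding integral_mirsky_finite[OF N] by (simp add: shift_map_funpow)
qed

text \<open>
  The average along \<open>\<eta>\<^sub>B\<close> is compared with the integral in three steps: with the average along \<open>\<eta>\<^bsub>B(m)\<^esub>\<close>, with
  the integral for \<open>B(m)\<close>, and with the integral for \<open>B\<close>.  Here \<open>m\<close> is chosen first, and then \<open>k\<close> is let go to
  infinity.
\<close>

lemma quasi_generic_mirsky:
  assumes B: "0 \<notin> B" and n: "filterlim n at_top sequentially"
    and close: "(\<lambda>m. limsup (\<lambda>k. ereal
        (real (card {j. j < n k \<and> eta (smallest B m) (int j) \<noteq> eta B (int j)}) / real (n k)))) \<longlonglongrightarrow> 0"
  shows "quasi_generic_along n (eta B) (mirsky_measure B)"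
  unfolding quasi_generic_along_def
proof (intro allI impI)
  fix f :: "(int \<Rightarrow> bool) \<Rightarrow> real" assume f: "continuous_on UNIV f"
  let ?avg = "\<lambda>x k. (\<Sum>j<n k. f ((shift_map ^^ j) x)) / real (n k)"
  let ?d = "\<lambda>m k. real (card {j. j < n k \<and> eta (smallest B m) (int j) \<noteq> eta B (int j)}) / real (n k)"
  let ?I = "\<lambda>m. LINT w|P. f (translated_eta (smallest B m) w)"
  have int: "integral\<^sup>L (mirsky_measure B) f = (LINT w|P. f (translated_eta B w))"
    by (rule integral_mirsky[OF borel_measurable_continuous_onI[OF f]])
  obtain K where K: "0 < K" "\<And>x. \<bar>f x\<bar> \<le> K" using continuous_bool_seq_bounded[OF f] by blast
  show "?avg (eta B) \<longlonglongrightarrow> integral\<^sup>L (mirsky_measure B) f"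
    unfolding int
  proof (rule LIMSEQ_I)
    fix e :: real assume "0 < e"
    then have "0 < e / 8" by simp
    \<comment> \<open>The error \<open>e\<close> splits into \<open>e / 8\<close> for the window, \<open>e / 8\<close> for its boundary, \<open>e / 4\<close> for the
      disagreements of the two sequences, and \<open>e / 4\<close> for each of the two limits.\<close>
    obtain J where J: "finite J" "\<And>x y. (\<And>i. i \<in> J \<Longrightarrow> x i = y i) \<Longrightarrow> \<bar>f x - f y\<bar> < e / 8"
      using continuous_uniform_window[OF f \<open>0 < e / 8\<close>] by blast
    \<comment> \<open>The summand 1 avoids a division by 0 when the window is empty.\<close>
    define c where "c = real (card J) + 1"
    have c: "0 < c" by (simp add: c_def)
    define \<delta> where "\<delta> = e / (8 * K * c)"
    have \<delta>: "0 < \<delta>" using \<open>0 < e\<close> K(1) c by (simp add: \<delta>_def)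
    have "\<forall>\<^sub>F m in sequentially. \<bar>?I m - (LINT w|P. f (translated_eta B w))\<bar> < e / 4"
      using tendstoD[OF tendsto_integral_smallest[OF f, of B], of "e / 4"] \<open>0 < e\<close>
      by (simp add: dist_real_def)
    moreover have "\<forall>\<^sub>F m in sequentially. limsup (\<lambda>k. ereal (?d m k)) < ereal \<delta>"
      using close \<delta> by (intro order_tendstoD(2)[OF close]) simp
    ultimately have "\<forall>\<^sub>F m in sequentially. \<bar>?I m - (LINT w|P. f (translated_eta B w))\<bar> < e / 4
        \<and> limsup (\<lambda>k. ereal (?d m k)) < ereal \<delta>"
      by (rule eventually_conj)
    then have "\<exists>m. \<bar>?I m - (LINT w|P. f (translated_eta B w))\<bar> < e / 4
        \<and> limsup (\<lambda>k. ereal (?d m k)) < ereal \<delta>"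
      by (rule eventually_happens'[rotated]) simp
    then obtain m where m: "\<bar>?I m - (LINT w|P. f (translated_eta B w))\<bar> < e / 4"
      and limsup: "limsup (\<lambda>k. ereal (?d m k)) < ereal \<delta>" by (elim exE conjE)
    have "\<forall>\<^sub>F k in sequentially. ereal (?d m k) < ereal \<delta>" by (rule Limsup_lessD[OF limsup])
    moreover have "\<forall>\<^sub>F k in sequentially. \<bar>?avg (eta (smallest B m)) k - ?I m\<bar> < e / 4"
      using tendstoD[OF average_eta_smallest[OF B n, of f m], of "e / 4"] \<open>0 < e\<close>
      by (simp add: dist_real_def)
    moreover have "\<forall>\<^sub>F k in sequentially. 2 * K * ((\<Sum>i\<in>J. real_of_int \<bar>i\<bar>) / n k) < e / 8"
    proof -
      have "(\<lambda>k. 2 * K * ((\<Sum>i\<in>J. real_of_int \<bar>i\<bar>) / real (n k))) \<longlonglongrightarrow> 2 * K * 0"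
        by (intro tendsto_mult_left filterlim_compose[OF lim_const_over_n n])
      then show ?thesis using \<open>0 < e / 8\<close> by (intro order_tendstoD) auto
    qed
    moreover have "\<forall>\<^sub>F k in sequentially. 0 < n k"
      by (rule eventually_compose_filterlim[OF eventually_gt_at_top n])
    ultimately have "\<forall>\<^sub>F k in sequentially. \<bar>?avg (eta B) k - (LINT w|P. f (translated_eta B w))\<bar> < e"
    proof eventually_elim
      case (elim k)
      have "\<bar>?avg (eta (smallest B m)) k - ?avg (eta B) k\<bar>
          \<le> e / 8 + 2 * K * (card J * ?d m k + (\<Sum>i\<in>J. real_of_int \<bar>i\<bar>) / n k)"
        by (rule average_difference_le[OF J K(2) elim(4)])
      also have "\<dots> = e / 8 + 2 * K * (card J * ?d m k) + 2 * K * ((\<Sum>i\<in>J. real_of_int \<bar>i\<bar>) / n k)"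
        by (simp add: distrib_left)
      also have "2 * K * (card J * ?d m k) \<le> 2 * K * (c * \<delta>)"
        using K(1) elim(1) by (intro mult_left_mono mult_mono) (auto simp: c_def)
      also have "2 * K * (c * \<delta>) = e / 4"
        using K(1) c by (simp add: \<delta>_def field_simps)
      finally show ?case using elim(2,3) m by linarith
    qed
    then show "\<exists>k0. \<forall>k\<ge>k0. norm (?avg (eta B) k - (LINT w|P. f (translated_eta B w))) < e"
      by (simp add: eventually_sequentially)
  qed
qed

end

theorem corollary9p4:
  fixes B :: "nat set" and n :: "nat \<Rightarrow> nat"
  assumes "0 \<notin> B"
    and "strict_mono_on {1..} n"
    and "\<forall>k\<ge>1. 0 < n k"
    and "(\<lambda>m. limsup (\<lambda>k. ereal
            (real (card {j. j < n k \<and> eta (smallest B m) (int j) \<noteq> eta B (int j)}) / real (n k))))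
          \<longlonglongrightarrow> 0"
  shows "\<exists>\<nu>. ergodic_prob shift_map \<nu> \<and> measure \<nu> (subshift B) = 1 \<and>
           (\<lambda>m. dbar (periodic_measure B m) \<nu>) \<longlonglongrightarrow> 0 \<and>
           quasi_generic_along n (eta B) \<nu> \<and>
           rational_discrete_spectrum shift_map \<nu> \<and>
           KS_entropy shift_map \<nu> = 0"
proof -
  interpret odometer digit_measure digit_succ digit_sum by (rule odometer_digits)
  interpret odometer_factor digit_measure digit_succ digit_sum "translated_eta B" shift_map unshift
    by (rule odometer_factor_translated_eta[OF assms(1)])
  have eq: "factor_measure = mirsky_measure B" by (rule factor_measure_def)
  have n: "filterlim n at_top sequentially"
  proof -
    have "strict_mono (\<lambda>k. n (Suc k))"
      using assms(2) by (auto simp: strict_mono_on_def strict_mono_def)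
    then have "filterlim (\<lambda>k. n (Suc k)) at_top sequentially" by (rule filterlim_subseq)
    then show ?thesis by (simp add: filterlim_sequentially_Suc)
  qed
  have q: "quasi_generic_along n (eta B) (mirsky_measure B)"
    by (rule quasi_generic_mirsky[OF assms(1) n assms(4)])
  show ?thesis
  proof (intro exI[of _ "mirsky_measure B"] conjI)
    show "measure (mirsky_measure B) (subshift B) = 1"
      using measure_subshift_quasi_generic[OF _ q n] invariant_factor_measure by (simp only: eq)
    show "(\<lambda>m. dbar (periodic_measure B m) (mirsky_measure B)) \<longlonglongrightarrow> 0"
      by (rule dbar_periodic_mirsky_tendsto_0[OF assms(1)])
  qed (use q ergodic_factor_measure rational_discrete_spectrum_factor KS_entropy_factor in \<open>simp_all only: eq\<close>)
qed

end
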